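(* Let $\Gamma$ be a finite Boolean constraint language such that $\mathrm{W\text{-}Max\text{-}Ones}(\Gamma)$ is NP-hard. Then $\mathrm{W\text{-}Max\text{-}Ones}(R_{II_2}) \le^{\mathrm{CV}} \mathrm{W\text{-}Max\text{-}Ones}(\Gamma)$.
   Context: Let $\mathbb{B}=\{0,1\}$. A (Boolean) constraint language is a finite set $\Gamma$ of finitary relations over $\mathbb{B}$; a single relation $R$ is identified with $\{R\}$. An instance of $\mathrm{W\text{-}Max\text{-}Ones}(\Gamma)$ consists of a finite set of variables $V=\{x_1,\dots,x_n\}$, a finite set of constraints $R(v_1,\dots,v_k)$ with $R\in\Gamma$ of arity $k$ and $v_1,\dots,v_k\in V$, and weights $w_i\in\mathbb{Q}_{\ge 0}$; a solution is a map $h:V\to\mathbb{B}$ with $(h(v_1),\dots,h(v_k))\in R$ for every constraint, and the goal is to maximize $\sum_i w_i h(x_i)$. It is treated as a decision problem: given additionally a number $k$, is there a solution with objective value at least $k$? The set of variables of an instance $I$ is $\mathrm{var}(I)$. A CV-reduction from problem $A_1$ to problem $A_2$ is a function $f$ from instances of $A_1$ to instances of $A_2$, computable in time polynomial in the size of $I$, such that $I$ is a yes-instance iff $f(I)$ is a yes-instance, and $|\mathrm{var}(f(I))| = |\mathrm{var}(I)| + O(1)$; write $A_1\le^{\mathrm{CV}}A_2$ if one exists. $R_{II_2}=\{(x_1,\dots,x_6,c_0,c_1)\in\mathbb{B}^8 : (x_1,x_2,x_3)\in\{(0,0,1),(0,1,0),(1,0,0)\},\ x_4=1-x_1,\ x_5=1-x_2,\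 x_6=1-x_3,\ c_0=0,\ c_1=1\}$. *)

theory Defs
  imports Complex_Main "HOL-Computational_Algebra.Polynomial"
begin

text \<open>
  Computation model: structured programs with finitely many stacks over a fixed finite alphabet.
  Every primitive step and every test inspects or changes only the top symbol of one stack and
  costs one time unit. A tape is a pair of stacks and conversely, so up to constant factors this
  is the multitape Turing machine. Popping the empty stack has no effect.
\<close>

datatype symbol = B0 | B1 | LP | RP

type_synonym word = "symbol list"

datatype prog =
    Skip
  | Push nat symbol
  | Pop nat
  | Seq prog prog
  | IfTop nat "symbol option set" prog prog
  | WhileTop nat "symbol option set" prog

type_synonym store = "nat \<Rightarrow> word"

definition top_of :: "word \<Rightarrow> symbol option" where
  "top_of w = (case w of [] \<Rightarrow> None | a # _ \<Rightarrow> Some a)"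

inductive exec :: "prog \<Rightarrow> store \<Rightarrow> nat \<Rightarrow> store \<Rightarrow> bool" where
  exec_Skip: "exec Skip s 1 s"
| exec_Push: "exec (Push r a) s 1 (s(r := a # s r))"
| exec_Pop: "exec (Pop r) s 1 (s(r := tl (s r)))"
| exec_Seq: "exec p s m s' \<Longrightarrow> exec q s' n s'' \<Longrightarrow> exec (Seq p q) s (m + n) s''"
| exec_IfTrue: "top_of (s r) \<in> A \<Longrightarrow> exec p s n s' \<Longrightarrow> exec (IfTop r A p q) s (Suc n) s'"
| exec_IfFalse: "top_of (s r) \<notin> A \<Longrightarrow> exec q s n s' \<Longrightarrow> exec (IfTop r A p q) s (Suc n) s'"
| exec_WhileFalse: "top_of (s r) \<notin> A \<Longrightarrow> exec (WhileTop r A p) s 1 s"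
| exec_WhileTrue: "top_of (s r) \<in> A \<Longrightarrow> exec p s m s' \<Longrightarrow> exec (WhileTop r A p) s' n s'' \<Longrightarrow>
    exec (WhileTop r A p) s (Suc (m + n)) s''"

inductive_cases exec_SkipE: "exec Skip s n t"
inductive_cases exec_PushE: "exec (Push r a) s n t"
inductive_cases exec_PopE: "exec (Pop r) s n t"
inductive_cases exec_SeqE: "exec (Seq p q) s n t"
inductive_cases exec_IfE: "exec (IfTop r A p q) s n t"
inductive_cases exec_WhileE: "exec (WhileTop r A p) s n t"

lemma exec_deterministic:
  "exec p s n t \<Longrightarrow> exec p s n' t' \<Longrightarrow> n' = n \<and> t' = t"
proof (induction arbitrary: n' t' rule: exec.induct)
  case exec_Skip then show ?case by (auto elim: exec_SkipE)
next
  case exec_Push then show ?case by (auto elim: exec_PushE)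
next
  case exec_Pop then show ?case by (auto elim: exec_PopE)
next
  case exec_Seq then show ?case by (blast elim: exec_SeqE)
next
  case exec_IfTrue then show ?case by (blast elim: exec_IfE)
next
  case exec_IfFalse then show ?case by (blast elim: exec_IfE)
next
  case exec_WhileFalse then show ?case by (auto elim: exec_WhileE)
next
  case exec_WhileTrue then show ?case by (blast elim: exec_WhileE)
qed

text \<open>The inputs are placed on the first stacks, the output is read off stack 0.\<close>

definition init_store :: "word list \<Rightarrow> store" where
  "init_store xs = (\<lambda>i. if i < length xs then xs ! i else [])"

definition outputs_within :: "prog \<Rightarrow> word list \<Rightarrow> nat \<Rightarrow> word \<Rightarrow> bool" where
  "outputs_within P xs n y \<longleftrightarrow> (\<exists>t s. exec P (init_store xs) t s \<and> t \<le> n \<and> s 0 = y)"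

definition poly_time_computable ::
    "('a \<Rightarrow> word) \<Rightarrow> ('b \<Rightarrow> word) \<Rightarrow> 'a set \<Rightarrow> ('a \<Rightarrow> 'b) \<Rightarrow> bool" where
  "poly_time_computable enc_in enc_out D f \<longleftrightarrow>
     (\<exists>P (p :: nat poly). \<forall>x\<in>D.
        outputs_within P [enc_in x] (poly p (length (enc_in x))) (enc_out (f x)))"

definition in_NP :: "word set \<Rightarrow> bool" where
  "in_NP L \<longleftrightarrow>
     (\<exists>ver P (p :: nat poly) (q :: nat poly).
        (\<forall>x y. length y \<le> poly q (length x) \<longrightarrow>
           outputs_within P [x, y] (poly p (length x)) [if ver x y then B1 else B0]) \<and>
        L = {x. \<exists>y. length y \<le> poly q (length x) \<and> ver x y})"

record 'i problem =
  instances :: "'i set"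
  yes_instance :: "'i \<Rightarrow> bool"
  var :: "'i \<Rightarrow> nat set"
  enc :: "'i \<Rightarrow> word"

definition NP_hard :: "'i problem \<Rightarrow> bool" where
  "NP_hard A \<longleftrightarrow>
     (\<forall>L. in_NP L \<longrightarrow>
        (\<exists>f. (\<forall>x. f x \<in> instances A) \<and>
             (\<forall>x. x \<in> L \<longleftrightarrow> yes_instance A (f x)) \<and>
             poly_time_computable (\<lambda>x. x) (enc A) UNIV f))"

definition CV_reduction :: "'i problem \<Rightarrow> 'j problem \<Rightarrow> ('i \<Rightarrow> 'j) \<Rightarrow> bool" where
  "CV_reduction A\<^sub>1 A\<^sub>2 f \<longleftrightarrow>
     (\<forall>I\<in>instances A\<^sub>1. f I \<in> instances A\<^sub>2) \<and>
     poly_time_computable (enc A\<^sub>1) (enc A\<^sub>2) (instances A\<^sub>1) f \<and>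
     (\<forall>I\<in>instances A\<^sub>1. yes_instance A\<^sub>1 I \<longleftrightarrow> yes_instance A\<^sub>2 (f I)) \<and>
     (\<exists>c. \<forall>I\<in>instances A\<^sub>1. \<bar>int (card (var A\<^sub>2 (f I))) - int (card (var A\<^sub>1 I))\<bar> \<le> c)"

definition CV_reducible :: "'i problem \<Rightarrow> 'j problem \<Rightarrow> bool" (infix "\<le>\<^sub>C\<^sub>V" 50) where
  "A\<^sub>1 \<le>\<^sub>C\<^sub>V A\<^sub>2 \<longleftrightarrow> (\<exists>f. CV_reduction A\<^sub>1 A\<^sub>2 f)"

text \<open>The arity is stored explicitly, so that empty relations of different arities differ.\<close>

datatype brel = Rel (arity: nat) (tuples: "bool list set")

definition constraint_language :: "brel set \<Rightarrow> bool" where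
  "constraint_language \<Gamma> \<longleftrightarrow> finite \<Gamma> \<and> (\<forall>R\<in>\<Gamma>. \<forall>t\<in>tuples R. length t = arity R)"

text \<open>
  The variables of an instance are the indices of its list of weights. The finite set of
  constraints is presented as a list; order and repetitions do not affect the solutions.
\<close>

record wmo_instance =
  weights :: "rat list"
  constraints :: "(brel \<times> nat list) list"
  threshold :: rat

definition wmo_var :: "wmo_instance \<Rightarrow> nat set" where
  "wmo_var I = {..<length (weights I)}"

definition wmo_instances :: "brel set \<Rightarrow> wmo_instance set" where
  "wmo_instances \<Gamma> =
     {I. (\<forall>w\<in>set (weights I). 0 \<le> w) \<and>
         (\<forall>(R, vs)\<in>set (constraints I).
            R \<in> \<Gamma> \<and> length vs = arity R \<and> set vs \<subseteq> wmo_var I)}"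

definition wmo_solution :: "wmo_instance \<Rightarrow> (nat \<Rightarrow> bool) \<Rightarrow> bool" where
  "wmo_solution I h \<longleftrightarrow> (\<forall>(R, vs)\<in>set (constraints I). map h vs \<in> tuples R)"

definition wmo_value :: "wmo_instance \<Rightarrow> (nat \<Rightarrow> bool) \<Rightarrow> rat" where
  "wmo_value I h = (\<Sum>i\<in>wmo_var I. weights I ! i * of_bool (h i))"

definition wmo_yes :: "wmo_instance \<Rightarrow> bool" where
  "wmo_yes I \<longleftrightarrow> (\<exists>h. wmo_solution I h \<and> threshold I \<le> wmo_value I h)"

text \<open>
  Instances are written as bracketed words, with numbers in binary (least significant bit first)
  and relations given by their truth tables.
\<close>

fun bits :: "nat \<Rightarrow> word" where
  "bits n = (if n = 0 then [] else (if odd n then B1 else B0) # bits (n div 2))"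

declare bits.simps [simp del]

definition enc_nat :: "nat \<Rightarrow> word" where
  "enc_nat n = LP # bits n @ [RP]"

definition enc_list :: "('a \<Rightarrow> word) \<Rightarrow> 'a list \<Rightarrow> word" where
  "enc_list e xs = LP # concat (map e xs) @ [RP]"

definition enc_bool :: "bool \<Rightarrow> word" where
  "enc_bool b = [if b then B1 else B0]"

definition enc_rat :: "rat \<Rightarrow> word" where
  "enc_rat r = (case quotient_of r of (a, b) \<Rightarrow>
     enc_bool (a < 0) @ enc_nat (nat \<bar>a\<bar>) @ enc_nat (nat b))"

definition enc_brel :: "brel \<Rightarrow> word" where
  "enc_brel R =
     enc_list (\<lambda>t. enc_bool (t \<in> tuples R)) (List.n_lists (arity R) [False, True])"

definition enc_constraint :: "brel \<times> nat list \<Rightarrow> word" where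
  "enc_constraint C = enc_brel (fst C) @ enc_list enc_nat (snd C)"

definition enc_wmo :: "wmo_instance \<Rightarrow> word" where
  "enc_wmo I =
     enc_list enc_rat (weights I) @ enc_list enc_constraint (constraints I) @
     enc_rat (threshold I)"

definition W_Max_Ones :: "brel set \<Rightarrow> wmo_instance problem" where
  "W_Max_Ones \<Gamma> =
     \<lparr>instances = wmo_instances \<Gamma>, yes_instance = wmo_yes, var = wmo_var, enc = enc_wmo\<rparr>"

definition R_II2 :: brel where
  "R_II2 = Rel 8
     {[x1, x2, x3, x4, x5, x6, c0, c1] | x1 x2 x3 x4 x5 x6 c0 c1.
        (x1, x2, x3) \<in> {(False, False, True), (False, True, False), (True, False, False)} \<and>
        x4 = (\<not> x1) \<and> x5 = (\<not> x2) \<and> x6 = (\<not> x3) \<and> c0 = False \<and> c1 = True}"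

end

theory Submission imports Defs begin

text \<open>
  Call \<open>\<Gamma>\<close> easy if all its nonempty relations contain the all-one tuple, or all its relations are
  closed under disjunction, or all are closed under \<open>maj(x, y, \<not> z)\<close>.

  If \<open>\<Gamma>\<close> is not easy, three relations witnessing this yield, after identifying their arguments,
  constraints on the eight variables of a constraint \<open>R_II2\<close>, such that the tuples of \<open>R_II2\<close> are exactly
  the admitted tuples of maximal weight for suitable weights. Scaling these weights by a number
  exceeding the total weight of the instance forces maximality in every constraint, so no variable has to
  be added.

  If \<open>\<Gamma>\<close> is easy, then an optimal solution is found in polynomial time: in the first two cases it
  is the greatest solution; in the third case all constraints are equations \<open>x + y = b\<close> modulo 2, whose
  connected components can be optimised independently. As the source problem is in NP, the assumed
  NP-hardness then makes it decidable in polynomial time, and the reduction outputs a yes- or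
  no-instance without constraints on as many variables of weight 0.
\<close>

section \<open>Stack programs\<close>

text \<open>The gadgets rest on one fact: on its three tuples the eight coordinates of
  \<open>R_II2\<close> show all eight columns in {0,1}^3. So for any three tuples of a relation,
  every argument position can be given the slot with the same column, and the resulting constraint
  holds throughout \<open>R_II2\<close>. The other assignments of the slots produce disjunctions,
  conjunctions, \<open>maj\<close> or its variant with a negated argument, and the failure of a
  closure property says that one of these is forbidden.

  The easy case cannot be dismissed, because P = NP is not excluded. The reduction supplied by
  NP-hardness may change the number of variables arbitrarily, so only the answer is extracted from
  it.

  Since the machine model is explicit, polynomial time is established through closure properties of
  a class of functions on self-delimiting data. Its iteration scheme is a left fold with
  accumulators of polynomial size, and the algorithms are written as such folds.\<close>

definition runs :: "prog \<Rightarrow> store \<Rightarrow> store \<Rightarrow> nat \<Rightarrow> bool" where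
  "runs P s s' T \<longleftrightarrow> (\<exists>t\<le>T. exec P s t s')"

lemma runs_mono: "runs P s s' T \<Longrightarrow> T \<le> T' \<Longrightarrow> runs P s s' T'"
  unfolding runs_def using le_trans by blast

lemma runs_cong: "runs P s s' T \<Longrightarrow> s' = s'' \<Longrightarrow> T \<le> T' \<Longrightarrow> runs P s s'' T'"
  using runs_mono by blast

lemma runs_Skip: "runs Skip s s 1"
  unfolding runs_def using exec_Skip by blast

lemma runs_Push: "runs (Push r a) s (s(r := a # s r)) 1"
  unfolding runs_def using exec_Push by blast

lemma runs_Pop: "runs (Pop r) s (s(r := tl (s r))) 1"
  unfolding runs_def using exec_Pop by blast

lemma runs_Seq: "runs p s s1 m \<Longrightarrow> runs q s1 s2 n \<Longrightarrow> runs (Seq p q) s s2 (m + n)"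
  unfolding runs_def using exec_Seq add_le_mono by blast

lemma runs_IfTrue: "top_of (s r) \<in> A \<Longrightarrow> runs p s s' n \<Longrightarrow> runs (IfTop r A p q) s s' (Suc n)"
  unfolding runs_def using exec_IfTrue Suc_le_mono by blast

lemma runs_IfFalse: "top_of (s r) \<notin> A \<Longrightarrow> runs q s s' n \<Longrightarrow> runs (IfTop r A p q) s s' (Suc n)"
  unfolding runs_def using exec_IfFalse Suc_le_mono by blast

lemma runs_If:
  assumes "top_of (s r) \<in> A \<Longrightarrow> runs p s s' n" "top_of (s r) \<notin> A \<Longrightarrow> runs q s s' n"
  shows "runs (IfTop r A p q) s s' (Suc n)"
  using runs_IfTrue[OF _ assms(1)] runs_IfFalse[OF _ assms(2)] by (cases "top_of (s r) \<in> A") simp_all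

lemma runs_WhileFalse: "top_of (s r) \<notin> A \<Longrightarrow> runs (WhileTop r A p) s s 1"
  unfolding runs_def using exec_WhileFalse by blast

lemma runs_WhileTrue:
  "top_of (s r) \<in> A \<Longrightarrow> runs p s s1 m \<Longrightarrow> runs (WhileTop r A p) s1 s2 n \<Longrightarrow>
   runs (WhileTop r A p) s s2 (Suc (m + n))"
  unfolding runs_def using exec_WhileTrue add_le_mono Suc_le_mono by meson

lemma top_of_simps [simp]: "top_of [] = None" "top_of (a # w) = Some a"
  by (simp_all add: top_of_def)

lemma top_of_in_range_Some [simp]: "top_of w \<in> range Some \<longleftrightarrow> w \<noteq> []"
  by (cases w) auto

section \<open>Frame property of programs\<close>

fun below :: "nat \<Rightarrow> prog \<Rightarrow> bool" where
  "below N Skip \<longleftrightarrow> True"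
| "below N (Push r a) \<longleftrightarrow> r < N"
| "below N (Pop r) \<longleftrightarrow> r < N"
| "below N (Seq p q) \<longleftrightarrow> below N p \<and> below N q"
| "below N (IfTop r A p q) \<longleftrightarrow> r < N \<and> below N p \<and> below N q"
| "below N (WhileTop r A p) \<longleftrightarrow> r < N \<and> below N p"

lemma below_mono: "below N P \<Longrightarrow> N \<le> N' \<Longrightarrow> below N' P"
  by (induction P) auto

lemma ex_below: "\<exists>N>0. below N P"
proof (induction P)
  case (Seq p q)
  then obtain M N where "M > 0" "below M p" "below N q" by blast
  then have "below (max M N) (Seq p q)" by (auto intro: below_mono)
  then show ?case using \<open>M > 0\<close> by (metis less_max_iff_disj)
next
  case (IfTop r A p q)
  then obtain M N where "M > 0" "below M p" "below N q" by blast
  then have "below (max (Suc r) (max M N)) (IfTop r A p q)" by (auto intro: below_mono)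
  then show ?case by (metis less_max_iff_disj zero_less_Suc)
next
  case (WhileTop r A p)
  then obtain N where "below N p" by blast
  then have "below (max (Suc r) N) (WhileTop r A p)" by (auto intro: below_mono)
  then show ?case by (metis less_max_iff_disj zero_less_Suc)
qed (auto intro: exI[of _ "Suc _"])

text \<open>A program neither reads nor writes the stacks from \<open>N\<close> on, so its run
  carries over to any store that agrees below \<open>N\<close>. This makes it usable as a subroutine
  while other data wait on higher stacks.\<close>

lemma exec_frame:
  "exec P s t s' \<Longrightarrow> below N P \<Longrightarrow> (\<And>i. i < N \<Longrightarrow> r i = s i) \<Longrightarrow>
   exec P r t (\<lambda>i. if i < N then s' i else r i)"
proof (induction arbitrary: r rule: exec.induct)
  case (exec_Skip s)
  then have "(\<lambda>i. if i < N then s i else r i) = r" by auto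
  then show ?case using exec.exec_Skip[of r] by simp
next
  case (exec_Push k a s)
  then have "(\<lambda>i. if i < N then (s(k := a # s k)) i else r i) = r(k := a # r k)" by auto
  then show ?case by (simp only: exec.exec_Push)
next
  case (exec_Pop k s)
  then have "(\<lambda>i. if i < N then (s(k := tl (s k))) i else r i) = r(k := tl (r k))" by auto
  then show ?case by (simp only: exec.exec_Pop)
next
  case (exec_Seq p s m s' q n s'')
  from exec_Seq.prems have b: "below N p" "below N q" by auto
  have 1: "exec p r m (\<lambda>i. if i < N then s' i else r i)"
    by (rule exec_Seq.IH(1)[OF b(1) exec_Seq.prems(2)])
  have 2: "exec q (\<lambda>i. if i < N then s' i else r i) n
    (\<lambda>i. if i < N then s'' i else (if i < N then s' i else r i))"
    by (rule exec_Seq.IH(2)[OF b(2)]) simp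
  have eq: "(\<lambda>i. if i < N then s'' i else (if i < N then s' i else r i)) =
    (\<lambda>i. if i < N then s'' i else r i)" by auto
  show ?case using exec.exec_Seq[OF 1 2] unfolding eq .
next
  case (exec_IfTrue s k A p n s' q)
  then show ?case by (intro exec.exec_IfTrue) auto
next
  case (exec_IfFalse s k A q n s' p)
  then show ?case by (intro exec.exec_IfFalse) auto
next
  case (exec_WhileFalse s k A p)
  then have "(\<lambda>i. if i < N then s i else r i) = r" by auto
  moreover have "top_of (r k) \<notin> A" using exec_WhileFalse by simp
  ultimately show ?case using exec.exec_WhileFalse[of r k A p] by simp
next
  case (exec_WhileTrue s k A p m s' n s'')
  from exec_WhileTrue.prems have b: "below N p" "k < N" by auto
  have 1: "exec p r m (\<lambda>i. if i < N then s' i else r i)"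
    by (rule exec_WhileTrue.IH(1)) (use b exec_WhileTrue.prems(2) in auto)
  have 2: "exec (WhileTop k A p) (\<lambda>i. if i < N then s' i else r i) n
    (\<lambda>i. if i < N then s'' i else (if i < N then s' i else r i))"
    by (rule exec_WhileTrue.IH(2)[OF exec_WhileTrue.prems(1)]) simp
  have eq: "(\<lambda>i. if i < N then s'' i else (if i < N then s' i else r i)) =
    (\<lambda>i. if i < N then s'' i else r i)" by auto
  have "top_of (r k) \<in> A" using exec_WhileTrue.hyps exec_WhileTrue.prems(2) b by simp
  then show ?case using exec.exec_WhileTrue[OF _ 1 2] unfolding eq by blast
qed

text \<open>One step pushes at most one symbol. Time bounds thus also bound the sizes of
  outputs.\<close>

lemma exec_length: "exec P s t s' \<Longrightarrow> length (s' i) \<le> length (s i) + t"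
proof (induction arbitrary: i rule: exec.induct)
  case (exec_Seq p s m s' q n s'')
  from exec_Seq.IH(1)[of i] exec_Seq.IH(2)[of i] show ?case by linarith
next
  case (exec_WhileTrue s r A p m s' n s'')
  from exec_WhileTrue.IH(1)[of i] exec_WhileTrue.IH(2)[of i] show ?case by linarith
qed (auto simp: le_SucI)

text \<open>Calling convention of all subroutines: every stack but stack 0 is empty before and after
  the run, so that programs can be chained and framed.\<close>

definition clean :: "word \<Rightarrow> store" where
  "clean w = (\<lambda>i. if i = 0 then w else [])"

lemma clean_simps [simp]: "clean w 0 = w" "i > 0 \<Longrightarrow> clean w i = []"
  by (simp_all add: clean_def)

lemma clean_init_store: "clean w = init_store [w]"
  by (auto simp: clean_def init_store_def)

lemma runs_frame:
  assumes "runs P (clean u) (clean v) T" "below N P" "s 0 = u" "\<And>i. 0 < i \<Longrightarrow> i < N \<Longrightarrow> s i = []" "N > 0"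
    and "s' = s(0 := v)"
  shows "runs P s s' T"
proof -
  obtain t where t: "t \<le> T" "exec P (clean u) t (clean v)" using assms(1) by (auto simp: runs_def)
  have "exec P s t (\<lambda>i. if i < N then clean v i else s i)"
    by (rule exec_frame[OF t(2) assms(2)]) (use assms in \<open>auto simp: clean_def\<close>)
  also have "(\<lambda>i. if i < N then clean v i else s i) = s'"
    using assms by (auto simp: clean_def fun_eq_iff)
  finally show ?thesis using t(1) by (auto simp: runs_def)
qed

section \<open>Moving, copying and erasing words\<close>

definition put_top :: "nat \<Rightarrow> nat \<Rightarrow> prog" where
  "put_top a b = IfTop a {Some B0} (Push b B0) (IfTop a {Some B1} (Push b B1)
     (IfTop a {Some LP} (Push b LP) (Push b RP)))"

lemma runs_put_top: "s a = x # xs \<Longrightarrow> runs (put_top a b) s (s(b := x # s b)) 4"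
  unfolding put_top_def
  by (rule runs_mono[where T = "Suc (Suc (Suc 1))"], intro runs_If; cases x)
    (auto intro: runs_mono[OF runs_Push])

definition move :: "nat \<Rightarrow> nat \<Rightarrow> prog" where
  "move a b = WhileTop a (range Some) (Seq (put_top a b) (Pop a))"

lemma runs_move:
  assumes "a \<noteq> b" and "s' = s(a := [], b := rev (s a) @ s b)"
  shows "runs (move a b) s s' (6 * length (s a) + 1)"
  using assms(2)
proof (induction "s a" arbitrary: s)
  case Nil
  then have "s' = s" using assms(1) by auto
  then show ?case unfolding move_def using Nil by (auto intro!: runs_mono[OF runs_WhileFalse])
next
  case (Cons x xs)
  let ?s1 = "s(b := x # s b, a := xs)"
  have 1: "runs (Seq (put_top a b) (Pop a)) s ?s1 (4 + 1)"
    by (rule runs_Seq[OF runs_put_top[where xs = xs]])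
      (use assms(1) runs_Pop[of a "s(b := x # s b)"] in \<open>auto simp flip: Cons.hyps(2)\<close>)
  have e: "?s1 a = xs" using assms(1) by simp
  have "runs (move a b) ?s1 s' (6 * length (?s1 a) + 1)"
    by (rule Cons.hyps(1))
      (simp_all add: Cons.prems fun_eq_iff assms(1) assms(1)[symmetric] flip: Cons.hyps(2))
  from runs_WhileTrue[OF _ 1 this[unfolded move_def e]]
  show ?case unfolding move_def by (rule runs_mono) (simp_all flip: Cons.hyps(2))
qed

text \<open>Emptying a stack reverses its content, so a copy that keeps the original needs two
  targets: \<open>c\<close> is moved back to restore \<open>a\<close>, while the copy on
  \<open>b\<close> remains reversed.\<close>

definition copy :: "nat \<Rightarrow> nat \<Rightarrow> nat \<Rightarrow> prog" where
  "copy a b c = Seq (WhileTop a (range Some) (Seq (put_top a b) (Seq (put_top a c) (Pop a)))) (move c a)"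

lemma runs_copy_loop:
  assumes "a \<noteq> b" "a \<noteq> c" "b \<noteq> c" and "s' = s(a := [], b := rev (s a) @ s b, c := rev (s a) @ s c)"
  shows "runs (WhileTop a (range Some) (Seq (put_top a b) (Seq (put_top a c) (Pop a)))) s s' (10 * length
      (s a) + 1)"
  using assms(4)
proof (induction "s a" arbitrary: s)
  case Nil
  then have "s' = s" using assms(1-3) by auto
  then show ?case using Nil by (auto intro!: runs_mono[OF runs_WhileFalse])
next
  case (Cons x xs)
  let ?s1 = "s(b := x # s b, c := x # s c, a := xs)"
  let ?W = "WhileTop a (range Some) (Seq (put_top a b) (Seq (put_top a c) (Pop a)))"
  have p: "runs (Pop a) (s(b := x # s b, c := x # s c)) ?s1 1"
    using runs_Pop[of a "s(b := x # s b, c := x # s c)"] assms by (simp flip: Cons.hyps(2))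
  have q: "runs (put_top a c) (s(b := x # s b)) (s(b := x # s b, c := x # s c)) 4"
    using runs_put_top[of "s(b := x # s b)" a x xs c] assms by (simp flip: Cons.hyps(2))
  have 1: "runs (Seq (put_top a b) (Seq (put_top a c) (Pop a))) s ?s1 (4 + (4 + 1))"
    by (rule runs_Seq[OF runs_put_top[where xs = xs] runs_Seq[OF q p]]) (simp flip: Cons.hyps(2))
  have e: "?s1 a = xs" using assms(1) by simp
  have "runs ?W ?s1 s' (10 * length (?s1 a) + 1)"
    by (rule Cons.hyps(1))
      (simp_all add: Cons.prems fun_eq_iff assms(1-3) assms(1-3)[symmetric] flip: Cons.hyps(2))
  from runs_WhileTrue[OF _ 1 this[unfolded e]]
  show ?case by (rule runs_mono) (simp_all flip: Cons.hyps(2))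
qed

lemma runs_copy:
  assumes "a \<noteq> b" "a \<noteq> c" "b \<noteq> c" "s c = []" and "s' = s(b := rev (s a) @ s b)"
  shows "runs (copy a b c) s s' (16 * length (s a) + 2)"
proof -
  have 1: "runs (move c a) (s(a := [], b := rev (s a) @ s b, c := rev (s a) @ s c)) s' (6 * length (s a) + 1)"
    by (rule runs_mono[OF runs_move]) (use assms in \<open>auto simp: fun_eq_iff\<close>)
  show ?thesis unfolding copy_def
    by (rule runs_mono[OF runs_Seq[OF runs_copy_loop[OF assms(1-3) refl] 1]]) simp
qed

definition clear :: "nat \<Rightarrow> prog" where
  "clear a = WhileTop a (range Some) (Pop a)"

lemma runs_clear: "s' = s(a := []) \<Longrightarrow> runs (clear a) s s' (2 * length (s a) + 1)"
proof (induction "s a" arbitrary: s)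
  case Nil
  then have "s' = s" by auto
  then show ?case unfolding clear_def using Nil by (auto intro!: runs_mono[OF runs_WhileFalse])
next
  case (Cons x xs)
  have "runs (clear a) (s(a := tl (s a))) s' (2 * length (tl (s a)) + 1)"
    using Cons.hyps(1)[of "s(a := tl (s a))"] by (simp add: Cons.prems flip: Cons.hyps(2))
  from runs_WhileTrue[OF _ runs_Pop this[unfolded clear_def]]
  show ?case unfolding clear_def by (rule runs_mono) (simp_all flip: Cons.hyps(2))
qed

fun push_word :: "nat \<Rightarrow> word \<Rightarrow> prog" where
  "push_word a [] = Skip"
| "push_word a (x # xs) = Seq (push_word a xs) (Push a x)"

lemma runs_push_word: "runs (push_word a w) s (s(a := w @ s a)) (length w + 1)"
proof (induction w)
  case (Cons x w)
  show ?case unfolding push_word.simps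
    by (rule runs_cong[OF runs_Seq[OF Cons runs_Push[of a x]]]) auto
qed (use runs_Skip in \<open>simp add: fun_upd_idem\<close>)

section \<open>Self-delimiting bracketed words\<close>

inductive item :: "word \<Rightarrow> bool" where
  "item [B0]"
| "item [B1]"
| "(\<And>w. w \<in> set ws \<Longrightarrow> item w) \<Longrightarrow> item (LP # concat ws @ [RP])"

lemma item_hd: "item w \<Longrightarrow> \<exists>x v. w = x # v \<and> x \<noteq> RP"
  by (induction rule: item.induct) auto

text \<open>Stack \<open>d\<close> holds the current bracket depth in unary, so the end of an item
  is recognised without knowing its length.\<close>

definition item_step :: "nat \<Rightarrow> nat \<Rightarrow> nat \<Rightarrow> prog" where
  "item_step a b d = Seq (IfTop a {Some LP} (Push d B1) (IfTop a {Some RP} (Pop d) Skip))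
     (Seq (put_top a b) (Pop a))"

definition depth_change :: "symbol \<Rightarrow> word \<Rightarrow> word" where
  "depth_change x w = (if x = LP then B1 # w else if x = RP then tl w else w)"

lemma runs_item_step:
  assumes "s a = x # r" "a \<noteq> b" "a \<noteq> d" "b \<noteq> d"
  shows "runs (item_step a b d) s (s(a := r, b := x # s b, d := depth_change x (s d))) 8"
proof -
  let ?s1 = "s(d := depth_change x (s d))"
  have 1: "runs (IfTop a {Some LP} (Push d B1) (IfTop a {Some RP} (Pop d) Skip)) s ?s1 3"
    by (rule runs_mono[where T = "Suc (Suc 1)"], intro runs_If; cases x)
      (use assms in \<open>auto intro: runs_mono[OF runs_Push] runs_mono[OF runs_Pop] runs_mono[OF runs_Skip]
        simp: depth_change_def\<close>)
  have 2: "runs (put_top a b) ?s1 (?s1(b := x # ?s1 b)) 4"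
    by (rule runs_put_top) (use assms in auto)
  have e: "(?s1(b := x # ?s1 b))(a := tl ((?s1(b := x # ?s1 b)) a)) =
      s(a := r, b := x # s b, d := depth_change x (s d))" using assms by (auto simp: fun_eq_iff)
  have 3: "runs (Pop a) (?s1(b := x # ?s1 b)) (s(a := r, b := x # s b, d := depth_change x (s d))) 1"
    using runs_Pop[of a "?s1(b := x # ?s1 b)"] unfolding e .
  show ?thesis unfolding item_step_def by (rule runs_mono[OF runs_Seq[OF 1 runs_Seq[OF 2 3]]]) simp
qed

definition item_loop :: "nat \<Rightarrow> nat \<Rightarrow> nat \<Rightarrow> prog" where
  "item_loop a b d = WhileTop d {Some B1} (item_step a b d)"

lemma runs_item_loop_step:
  assumes "s a = x # r" "s d = B1 # ds" "a \<noteq> b" "a \<noteq> d" "b \<noteq> d"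
    and "runs (item_loop a b d) s1 s' T" and "s1 = s(a := r, b := x # s b, d := depth_change x (s d))"
  shows "runs (item_loop a b d) s s' (T + 10)"
proof -
  have 1: "runs (item_step a b d) s s1 8"
    unfolding assms(7) by (rule runs_item_step) (use assms in auto)
  show ?thesis unfolding item_loop_def
    by (rule runs_mono[OF runs_WhileTrue[OF _ 1 assms(6)[unfolded item_loop_def]]])
      (use assms(2) in auto)
qed

text \<open>The assumption \<open>one\<close> is what an induction over items supplies for the
  components of a bracket. Stated separately, the lemma serves both nested brackets and the
  outermost one.\<close>

lemma runs_item_loop_concat:
  assumes d: "a \<noteq> b" "a \<noteq> d" "b \<noteq> d"
    and one: "\<And>v s r ds s1 s' T. v \<in> set ws \<Longrightarrow> s a = v @ r \<Longrightarrow> s d = B1 # ds \<Longrightarrow>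
      runs (item_loop a b d) s1 s' T \<Longrightarrow> s1 = s(a := r, b := rev v @ s b) \<Longrightarrow>
      runs (item_loop a b d) s s' (T + 10 * length v)"
  shows "s a = concat ws @ r \<Longrightarrow> s d = B1 # ds \<Longrightarrow>
    runs (item_loop a b d) s1 s' T \<Longrightarrow> s1 = s(a := r, b := rev (concat ws) @ s b) \<Longrightarrow>
    runs (item_loop a b d) s s' (T + 10 * length (concat ws))"
  using one
proof (induction ws arbitrary: s)
  case Nil
  then have "s1 = s" by (auto simp: fun_eq_iff)
  then show ?case using Nil(3) by simp
next
  case (Cons v vs)
  let ?s2 = "s(a := concat vs @ r, b := rev v @ s b)"
  have "runs (item_loop a b d) ?s2 s' (T + 10 * length (concat vs))"
    by (rule Cons.IH[OF _ _ Cons.prems(3) _ Cons.prems(5)])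
      (use Cons.prems(1,2,4) d in \<open>auto simp: fun_eq_iff\<close>)
  from Cons.prems(5)[OF _ _ Cons.prems(2) this refl] Cons.prems(1)
  show ?case by (simp add: algebra_simps)
qed

text \<open>Inside an outer bracket the loop does not stop at the end of \<open>w\<close>. The
  statement is therefore in continuation form: whatever run of the loop follows the item, reading
  \<open>w\<close> first prolongs it by at most \<open>10 * length w\<close>.\<close>

lemma runs_item_loop:
  assumes "item w" and d: "a \<noteq> b" "a \<noteq> d" "b \<noteq> d"
  shows "s a = w @ r \<Longrightarrow> s d = B1 # ds \<Longrightarrow>
    runs (item_loop a b d) s1 s' T \<Longrightarrow> s1 = s(a := r, b := rev w @ s b) \<Longrightarrow>
    runs (item_loop a b d) s s' (T + 10 * length w)"
  using assms(1)
proof (induction arbitrary: s r ds T s1 s' rule: item.induct)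
  case 1
  show ?case by (rule runs_mono[OF runs_item_loop_step[of s a B0 r d ds b s1 s' T, OF _ 1(2) d 1(3)]])
      (use d in \<open>simp_all add: 1(1,4) depth_change_def fun_eq_iff\<close>)
next
  case 2
  show ?case by (rule runs_mono[OF runs_item_loop_step[of s a B1 r d ds b s1 s' T, OF _ 2(2) d 2(3)]])
      (use d in \<open>simp_all add: 2(1,4) depth_change_def fun_eq_iff\<close>)
next
  case (3 ws)
  let ?s1 = "s(a := concat ws @ RP # r, b := LP # s b, d := B1 # s d)"
  let ?s2 = "s(a := RP # r, b := rev (concat ws) @ LP # s b, d := B1 # s d)"
  have fin: "runs (item_loop a b d) ?s2 s' (T + 10)"
    by (rule runs_item_loop_step[of ?s2 a RP r d "s d" b s1 s' T, OF _ _ d "3.prems"(3)])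
      (use d in \<open>simp_all add: "3.prems"(4) depth_change_def fun_eq_iff\<close>)
  have L: "runs (item_loop a b d) ?s1 s' (T + 10 + 10 * length (concat ws))"
  proof (rule runs_item_loop_concat[of a b d ws ?s1 "RP # r" "s d" ?s2, OF d _ _ _ fin])
    show "runs (item_loop a b d) s s' (T + 10 * length v)"
      if "v \<in> set ws" "s a = v @ r" "s d = B1 # ds" "runs (item_loop a b d) s1 s' T"
        "s1 = s(a := r, b := rev v @ s b)" for v s r ds s1 s' T
      by (rule "3.IH"[OF that])
  qed (use d in \<open>simp_all add: fun_eq_iff\<close>)
  have "runs (item_loop a b d) s s' (T + 10 + 10 * length (concat ws) + 10)"
  proof (rule runs_item_loop_step[of s a LP "concat ws @ RP # r" d ds b ?s1, OF _ "3.prems"(2) d L])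
    show "s a = LP # concat ws @ RP # r" using "3.prems"(1) by simp
    show "?s1 = s(a := concat ws @ RP # r, b := LP # s b, d := depth_change LP (s d))"
      by (simp add: depth_change_def)
  qed
  then show ?case by (rule runs_mono) simp
qed

text \<open>One step is taken outside the loop because the depth is 0 before an item as well as
  after it.\<close>

definition move_item :: "nat \<Rightarrow> nat \<Rightarrow> nat \<Rightarrow> prog" where
  "move_item a b d = Seq (item_step a b d) (item_loop a b d)"

lemma runs_move_item:
  assumes "item w" and d: "a \<noteq> b" "a \<noteq> d" "b \<noteq> d" and s: "s a = w @ r" "s d = []"
  shows "runs (move_item a b d) s (s(a := r, b := rev w @ s b)) (20 * length w)"
proof -
  let ?s3 = "s(a := r, b := rev w @ s b)"
  have 0: "runs (item_loop a b d) ?s3 ?s3 1"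
    unfolding item_loop_def by (rule runs_WhileFalse) (use d s(2) in simp)
  from assms(1) show ?thesis
  proof cases
    case 1
    have "runs (item_step a b d) s ?s3 8"
      by (rule runs_cong[OF runs_item_step[of s a B0 r, OF _ d]])
        (use d in \<open>simp_all add: 1 s depth_change_def fun_eq_iff\<close>)
    from runs_Seq[OF this 0] show ?thesis unfolding move_item_def by (rule runs_mono) (simp add: 1)
  next
    case 2
    have "runs (item_step a b d) s ?s3 8"
      by (rule runs_cong[OF runs_item_step[of s a B1 r, OF _ d]])
        (use d in \<open>simp_all add: 2 s depth_change_def fun_eq_iff\<close>)
    from runs_Seq[OF this 0] show ?thesis unfolding move_item_def by (rule runs_mono) (simp add: 2)
  next
    case (3 ws)
    let ?s1 = "s(a := concat ws @ RP # r, b := LP # s b, d := [B1])"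
    let ?s2 = "s(a := RP # r, b := rev (concat ws) @ LP # s b, d := [B1])"
    have 1: "runs (item_loop a b d) ?s2 ?s3 (1 + 10)"
      by (rule runs_item_loop_step[of ?s2 a RP r d "[]" b ?s3 ?s3 1, OF _ _ d 0])
        (use d in \<open>simp_all add: 3(1) s depth_change_def fun_eq_iff\<close>)
    have 2: "runs (item_loop a b d) ?s1 ?s3 (1 + 10 + 10 * length (concat ws))"
    proof (rule runs_item_loop_concat[of a b d ws ?s1 "RP # r" "[]" ?s2, OF d _ _ _ 1])
      show "runs (item_loop a b d) s s' (T + 10 * length v)"
        if "v \<in> set ws" "s a = v @ r" "s d = B1 # ds" "runs (item_loop a b d) s1 s' T"
          "s1 = s(a := r, b := rev v @ s b)" for v s r ds s1 s' T
        by (rule runs_item_loop[OF 3(2)[OF that(1)] d that(2-5)])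
    qed (use d in \<open>simp_all add: fun_eq_iff\<close>)
    have 4: "runs (item_step a b d) s ?s1 8"
      by (rule runs_cong[OF runs_item_step[of s a LP "concat ws @ RP # r", OF _ d]])
        (use d in \<open>simp_all add: 3(1) s depth_change_def fun_eq_iff\<close>)
    show ?thesis unfolding move_item_def
      by (rule runs_mono[OF runs_Seq[OF 4 2]]) (simp add: 3)
  qed
qed

fun move_items :: "nat \<Rightarrow> nat \<Rightarrow> nat \<Rightarrow> nat \<Rightarrow> prog" where
  "move_items 0 a b d = Skip"
| "move_items (Suc k) a b d = Seq (move_item a b d) (move_items k a b d)"

definition nitems :: "nat \<Rightarrow> word \<Rightarrow> bool" where
  "nitems k w \<longleftrightarrow> (\<exists>ws. length ws = k \<and> (\<forall>v\<in>set ws. item v) \<and> w = concat ws)"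

lemma nitems_append: "nitems k v \<Longrightarrow> nitems l w \<Longrightarrow> nitems (k + l) (v @ w)"
  unfolding nitems_def by (metis Un_iff concat_append length_append set_append)

lemma nitems_1: "nitems 1 w \<longleftrightarrow> item w"
  unfolding nitems_def by (auto simp: length_Suc_conv)

lemma runs_move_items:
  assumes d: "a \<noteq> b" "a \<noteq> d" "b \<noteq> d"
  shows "nitems k w \<Longrightarrow> s a = w @ r \<Longrightarrow> s d = [] \<Longrightarrow> s' = s(a := r, b := rev w @ s b) \<Longrightarrow>
    runs (move_items k a b d) s s' (20 * length w + 1)"
proof (induction k arbitrary: w s)
  case 0
  from 0(1) have "w = []" by (simp add: nitems_def)
  moreover from this 0(2) have "s' = s" unfolding 0(4) by (simp add: fun_upd_idem)
  ultimately show ?case using runs_Skip by simp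
next
  case (Suc k)
  obtain v w' where v: "item v" "nitems k w'" "w = v @ w'"
  proof -
    obtain ws where ws: "length ws = Suc k" "\<forall>v\<in>set ws. item v" "w = concat ws"
      using Suc.prems(1) by (auto simp: nitems_def)
    then obtain v vs where "ws = v # vs" by (cases ws) auto
    with ws show ?thesis by (intro that[of v "concat vs"]) (auto simp: nitems_def)
  qed
  have 1: "runs (move_item a b d) s (s(a := w' @ r, b := rev v @ s b)) (20 * length v)"
    by (rule runs_move_item[OF v(1) d]) (use v Suc.prems(2,3) in auto)
  have 2: "runs (move_items k a b d) (s(a := w' @ r, b := rev v @ s b)) s' (20 * length w' + 1)"
    by (rule Suc.IH[OF v(2)]) (use v Suc.prems(3) d in \<open>simp_all add: Suc.prems(4) fun_eq_iff\<close>)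
  show ?case using runs_Seq[OF 1 2] by (simp add: v(3) algebra_simps)
qed

section \<open>Polynomial-time computations on encoded data\<close>

text \<open>The base is at least 2, so a single exponent absorbs constants, sums and products, and
  no polynomial has to be carried along.\<close>

definition pbound :: "'i set \<Rightarrow> ('i \<Rightarrow> nat) \<Rightarrow> ('i \<Rightarrow> nat) \<Rightarrow> bool" where
  "pbound D g s \<longleftrightarrow> (\<exists>c. \<forall>i\<in>D. g i \<le> (s i + 2) ^ c)"

lemma pbound_mono: "pbound D h s \<Longrightarrow> (\<And>i. i \<in> D \<Longrightarrow> g i \<le> h i) \<Longrightarrow> pbound D g s"
  unfolding pbound_def by (meson le_trans)

lemma pbound_const: "pbound D (\<lambda>_. k) s"
proof -
  have "k \<le> (n + 2) ^ k" for n :: nat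
    using less_exp[of k] power_mono[of 2 "n + 2" k] by linarith
  then show ?thesis unfolding pbound_def by blast
qed

lemma pbound_self: "pbound D s s"
  unfolding pbound_def by (rule exI[of _ 1]) simp

lemma pbound_add: "pbound D g s \<Longrightarrow> pbound D h s \<Longrightarrow> pbound D (\<lambda>i. g i + h i) s"
proof -
  have "x + y \<le> (n + 2) ^ Suc (max a b)" if "x \<le> (n + 2) ^ a" "y \<le> (n + 2) ^ b" for x y n a b :: nat
  proof -
    have "x \<le> (n + 2) ^ max a b" "y \<le> (n + 2) ^ max a b"
      using that power_increasing[of _ "max a b" "n + 2"] by (meson le_add2 le_trans max.cobounded1
          max.cobounded2 one_le_numeral)+
    then have "x + y \<le> 2 * (n + 2) ^ max a b" by linarith
    also have "\<dots> \<le> (n + 2) ^ Suc (max a b)" by simp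
    finally show ?thesis .
  qed
  then show "pbound D g s \<Longrightarrow> pbound D h s \<Longrightarrow> pbound D (\<lambda>i. g i + h i) s"
    unfolding pbound_def by meson
qed

lemma pbound_mult: "pbound D g s \<Longrightarrow> pbound D h s \<Longrightarrow> pbound D (\<lambda>i. g i * h i) s"
  unfolding pbound_def by (metis mult_le_mono power_add)

lemma pbound_trans: "pbound D g h \<Longrightarrow> pbound D h s \<Longrightarrow> pbound D g s"
proof -
  assume "pbound D g h" "pbound D h s"
  then obtain c c' where c: "\<forall>i\<in>D. g i \<le> (h i + 2) ^ c" "\<forall>i\<in>D. h i \<le> (s i + 2) ^ c'"
    unfolding pbound_def by blast
  have "pbound D (\<lambda>i. h i + 2) s"
    by (rule pbound_add[OF _ pbound_const]) (use c(2) pbound_def in blast)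
  then obtain c'' where c'': "\<forall>i\<in>D. h i + 2 \<le> (s i + 2) ^ c''"
    unfolding pbound_def by blast
  have "g i \<le> (s i + 2) ^ (c'' * c)" if "i \<in> D" for i
  proof -
    have "g i \<le> (h i + 2) ^ c" using c(1) that by blast
    also have "\<dots> \<le> ((s i + 2) ^ c'') ^ c" using c'' that by (intro power_mono) auto
    finally show ?thesis by (simp add: power_mult)
  qed
  then show ?thesis unfolding pbound_def by blast
qed

lemma pbound_power: "pbound D g s \<Longrightarrow> pbound D (\<lambda>i. (g i + 2) ^ c) s"
  by (rule pbound_trans[of _ _ g]) (auto simp: pbound_def)

lemmas pbound_intros = pbound_const pbound_self pbound_add pbound_mult

text \<open>One program for a whole family of inputs. Indexing by \<open>i\<close> instead of by
  words permits a promise \<open>D\<close> on the inputs and outputs that depend on the object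
  behind an encoding.\<close>

definition ptime :: "'i set \<Rightarrow> ('i \<Rightarrow> word) \<Rightarrow> ('i \<Rightarrow> word) \<Rightarrow> bool" where
  "ptime D u v \<longleftrightarrow> (\<exists>P c. \<forall>i\<in>D. runs P (clean (u i)) (clean (v i)) ((length (u i) + 2) ^ c))"

lemma ptimeI:
  assumes "pbound D T (\<lambda>i. length (u i))" "\<And>i. i \<in> D \<Longrightarrow> runs P (clean (u i)) (clean (v i)) (T i)"
  shows "ptime D u v"
  using assms unfolding pbound_def ptime_def by (meson runs_mono)

lemma ptimeE:
  assumes "ptime D u v"
  obtains P T N where "pbound D T (\<lambda>i. length (u i))" "N > 0" "below N P"
    "\<And>i. i \<in> D \<Longrightarrow> runs P (clean (u i)) (clean (v i)) (T i)"
proof -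
  obtain P c where P: "\<forall>i\<in>D. runs P (clean (u i)) (clean (v i)) ((length (u i) + 2) ^ c)"
    using assms unfolding ptime_def by blast
  obtain N where N: "N > 0" "below N P" using ex_below by blast
  show ?thesis
    by (rule that[OF pbound_power[OF pbound_self] N]) (use P in blast)
qed

lemma ptime_length:
  assumes "ptime D u v"
  shows "pbound D (\<lambda>i. length (v i)) (\<lambda>i. length (u i))"
proof -
  obtain P T and N :: nat where P: "pbound D T (\<lambda>i. length (u i))"
    "\<And>i. i \<in> D \<Longrightarrow> runs P (clean (u i)) (clean (v i)) (T i)" using assms by (rule ptimeE) blast
  have "length (v i) \<le> length (u i) + T i" if i: "i \<in> D" for i
  proof -
    obtain t where "t \<le> T i" "exec P (clean (u i)) t (clean (v i))" using P(2)[OF i] by (auto simp: runs_def)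
    with exec_length[OF this(2), of 0] show ?thesis by simp
  qed
  then show ?thesis by (rule pbound_mono[OF pbound_add[OF pbound_self P(1)]])
qed

lemma ptime_reindex: "ptime D u v \<Longrightarrow> h ` E \<subseteq> D \<Longrightarrow> ptime E (\<lambda>i. u (h i)) (\<lambda>i. v (h i))"
  unfolding ptime_def by blast

lemma ptime_cong:
  assumes "ptime D u v" "\<And>i. i \<in> D \<Longrightarrow> u i = u' i" "\<And>i. i \<in> D \<Longrightarrow> v i = v' i"
  shows "ptime D u' v'"
  using assms unfolding ptime_def by force

lemma ptime_subset: "ptime D u v \<Longrightarrow> E \<subseteq> D \<Longrightarrow> ptime E u v"
  unfolding ptime_def by blast

lemma ptime_id: "ptime D u u"
  by (rule ptimeI[OF pbound_const runs_Skip])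

lemma ptime_comp:
  assumes "ptime D u v" "ptime D v w"
  shows "ptime D u w"
proof -
  obtain P T and N :: nat where P: "pbound D T (\<lambda>i. length (u i))"
    "\<And>i. i \<in> D \<Longrightarrow> runs P (clean (u i)) (clean (v i)) (T i)" using assms(1) by (rule ptimeE) blast
  obtain Q S and M :: nat where Q: "pbound D S (\<lambda>i. length (v i))"
    "\<And>i. i \<in> D \<Longrightarrow> runs Q (clean (v i)) (clean (w i)) (S i)" using assms(2) by (rule ptimeE) blast
  show ?thesis
    by (rule ptimeI[OF pbound_add[OF P(1) pbound_trans[OF Q(1) ptime_length[OF assms(1)]]]
          runs_Seq[OF P(2) Q(2)]])
qed

lemma ptime_const: "ptime D u (\<lambda>_. w)"
proof (rule ptimeI)
  show "pbound D (\<lambda>i. (2 * length (u i) + 1) + (length w + 1)) (\<lambda>i. length (u i))"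
    by (intro pbound_intros)
  fix i
  have 1: "runs (clear 0) (clean (u i)) (clean []) (2 * length (u i) + 1)"
    by (rule runs_mono[OF runs_clear]) (auto simp: clean_def)
  have 2: "runs (push_word 0 w) (clean []) (clean w) (length w + 1)"
    by (rule runs_cong[OF runs_push_word]) (auto simp: clean_def)
  show "runs (Seq (clear 0) (push_word 0 w)) (clean (u i)) (clean w) ((2 * length (u i) + 1) + (length w + 1))"
    by (rule runs_Seq[OF 1 2])
qed

text \<open>Both programs need the same input. It waits on stack \<open>N\<close>, which neither
  program can reach, and the first output waits on \<open>Suc N\<close>.\<close>

lemma ptime_append:
  assumes "ptime D u v" "ptime D u w"
  shows "ptime D u (\<lambda>i. v i @ w i)"
proof -
  obtain P T and N' :: nat where P: "pbound D T (\<lambda>i. length (u i))" "below N' P"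
    "\<And>i. i \<in> D \<Longrightarrow> runs P (clean (u i)) (clean (v i)) (T i)" using assms(1) by (rule ptimeE) blast
  obtain Q S and M :: nat where Q: "pbound D S (\<lambda>i. length (u i))" "below M Q" "M > 0"
    "\<And>i. i \<in> D \<Longrightarrow> runs Q (clean (u i)) (clean (w i)) (S i)" using assms(2) by (rule ptimeE) blast
  define N where "N = max N' M"
  have N: "N > 0" "below N P" "below N Q" using P Q by (auto simp: N_def intro: below_mono)
  let ?R = "Seq (move 0 N) (Seq (copy N 0 (Suc N)) (Seq P (Seq (move 0 (Suc N))
    (Seq (move N 0) (Seq Q (move (Suc N) 0))))))"
  let ?n = "\<lambda>i. length (u i)"
  let ?S = "\<lambda>i. (6 * ?n i + 1) + ((16 * ?n i + 2) + (T i + ((6 * length (v i) + 1) +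
    ((6 * ?n i + 1) + (S i + (6 * length (v i) + 1))))))"
  show ?thesis
  proof (rule ptimeI)
    show "pbound D ?S ?n"
      by (intro pbound_intros P(1) Q(1) ptime_length[OF assms(1)])
    fix i assume i: "i \<in> D"
    define st where "st a b c = (\<lambda>k. if k = 0 then a else if k = N then b else
        if k = Suc N then c else [])" for a b c :: word
    \<comment> \<open>Stack \<open>N\<close> keeps the input reversed; \<open>copy\<close> and the
      later \<open>move\<close> back to stack 0 both undo the reversal.\<close>
    have 1: "runs (move 0 N) (clean (u i)) (st [] (rev (u i)) []) (6 * ?n i + 1)"
      by (rule runs_mono[OF runs_move]) (use N in \<open>auto simp: clean_def st_def fun_eq_iff\<close>)
    have 2: "runs (copy N 0 (Suc N)) (st [] (rev (u i)) []) (st (u i) (rev (u i)) []) (16 * ?n i + 2)"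
      by (rule runs_mono[OF runs_copy]) (use N in \<open>auto simp: st_def fun_eq_iff\<close>)
    have 3: "runs P (st (u i) (rev (u i)) []) (st (v i) (rev (u i)) []) (T i)"
      by (rule runs_frame[OF P(3)[OF i] N(2)]) (use N in \<open>auto simp: st_def fun_eq_iff\<close>)
    have 4: "runs (move 0 (Suc N)) (st (v i) (rev (u i)) []) (st [] (rev (u i)) (rev (v i))) (6 * length (v
        i) + 1)"
      by (rule runs_mono[OF runs_move]) (use N in \<open>auto simp: st_def fun_eq_iff\<close>)
    have 5: "runs (move N 0) (st [] (rev (u i)) (rev (v i))) (st (u i) [] (rev (v i))) (6 * ?n i + 1)"
      by (rule runs_mono[OF runs_move]) (use N in \<open>auto simp: st_def fun_eq_iff\<close>)
    have 6: "runs Q (st (u i) [] (rev (v i))) (st (w i) [] (rev (v i))) (S i)"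
      by (rule runs_frame[OF Q(4)[OF i] N(3)]) (use N in \<open>auto simp: st_def fun_eq_iff\<close>)
    have 7: "runs (move (Suc N) 0) (st (w i) [] (rev (v i))) (clean (v i @ w i)) (6 * length (v i) + 1)"
      by (rule runs_mono[OF runs_move]) (use N in \<open>auto simp: st_def clean_def fun_eq_iff\<close>)
    show "runs ?R (clean (u i)) (clean (v i @ w i)) (?S i)"
      by (intro runs_Seq[OF 1] runs_Seq[OF 2] runs_Seq[OF 3] runs_Seq[OF 4] runs_Seq[OF 5] runs_Seq[OF 6] 7)
  qed
qed

lemma ptime_if_top:
  assumes "ptime {i\<in>D. b i} u v" "ptime {i\<in>D. \<not> b i} u v"
  shows "ptime D (\<lambda>i. (if b i then B1 else B0) # u i) v"
proof -
  let ?u = "\<lambda>i. (if b i then B1 else B0) # u i"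
  obtain P c where P: "\<forall>i\<in>{i\<in>D. b i}. runs P (clean (u i)) (clean (v i)) ((length (u i) + 2) ^ c)"
    using assms(1) unfolding ptime_def by blast
  obtain Q d where Q: "\<forall>i\<in>{i\<in>D. \<not> b i}. runs Q (clean (u i)) (clean (v i)) ((length (u i) + 2) ^ d)"
    using assms(2) unfolding ptime_def by blast
  show ?thesis
  proof (rule ptimeI)
    have u: "pbound D (\<lambda>i. length (u i)) (\<lambda>i. length (?u i))" by (rule pbound_mono[OF pbound_self]) simp
    show "pbound D (\<lambda>i. 1 + (1 + ((length (u i) + 2) ^ c + (length (u i) + 2) ^ d))) (\<lambda>i. length (?u i))"
      by (intro pbound_intros pbound_power u)
    fix i assume i: "i \<in> D"
    have 1: "runs (Pop 0) (clean (?u i)) (clean (u i)) 1"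
      by (rule runs_cong[OF runs_Pop]) (auto simp: clean_def)
    have 2: "runs (Seq (Pop 0) P) (clean (?u i)) (clean (v i)) (1 + ((length (u i) + 2) ^ c + (length (u i)
        + 2) ^ d))" if "b i"
      by (rule runs_mono[OF runs_Seq[OF 1]]) (use P i that in auto)
    have 3: "runs (Seq (Pop 0) Q) (clean (?u i)) (clean (v i)) (1 + ((length (u i) + 2) ^ c + (length (u i)
        + 2) ^ d))" if "\<not> b i"
      by (rule runs_mono[OF runs_Seq[OF 1]]) (use Q i that in auto)
    have "runs (IfTop 0 {Some B1} (Seq (Pop 0) P) (Seq (Pop 0) Q)) (clean (?u i)) (clean (v i))
       (Suc (1 + ((length (u i) + 2) ^ c + (length (u i) + 2) ^ d)))"
      by (rule runs_If; (rule 2 | rule 3)) (auto split: if_splits)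
    then show "runs (IfTop 0 {Some B1} (Seq (Pop 0) P) (Seq (Pop 0) Q)) (clean (?u i)) (clean (v i))
       (1 + (1 + ((length (u i) + 2) ^ c + (length (u i) + 2) ^ d)))"
      by simp
  qed
qed

text \<open>The computed bit is put in front of the unchanged input, where a single test of the top
  symbol selects the branch.\<close>

lemma ptime_if:
  assumes "ptime D u (\<lambda>i. enc_bool (b i))" "ptime {i\<in>D. b i} u v" "ptime {i\<in>D. \<not> b i} u v"
  shows "ptime D u v"
proof -
  have "ptime D u (\<lambda>i. enc_bool (b i) @ u i)" by (rule ptime_append[OF assms(1) ptime_id])
  then have "ptime D u (\<lambda>i. (if b i then B1 else B0) # u i)" by (simp add: enc_bool_def)
  then show ?thesis by (rule ptime_comp) (rule ptime_if_top[OF assms(2,3)])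
qed

text \<open>The number of items is fixed by the type, so a program can split a pair by cutting off a
  known number of items. There is at least one item, so a list element is never mistaken for the
  closing bracket of the list.\<close>

class data =
  fixes encode :: "'a \<Rightarrow> word"
  assumes encode_items: "\<exists>k. \<forall>x. nitems (Suc k) (encode x)"

instantiation bool :: data
begin
definition "encode = enc_bool"
instance
proof
  have "nitems (Suc 0) (encode b)" for b :: bool
    using nitems_1 by (auto simp: encode_bool_def enc_bool_def intro: item.intros)
  then show "\<exists>k. \<forall>x::bool. nitems (Suc k) (encode x)" by blast
qed
end

instantiation nat :: data
begin
definition "encode = enc_nat"
instance
proof
  have "\<exists>ws. (\<forall>w\<in>set ws. item w) \<and> bits n = concat ws" for n
  proof (induction n rule: bits.induct)
    case (1 n)
    show ?case
    proof (cases "n = 0")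
      case True
      then show ?thesis by (intro exI[of _ "[]"]) (simp add: bits.simps)
    next
      case False
      from 1[OF False] obtain ws where "\<forall>w\<in>set ws. item w" "bits (n div 2) = concat ws" by blast
      with False show ?thesis
        by (subst bits.simps) (intro exI[of _ "[if odd n then B1 else B0] # ws"], auto intro: item.intros)
    qed
  qed
  then have "item (encode n)" for n :: nat
    unfolding encode_nat_def enc_nat_def using item.intros(3) by metis
  then have "nitems (Suc 0) (encode n)" for n :: nat using nitems_1 by simp
  then show "\<exists>k. \<forall>x::nat. nitems (Suc k) (encode x)" by blast
qed
end

instantiation prod :: (data, data) data
begin
definition "encode p = encode (fst p) @ encode (snd p)"
instance
proof
  obtain k where k: "\<forall>x::'a. nitems (Suc k) (encode x)" using encode_items by blast
  obtain l where l: "\<forall>x::'b. nitems (Suc l) (encode x)" using encode_items by blast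
  from k l have "nitems (Suc (k + Suc l)) (encode p)" for p :: "'a \<times> 'b"
    using nitems_append[of "Suc k" _ "Suc l"] by (simp add: encode_prod_def)
  then show "\<exists>k. \<forall>x::'a \<times> 'b. nitems (Suc k) (encode x)" by blast
qed
end

instantiation list :: (data) data
begin
definition "encode xs = LP # concat (map encode xs) @ [RP]"
instance
proof
  obtain k where k: "\<forall>x::'a. nitems (Suc k) (encode x)" using encode_items by blast
  have "\<exists>ws. (\<forall>w\<in>set ws. item w) \<and> concat (map encode xs) = concat ws" for xs :: "'a list"
  proof (induction xs)
    case Nil then show ?case by (intro exI[of _ "[]"]) simp
  next
    case (Cons x xs)
    then obtain ws where ws: "\<forall>w\<in>set ws. item w" "concat (map encode xs) = concat ws" by blast
    obtain vs where "\<forall>w\<in>set vs. item w" "encode x = concat vs" using k by (auto simp: nitems_def)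
    with ws show ?case by (intro exI[of _ "vs @ ws"]) auto
  qed
  then have "item (encode xs)" for xs :: "'a list"
    unfolding encode_list_def using item.intros(3) by metis
  then have "nitems (Suc 0) (encode xs)" for xs :: "'a list" using nitems_1 by simp
  then show "\<exists>k. \<forall>x::'a list. nitems (Suc k) (encode x)" by blast
qed
end

lemma encode_pair: "encode (x, y) = encode x @ encode y"
  by (simp add: encode_prod_def)

abbreviation size_of :: "'a::data \<Rightarrow> nat" where
  "size_of x \<equiv> length (encode x)"

lemma encode_hd: "\<exists>x v. encode (y :: 'a::data) = x # v \<and> x \<noteq> RP"
proof -
  obtain k where "nitems (Suc k) (encode y)" using encode_items by blast
  then obtain w ws where "encode y = concat (w # ws)" "item w" by (auto simp: nitems_def length_Suc_conv)
  then show ?thesis using item_hd[of w] by auto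
qed

definition FP :: "('a::data \<Rightarrow> 'b::data) \<Rightarrow> bool" where
  "FP f \<longleftrightarrow> ptime UNIV encode (\<lambda>x. encode (f x))"

lemma FP_size: "FP f \<Longrightarrow> pbound UNIV (\<lambda>x. size_of (f x)) size_of"
  unfolding FP_def by (rule ptime_length)

lemma FP_id: "FP (\<lambda>x. x)"
  unfolding FP_def by (rule ptime_id)

lemma FP_const: "FP (\<lambda>_. c)"
  unfolding FP_def by (rule ptime_const)

lemma FP_comp: "FP g \<Longrightarrow> FP f \<Longrightarrow> FP (\<lambda>x. g (f x))"
  unfolding FP_def by (rule ptime_comp[OF _ ptime_reindex[where h = f]]) auto

lemma FP_pair: "FP f \<Longrightarrow> FP g \<Longrightarrow> FP (\<lambda>x. (f x, g x))"
  unfolding FP_def encode_pair by (rule ptime_append)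

lemma FP_if: "FP b \<Longrightarrow> FP f \<Longrightarrow> FP g \<Longrightarrow> FP (\<lambda>x. if b x then f x else g x)"
proof -
  assume "FP b" and f: "FP f" and g: "FP g"
  then have b: "ptime UNIV encode (\<lambda>x. enc_bool (b x))" by (simp add: FP_def encode_bool_def)
  show ?thesis unfolding FP_def
  proof (rule ptime_if[OF b])
    show "ptime {x \<in> UNIV. b x} encode (\<lambda>x. encode (if b x then f x else g x))"
      by (rule ptime_cong[OF ptime_subset[OF f[unfolded FP_def] subset_UNIV]]) simp_all
    show "ptime {x \<in> UNIV. \<not> b x} encode (\<lambda>x. encode (if b x then f x else g x))"
      by (rule ptime_cong[OF ptime_subset[OF g[unfolded FP_def] subset_UNIV]]) simp_all
  qed
qed

lemma FP_fst0: "FP (fst :: 'a::data \<times> 'b::data \<Rightarrow> 'a)"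
proof -
  obtain k where k: "\<forall>x::'a. nitems (Suc k) (encode x)" using encode_items by blast
  show ?thesis unfolding FP_def
  proof (rule ptimeI)
    let ?n = "\<lambda>p :: 'a \<times> 'b. size_of p"
    show "pbound UNIV (\<lambda>p. (20 * ?n p + 1) + ((2 * ?n p + 1) + (6 * ?n p + 1))) ?n"
      by (intro pbound_intros)
    fix p :: "'a \<times> 'b"
    let ?s1 = "(clean (encode (snd p)))(1 := rev (encode (fst p)))"
    let ?s2 = "(clean [])(1 := rev (encode (fst p)))"
    have 1: "runs (move_items (Suc k) 0 1 2) (clean (encode p)) ?s1 (20 * ?n p + 1)"
      by (rule runs_mono[OF runs_move_items[of _ _ _ _ "encode (fst p)"]])
        (use k in \<open>auto simp: encode_prod_def clean_def fun_eq_iff\<close>)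
    have 2: "runs (clear 0) ?s1 ?s2 (2 * ?n p + 1)"
      by (rule runs_mono[OF runs_clear]) (auto simp: encode_prod_def clean_def fun_eq_iff)
    have 3: "runs (move 1 0) ?s2 (clean (encode (fst p))) (6 * ?n p + 1)"
      by (rule runs_mono[OF runs_move]) (auto simp: encode_prod_def clean_def fun_eq_iff)
    show "runs (Seq (move_items (Suc k) 0 1 2) (Seq (clear 0) (move 1 0))) (clean (encode p)) (clean
        (encode (fst p)))
      ((20 * ?n p + 1) + ((2 * ?n p + 1) + (6 * ?n p + 1)))"
      by (intro runs_Seq[OF 1] runs_Seq[OF 2] 3)
  qed
qed

lemma FP_snd0: "FP (snd :: 'a::data \<times> 'b::data \<Rightarrow> 'b)"
proof -
  obtain k where k: "\<forall>x::'a. nitems (Suc k) (encode x)" using encode_items by blast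
  show ?thesis unfolding FP_def
  proof (rule ptimeI)
    let ?n = "\<lambda>p :: 'a \<times> 'b. size_of p"
    show "pbound UNIV (\<lambda>p. (20 * ?n p + 1) + (2 * ?n p + 1)) ?n"
      by (intro pbound_intros)
    fix p :: "'a \<times> 'b"
    let ?s1 = "(clean (encode (snd p)))(1 := rev (encode (fst p)))"
    have 1: "runs (move_items (Suc k) 0 1 2) (clean (encode p)) ?s1 (20 * ?n p + 1)"
      by (rule runs_mono[OF runs_move_items[of _ _ _ _ "encode (fst p)"]])
        (use k in \<open>auto simp: encode_prod_def clean_def fun_eq_iff\<close>)
    have 2: "runs (clear 1) ?s1 (clean (encode (snd p))) (2 * ?n p + 1)"
      by (rule runs_mono[OF runs_clear]) (auto simp: encode_prod_def clean_def fun_eq_iff)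
    show "runs (Seq (move_items (Suc k) 0 1 2) (clear 1)) (clean (encode p)) (clean (encode (snd p)))
      ((20 * ?n p + 1) + (2 * ?n p + 1))"
      by (intro runs_Seq[OF 1] 2)
  qed
qed

lemma FP_cons0: "FP (\<lambda>p :: 'a::data \<times> 'a list. fst p # snd p)"
proof -
  obtain k where k: "\<forall>x::'a. nitems (Suc k) (encode x)" using encode_items by blast
  show ?thesis unfolding FP_def
  proof (rule ptimeI)
    let ?n = "\<lambda>p :: 'a \<times> 'a list. size_of p"
    show "pbound UNIV (\<lambda>p. (20 * ?n p + 1) + (1 + ((6 * ?n p + 1) + 1))) ?n"
      by (intro pbound_intros)
    fix p :: "'a \<times> 'a list"
    let ?s1 = "(clean (encode (snd p)))(1 := rev (encode (fst p)))"
    let ?s2 = "(clean (tl (encode (snd p))))(1 := rev (encode (fst p)))"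
    let ?s3 = "clean (encode (fst p) @ tl (encode (snd p)))"
    have 1: "runs (move_items (Suc k) 0 1 2) (clean (encode p)) ?s1 (20 * ?n p + 1)"
      by (rule runs_mono[OF runs_move_items[of _ _ _ _ "encode (fst p)"]])
        (use k in \<open>auto simp: encode_prod_def clean_def fun_eq_iff\<close>)
    have 2: "runs (Pop 0) ?s1 ?s2 1"
      by (rule runs_cong[OF runs_Pop]) (auto simp: clean_def fun_eq_iff)
    have 3: "runs (move 1 0) ?s2 ?s3 (6 * ?n p + 1)"
      by (rule runs_mono[OF runs_move]) (auto simp: encode_prod_def clean_def fun_eq_iff)
    have 4: "runs (Push 0 LP) ?s3 (clean (encode (fst p # snd p))) 1"
      by (rule runs_cong[OF runs_Push]) (auto simp: clean_def encode_list_def fun_eq_iff)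
    show "runs (Seq (move_items (Suc k) 0 1 2) (Seq (Pop 0) (Seq (move 1 0) (Push 0 LP))))
      (clean (encode p)) (clean (encode (fst p # snd p))) ((20 * ?n p + 1) + (1 + ((6 * ?n p + 1) + 1)))"
      by (intro runs_Seq[OF 1] runs_Seq[OF 2] runs_Seq[OF 3] 4)
  qed
qed

lemma length_le_size_of: "length xs \<le> size_of xs"
proof -
  have "length xs \<le> length (concat (map encode xs))"
  proof (induction xs)
    case (Cons x xs)
    then show ?case using encode_hd[of x] by auto
  qed simp
  then show ?thesis by (simp add: encode_list_def)
qed

lemma size_of_member_le: "x \<in> set xs \<Longrightarrow> size_of x \<le> size_of xs"
proof -
  have "x \<in> set xs \<Longrightarrow> size_of x \<le> length (concat (map encode xs))"
    by (induction xs) auto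
  then show "x \<in> set xs \<Longrightarrow> size_of x \<le> size_of xs" by (simp add: encode_list_def)
qed

text \<open>This is the loop combinator behind all later algorithms. The bound must cover every
  intermediate accumulator: a polynomial-time step alone could let it grow exponentially, for
  instance by doubling its length each time.\<close>

lemma ptime_foldl:
  fixes step :: "'e::data \<Rightarrow> 'a::data \<Rightarrow> 'x::data \<Rightarrow> 'a"
  assumes step: "FP (\<lambda>p. step (fst p) (fst (snd p)) (snd (snd p)))"
    and D: "\<And>e a xs ys zs. (e, a, xs) \<in> D \<Longrightarrow> xs = ys @ zs \<Longrightarrow>
      size_of (foldl (step e) a ys) \<le> (size_of (e, a, xs) + 2) ^ c"
  shows "ptime D encode (\<lambda>(e, a, xs). encode (foldl (step e) a xs))"
proof -
  obtain P T N where P: "pbound UNIV T (\<lambda>p :: 'e \<times> 'a \<times> 'x. size_of p)" "N > 0" "below N P"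
    "\<And>p. runs P (clean (encode p)) (clean (encode (step (fst p) (fst (snd p)) (snd (snd p))))) (T p)"
    using step unfolding FP_def by (rule ptimeE) auto
  obtain cp where cp: "\<And>p. T p \<le> (size_of p + 2) ^ cp" using P(1) by (auto simp: pbound_def)
  obtain ke where ke: "\<forall>x::'e. nitems (Suc ke) (encode x)" using encode_items by blast
  obtain ka where ka: "\<forall>x::'a. nitems (Suc ka) (encode x)" using encode_items by blast
  obtain kx where kx: "\<forall>x::'x. nitems (Suc kx) (encode x)" using encode_items by blast
  \<comment> \<open>\<open>e\<close> and the accumulator are kept reversed on \<open>N\<close> and
    \<open>N + 1\<close>, the unread part of the list on \<open>N + 2\<close>. Stack
    \<open>N + 3\<close> is scratch space, \<open>N + 4\<close> counts brackets, and stack 0 passes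
    arguments to \<open>P\<close>.\<close>
  define st where "st e a l w = (\<lambda>i. if i = N then rev (encode (e::'e)) else
      if i = N + 1 then rev (encode (a::'a))
    else if i = N + 2 then l else if i = 0 then w else [])" for e a l w
  let ?body = "Seq (move_items (Suc kx) (N + 2) (N + 3) (N + 4)) (Seq (move (N + 3) 0) (Seq (move (N + 1) 0)
    (Seq (copy N 0 (N + 3)) (Seq P (move 0 (N + 1))))))"
  \<comment> \<open>No encoding begins with \<open>RP\<close>, so \<open>RP\<close> on top means
    that the list is exhausted.\<close>
  let ?loop = "WhileTop (N + 2) {Some B0, Some B1, Some LP} ?body"
  define it where "it n B = (20 * n + 1) + ((6 * n + 1) + ((6 * B + 1) + ((16 * n + 2) +
    ((2 * n + B + 2) ^ cp + (6 * B + 1)))))" for n B :: nat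
  have body: "runs ?body (st e a (encode x @ l) []) (st e (step e a x) l []) (it n B)"
    if "size_of e \<le> n" "size_of x \<le> n" "size_of a \<le> B" "size_of (step e a x) \<le> B" for e a x l n B
  proof -
    let ?s1 = "(st e a l [])(N + 3 := rev (encode x))"
    have 1: "runs (move_items (Suc kx) (N + 2) (N + 3) (N + 4)) (st e a (encode x @ l) []) ?s1 (20 * n + 1)"
      by (rule runs_mono[OF runs_move_items[of _ _ _ _ "encode x"]])
        (use kx that P(2) in \<open>auto simp: st_def fun_eq_iff\<close>)
    have 2: "runs (move (N + 3) 0) ?s1 (st e a l (encode x)) (6 * n + 1)"
      by (rule runs_mono[OF runs_move]) (use that P(2) in \<open>auto simp: st_def fun_eq_iff\<close>)
    let ?s3 = "(st e a l (encode a @ encode x))(N + 1 := [])"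
    have 3: "runs (move (N + 1) 0) (st e a l (encode x)) ?s3 (6 * B + 1)"
      by (rule runs_mono[OF runs_move]) (use that P(2) in \<open>auto simp: st_def fun_eq_iff\<close>)
    let ?s4 = "(st e a l (encode (e, a, x)))(N + 1 := [])"
    have 4: "runs (copy N 0 (N + 3)) ?s3 ?s4 (16 * n + 2)"
      by (rule runs_mono[OF runs_copy]) (use that P(2) in \<open>auto simp: st_def fun_eq_iff encode_pair\<close>)
    let ?s5 = "(st e a l (encode (step e a x)))(N + 1 := [])"
    have T: "T (e, a, x) \<le> (2 * n + B + 2) ^ cp"
      by (rule order_trans[OF cp]) (use that in \<open>auto simp: encode_pair intro!: power_mono\<close>)
    have 5: "runs P ?s4 ?s5 ((2 * n + B + 2) ^ cp)"
      by (rule runs_mono[OF _ T], rule runs_frame[OF P(4)[of "(e, a, x)"] P(3)])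
        (use P(2) in \<open>auto simp: st_def fun_eq_iff\<close>)
    have 6: "runs (move 0 (N + 1)) ?s5 (st e (step e a x) l []) (6 * B + 1)"
      by (rule runs_mono[OF runs_move]) (use that P(2) in \<open>auto simp: st_def fun_eq_iff\<close>)
    show ?thesis unfolding it_def
      by (intro runs_Seq[OF 1] runs_Seq[OF 2] runs_Seq[OF 3] runs_Seq[OF 4] runs_Seq[OF 5] 6)
  qed
  have loop: "runs ?loop (st e a (concat (map encode xs) @ [RP]) []) (st e (foldl (step e) a xs) [RP] [])
      (1 + length xs * (1 + it n B))"
    if "size_of e \<le> n" "\<And>x. x \<in> set xs \<Longrightarrow> size_of x \<le> n"
      "\<And>ys zs. xs = ys @ zs \<Longrightarrow> size_of (foldl (step e) a ys) \<le> B" for e a xs n B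
    using that
  proof (induction xs arbitrary: a)
    case Nil
    show ?case by (rule runs_mono[OF runs_WhileFalse[THEN runs_cong]]) (use P(2) in \<open>auto simp: st_def\<close>)
  next
    case (Cons x xs)
    have 1: "runs ?body (st e a (concat (map encode (x # xs)) @ [RP]) [])
        (st e (step e a x) (concat (map encode xs) @ [RP]) []) (it n B)"
      using body[of e n x a B "concat (map encode xs) @ [RP]"] Cons.prems(1,2) Cons.prems(3)[of "[]"]
        Cons.prems(3)[of "[x]"] by simp
    have 2: "runs ?loop (st e (step e a x) (concat (map encode xs) @ [RP]) [])
        (st e (foldl (step e) (step e a x) xs) [RP] []) (1 + length xs * (1 + it n B))"
    proof (rule Cons.IH)
      show "size_of (foldl (step e) (step e a x) ys) \<le> B" if "xs = ys @ zs" for ys zs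
        using Cons.prems(3)[of "x # ys" zs] that by simp
    qed (use Cons.prems in auto)
    obtain y v where y: "encode x = y # v" "y \<noteq> RP" using encode_hd by blast
    have 3: "top_of (st e a (concat (map encode (x # xs)) @ [RP]) [] (N + 2)) \<in> {Some B0, Some B1, Some LP}"
      using y P(2) by (cases y) (auto simp: st_def)
    show ?case by (rule runs_cong[OF runs_WhileTrue[OF 3 1 2]]) simp_all
  qed
  let ?init = "Seq (move_items (Suc ke) 0 N (N + 4)) (Seq (move_items (Suc ka) 0 (N + 1) (N + 4))
    (Seq (Pop 0) (Seq (move 0 (N + 3)) (move (N + 3) (N + 2)))))"
  let ?finish = "Seq (clear (N + 2)) (Seq (clear N) (move (N + 1) 0))"
  let ?n = "\<lambda>p :: 'e \<times> 'a \<times> 'x list. size_of p"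
  let ?B = "\<lambda>p. (?n p + 2) ^ c"
  let ?S = "\<lambda>p. (20 * ?n p + 1) + ((20 * ?n p + 1) + (1 + ((6 * ?n p + 1) + (6 * ?n p + 1))))"
  let ?F = "\<lambda>p. 3 + ((2 * ?n p + 1) + (6 * ?B p + 1))"
  let ?L = "\<lambda>p. 1 + ?n p * (1 + it (?n p) (?B p))"
  show ?thesis
  proof (rule ptimeI)
    show "pbound D (\<lambda>p. ?S p + (?L p + ?F p)) ?n"
      unfolding it_def by (intro pbound_intros pbound_power)
    fix p :: "'e \<times> 'a \<times> 'x list" assume pD: "p \<in> D"
    obtain e a xs where p: "p = (e, a, xs)" by (cases p)
    have len: "?n p = size_of e + size_of a + size_of xs" by (simp add: p encode_pair)
    let ?w = "concat (map encode xs) @ [RP]"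
    have enc: "encode p = encode e @ encode a @ LP # ?w" by (simp add: p encode_pair encode_list_def)
    have 1: "runs (move_items (Suc ke) 0 N (N + 4)) (clean (encode p))
        ((clean (encode a @ LP # ?w))(N := rev (encode e))) (20 * ?n p + 1)"
      by (rule runs_mono[OF runs_move_items[of _ _ _ _ "encode e"]])
        (use ke P(2) in \<open>auto simp: enc fun_eq_iff\<close>)
    have 2: "runs (move_items (Suc ka) 0 (N + 1) (N + 4)) ((clean (encode a @ LP # ?w))(N := rev (encode e)))
        (st e a [] (LP # ?w)) (20 * ?n p + 1)"
      by (rule runs_mono[OF runs_move_items[of _ _ _ _ "encode a"]])
        (use ka P(2) in \<open>auto simp: enc st_def fun_eq_iff\<close>)
    have 3: "runs (Pop 0) (st e a [] (LP # ?w)) (st e a [] ?w) 1"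
      by (rule runs_cong[OF runs_Pop]) (use P(2) in \<open>auto simp: st_def fun_eq_iff\<close>)
    have 4: "runs (move 0 (N + 3)) (st e a [] ?w) ((st e a [] [])(N + 3 := rev ?w)) (6 * ?n p + 1)"
      by (rule runs_mono[OF runs_move]) (use P(2) in \<open>auto simp: st_def enc fun_eq_iff\<close>)
    have 5: "runs (move (N + 3) (N + 2)) ((st e a [] [])(N + 3 := rev ?w)) (st e a ?w []) (6 * ?n p + 1)"
      by (rule runs_mono[OF runs_move]) (use P(2) in \<open>auto simp: st_def enc fun_eq_iff\<close>)
    have ini: "runs ?init (clean (encode p)) (st e a ?w []) (?S p)"
      by (intro runs_Seq[OF 1] runs_Seq[OF 2] runs_Seq[OF 3] runs_Seq[OF 4] 5)
    have lp: "runs ?loop (st e a ?w []) (st e (foldl (step e) a xs) [RP] []) (?L p)"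
    proof (rule runs_mono[OF loop[of e "?n p" xs a "?B p"]])
      show "size_of x \<le> ?n p" if "x \<in> set xs" for x using size_of_member_le[OF that] len by simp
      show "size_of (foldl (step e) a ys) \<le> ?B p" if "xs = ys @ zs" for ys zs
        using D[OF _ that] pD p by simp
      show "1 + length xs * (1 + it (?n p) (?B p)) \<le> ?L p"
        using length_le_size_of[of xs] len by (intro add_left_mono mult_right_mono) simp_all
    qed (use len in simp)
    let ?r = "foldl (step e) a xs"
    have r: "size_of ?r \<le> ?B p" using D[of e a xs xs "[]"] pD p by simp
    have 6: "runs (clear (N + 2)) (st e ?r [RP] []) (st e ?r [] []) 3"
      by (rule runs_mono[OF runs_clear]) (use P(2) in \<open>auto simp: st_def fun_eq_iff\<close>)
    have 7: "runs (clear N) (st e ?r [] []) ((st e ?r [] [])(N := [])) (2 * ?n p + 1)"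
      by (rule runs_mono[OF runs_clear]) (use P(2) len in \<open>auto simp: st_def fun_eq_iff\<close>)
    have 8: "runs (move (N + 1) 0) ((st e ?r [] [])(N := [])) (clean (encode ?r)) (6 * ?B p + 1)"
      by (rule runs_mono[OF runs_move]) (use P(2) r in \<open>auto simp: st_def clean_def fun_eq_iff\<close>)
    have fin: "runs ?finish (st e ?r [RP] []) (clean (encode ?r)) (?F p)"
      by (intro runs_Seq[OF 6] runs_Seq[OF 7] 8)
    show "runs (Seq ?init (Seq ?loop ?finish)) (clean (encode p))
        (clean (case p of (e, a, xs) \<Rightarrow> encode (foldl (step e) a xs))) (?S p + (?L p + ?F p))"
      unfolding p prod.case by (intro runs_Seq[OF ini[unfolded p]] runs_Seq[OF lp[unfolded p]] fin[unfolded p])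
  qed
qed

section \<open>A library of polynomial-time functions\<close>

named_theorems FP_intros

declare FP_id [FP_intros] FP_const [FP_intros] FP_pair [FP_intros] FP_if [FP_intros]

lemma FP_fst [FP_intros]: "FP f \<Longrightarrow> FP (\<lambda>x. fst (f x))"
  by (rule FP_comp[OF FP_fst0])

lemma FP_snd [FP_intros]: "FP f \<Longrightarrow> FP (\<lambda>x. snd (f x))"
  by (rule FP_comp[OF FP_snd0])

lemma FP_comp2: "FP (\<lambda>p. g (fst p) (snd p)) \<Longrightarrow> FP f \<Longrightarrow> FP h \<Longrightarrow> FP (\<lambda>x. g (f x) (h x))"
  using FP_comp[OF _ FP_pair, of "\<lambda>p. g (fst p) (snd p)" f h] by simp

lemma FP_Cons [FP_intros]: "FP f \<Longrightarrow> FP g \<Longrightarrow> FP (\<lambda>x. f x # g x)"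
  by (rule FP_comp2[OF FP_cons0])

lemma FP_not [FP_intros]: "FP b \<Longrightarrow> FP (\<lambda>x. \<not> b x)"
proof -
  assume "FP b"
  then have "FP (\<lambda>x. if b x then False else True)" by (intro FP_intros)
  moreover have "(\<lambda>x. if b x then False else True) = (\<lambda>x. \<not> b x)" by auto
  ultimately show ?thesis by (simp only:)
qed

lemma FP_conj [FP_intros]: "FP b \<Longrightarrow> FP c \<Longrightarrow> FP (\<lambda>x. b x \<and> c x)"
proof -
  assume "FP b" "FP c"
  then have "FP (\<lambda>x. if b x then c x else False)" by (intro FP_intros)
  moreover have "(\<lambda>x. if b x then c x else False) = (\<lambda>x. b x \<and> c x)" by auto
  ultimately show ?thesis by (simp only:)
qed

lemma FP_disj [FP_intros]: "FP b \<Longrightarrow> FP c \<Longrightarrow> FP (\<lambda>x. b x \<or> c x)"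
  using FP_not[OF FP_conj[OF FP_not FP_not], of b c] by simp

lemma FP_eq_bool [FP_intros]: "FP b \<Longrightarrow> FP c \<Longrightarrow> FP (\<lambda>x. b x = (c x :: bool))"
proof -
  assume "FP b" "FP c"
  then have "FP (\<lambda>x. if b x then c x else \<not> c x)" by (intro FP_intros)
  moreover have "(\<lambda>x. if b x then c x else \<not> c x) = (\<lambda>x. b x = c x)" by auto
  ultimately show ?thesis by simp
qed

lemma size_of_pair: "size_of (x, y) = size_of x + size_of y"
  by (simp add: encode_pair)

lemma size_of_bool [simp]: "size_of (b :: bool) = 1"
  by (simp add: encode_bool_def enc_bool_def)

lemma size_of_Nil [simp]: "size_of ([] :: 'a::data list) = 2"
  by (simp add: encode_list_def)

lemma size_of_Cons [simp]: "size_of (x # xs) = size_of x + size_of xs"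
  by (simp add: encode_list_def)

lemma size_of_append: "size_of (xs @ ys) + 2 = size_of xs + size_of ys"
  by (simp add: encode_list_def)

lemma FP_foldl_bounded:
  fixes step :: "'e::data \<Rightarrow> 'a::data \<Rightarrow> 'x::data \<Rightarrow> 'a"
  assumes "FP init" "FP xs" and step: "FP (\<lambda>p. step (fst p) (fst (snd p)) (snd (snd p)))"
    and bound: "\<And>e ys zs. xs e = ys @ zs \<Longrightarrow> size_of (foldl (step e) (init e) ys) \<le> (size_of (e, init e, xs
        e) + 2) ^ c"
  shows "FP (\<lambda>e. foldl (step e) (init e) (xs e))"
proof -
  have 1: "ptime UNIV encode (\<lambda>e. encode (e, init e, xs e))"
    using FP_pair[OF FP_id FP_pair[OF assms(1,2)]] by (simp add: FP_def)
  have 2: "ptime (range (\<lambda>e. (e, init e, xs e))) encode (\<lambda>(e, a, xs). encode (foldl (step e) a xs))"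
  proof (rule ptime_foldl[OF step, where c = c])
    fix e a us ys zs assume "(e, a, us) \<in> range (\<lambda>e. (e, init e, xs e))" "us = ys @ zs"
    then have "a = init e" "us = xs e" "xs e = ys @ zs" by auto
    then show "size_of (foldl (step e) a ys) \<le> (size_of (e, a, us) + 2) ^ c" using bound by metis
  qed
  show ?thesis unfolding FP_def
    by (rule ptime_comp[OF 1]) (use ptime_reindex[OF 2, of "\<lambda>e. (e, init e, xs e)" UNIV] in simp)
qed

text \<open>If a step adds at most an amount that does not depend on the accumulator, every
  accumulator is bounded by the initial size plus the number of steps times that amount.\<close>

lemma FP_foldl:
  fixes step :: "'e::data \<Rightarrow> 'a::data \<Rightarrow> 'x::data \<Rightarrow> 'a"
  assumes init: "FP init" and xs: "FP xs" and step: "FP (\<lambda>p. step (fst p) (fst (snd p)) (snd (snd p)))"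
    and q: "pbound UNIV q (\<lambda>p. size_of p)" "\<And>e a x. size_of (step e a x) \<le> size_of a + q (e, x)"
  shows "FP (\<lambda>e. foldl (step e) (init e) (xs e))"
proof -
  obtain c where c: "\<And>p. q p \<le> (size_of p + 2) ^ c" using q(1) by (auto simp: pbound_def)
  show ?thesis
  proof (rule FP_foldl_bounded[OF init xs step, where c = "c + 2"])
    fix e ys zs assume e: "xs e = ys @ zs"
    let ?n = "size_of (e, init e, xs e)"
    have "size_of (foldl (step e) a us) \<le> size_of a + length us * (?n + 2) ^ c" if "set us \<subseteq> set ys" for us a
      using that
    proof (induction us arbitrary: a)
      case (Cons x us)
      have "size_of x \<le> size_of (xs e)" using Cons.prems size_of_member_le[of x "xs e"] e by auto
      then have "size_of (e, x) + 2 \<le> ?n + 2" by (simp add: size_of_pair)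
      then have "q (e, x) \<le> (?n + 2) ^ c" using c[of "(e, x)"] power_mono[of "size_of (e, x) + 2"
          "?n + 2" c] by linarith
      moreover have "size_of (step e a x) \<le> size_of a + q (e, x)" by (rule q(2))
      moreover have "size_of (foldl (step e) (step e a x) us) \<le> size_of (step e a x) + length us * (?n + 2) ^ c"
        by (rule Cons.IH) (use Cons.prems in auto)
      ultimately show ?case by simp
    qed simp
    from this[of ys "init e"]
    have "size_of (foldl (step e) (init e) ys) \<le> size_of (init e) + length ys * (?n + 2) ^ c" by simp
    moreover have "length ys \<le> ?n" using length_le_size_of[of "xs e"] e by (simp add: size_of_pair)
    moreover have "size_of (init e) \<le> ?n" by (simp add: size_of_pair)
    ultimately have "size_of (foldl (step e) (init e) ys) \<le> ?n + ?n * (?n + 2) ^ c"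
      by (meson add_mono le_trans mult_right_mono zero_le)
    also have "\<dots> \<le> ?n * (?n + 2) ^ c + ?n * (?n + 2) ^ c" by simp
    also have "\<dots> \<le> (?n + 2) * (?n + 2) ^ c * (?n + 2)" by (simp add: algebra_simps)
    finally show "size_of (foldl (step e) (init e) ys) \<le> (?n + 2) ^ (c + 2)"
      by (simp add: power_add power2_eq_square mult_ac)
  qed
qed

section \<open>List functions\<close>

lemma FP_rev [FP_intros]: "FP f \<Longrightarrow> FP (\<lambda>x. rev (f x))"
proof -
  assume f: "FP f"
  have "FP (\<lambda>e. foldl (\<lambda>a x. x # a) [] (f e))"
    by (rule FP_foldl[where q = "\<lambda>p. size_of p"]) (auto intro!: FP_intros f pbound_intros simp: size_of_pair)
  moreover have "foldl (\<lambda>a x. x # a) ys xs = rev xs @ ys" for xs ys :: "'b list"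
    by (induction xs arbitrary: ys) auto
  ultimately show ?thesis by simp
qed

lemma FP_append [FP_intros]: "FP f \<Longrightarrow> FP g \<Longrightarrow> FP (\<lambda>x. f x @ g x)"
proof -
  assume f: "FP f" "FP g"
  have "FP (\<lambda>e. foldl (\<lambda>a x. x # a) (g e) (rev (f e)))"
    by (rule FP_foldl[where q = "\<lambda>p. size_of p"]) (auto intro!: FP_intros f pbound_intros simp: size_of_pair)
  moreover have "foldl (\<lambda>a x. x # a) ys xs = rev xs @ ys" for xs ys :: "'b list"
    by (induction xs arbitrary: ys) auto
  ultimately show ?thesis by simp
qed

lemma FP_concat_map [FP_intros]:
  assumes g: "FP (\<lambda>p. g (fst p) (snd p))" and f: "FP f"
  shows "FP (\<lambda>e. concat (map (g e) (f e)))"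
proof -
  have "FP (\<lambda>e. foldl (\<lambda>a x. a @ g e x) [] (f e))"
  proof (rule FP_foldl)
    show "pbound UNIV (\<lambda>p. size_of (g (fst p) (snd p))) (\<lambda>p. size_of p)" by (rule FP_size[OF g])
    show "size_of (a @ g e x) \<le> size_of a + size_of (g (fst (e, x)) (snd (e, x)))" for e a x
      using size_of_append[of a "g e x"] by simp
  qed (intro FP_intros f FP_comp2[OF g])+
  moreover have "foldl (\<lambda>a x. a @ h x) ys xs = ys @ concat (map h xs)" for h :: "'b \<Rightarrow> 'c list" and xs ys
    by (induction xs arbitrary: ys) auto
  ultimately show ?thesis by simp
qed

lemma FP_map [FP_intros]:
  assumes g: "FP (\<lambda>p. g (fst p) (snd p))" and f: "FP f"
  shows "FP (\<lambda>e. map (g e) (f e))"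
proof -
  have "FP (\<lambda>e. concat (map (\<lambda>x. [g e x]) (f e)))" by (intro FP_intros f FP_comp2[OF g])
  then show ?thesis by simp
qed

lemma FP_filter [FP_intros]:
  assumes g: "FP (\<lambda>p. g (fst p) (snd p))" and f: "FP f"
  shows "FP (\<lambda>e. filter (g e) (f e))"
proof -
  have "FP (\<lambda>e. concat (map (\<lambda>x. if g e x then [x] else []) (f e)))" by (intro FP_intros f FP_comp2[OF g])
  moreover have "concat (map (\<lambda>x. if h x then [x] else []) xs) = filter h xs" for h and xs :: "'b list"
    by (induction xs) auto
  ultimately show ?thesis by simp
qed

lemma FP_ball [FP_intros]:
  assumes g: "FP (\<lambda>p. g (fst p) (snd p))" and f: "FP f"
  shows "FP (\<lambda>e. \<forall>x\<in>set (f e). g e x)"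
proof -
  have "FP (\<lambda>e. foldl (\<lambda>a x. a \<and> g e x) True (f e))"
    by (rule FP_foldl[where q = "\<lambda>p. 1"]) (auto intro!: FP_intros f FP_comp2[OF g] pbound_intros)
  moreover have "foldl (\<lambda>a x. a \<and> h x) b xs = (b \<and> (\<forall>x\<in>set xs. h x))" for h :: "'b \<Rightarrow> bool" and xs b
    by (induction xs arbitrary: b) auto
  ultimately show ?thesis by simp
qed

lemma FP_bex [FP_intros]:
  assumes g: "FP (\<lambda>p. g (fst p) (snd p))" and f: "FP f"
  shows "FP (\<lambda>e. \<exists>x\<in>set (f e). g e x)"
  using FP_not[OF FP_ball[OF FP_not[OF g] f]] by simp

lemma FP_null [FP_intros]: "FP f \<Longrightarrow> FP (\<lambda>e. f e = [])"
  using FP_ball[of "\<lambda>e x. False" f] by (simp add: FP_const)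

lemma FP_last_or: "FP d \<Longrightarrow> FP f \<Longrightarrow> FP (\<lambda>e. if f e = [] then d e else last (f e))"
proof -
  assume f: "FP d" "FP f"
  have "FP (\<lambda>e. foldl (\<lambda>a x. x) (d e) (f e))"
    by (rule FP_foldl[where q = "\<lambda>p. size_of p"]) (auto intro!: FP_intros f pbound_intros simp: size_of_pair)
  moreover have "foldl (\<lambda>a x. x) b xs = (if xs = [] then b else last xs)" for b and xs :: "'b list"
    by (induction xs arbitrary: b) auto
  ultimately show ?thesis by simp
qed

definition hd_or :: "'a \<Rightarrow> 'a list \<Rightarrow> 'a" where
  "hd_or d xs = (case xs of [] \<Rightarrow> d | x # _ \<Rightarrow> x)"

lemma hd_or_simps [simp]: "hd_or d [] = d" "hd_or d (x # xs) = x"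
  by (simp_all add: hd_or_def)

lemma FP_hd_or [FP_intros]: "FP d \<Longrightarrow> FP f \<Longrightarrow> FP (\<lambda>e. hd_or (d e) (f e))"
proof -
  assume f: "FP d" "FP f"
  have "FP (\<lambda>e. if rev (f e) = [] then d e else last (rev (f e)))" by (intro FP_last_or FP_intros f)
  moreover have "(if rev (f e) = [] then d e else last (rev (f e))) = hd_or (d e) (f e)" for e
    by (cases "f e") auto
  ultimately show ?thesis by simp
qed

lemma FP_tl [FP_intros]: "FP f \<Longrightarrow> FP (\<lambda>e. tl (f e))"
proof -
  assume f: "FP f"
  let ?h = "\<lambda>s x. (False, if fst s then snd s else x # snd s)"
  have "FP (\<lambda>e. rev (snd (foldl ?h (True, []) (f e))))"
    by (intro FP_intros, rule FP_foldl[where q = "\<lambda>p. size_of p"])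
      (auto intro!: FP_intros f pbound_intros simp: encode_prod_def)
  moreover have "foldl ?h (False, ys) xs = (False, rev xs @ ys)" for xs ys :: "'b list"
    by (induction xs arbitrary: ys) auto
  then have "rev (snd (foldl ?h (True, []) xs)) = tl xs" for xs :: "'b list"
    by (cases xs) auto
  ultimately show ?thesis by simp
qed

section \<open>Binary arithmetic\<close>

fun nbits :: "nat \<Rightarrow> bool list" where
  "nbits n = (if n = 0 then [] else odd n # nbits (n div 2))"

declare nbits.simps [simp del]

lemma nbits_0 [simp]: "nbits 0 = []"
  by (simp add: nbits.simps)

lemma nbits_eq_Nil [simp]: "nbits n = [] \<longleftrightarrow> n = 0"
  by (subst nbits.simps) simp

lemma encode_nbits: "encode (nbits n) = encode n"
proof -
  have "map (\<lambda>b. if b then B1 else B0) (nbits n) = bits n"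
  proof (induction n rule: nbits.induct)
    case (1 n)
    then show ?case by (subst nbits.simps, subst bits.simps) simp
  qed
  moreover have "concat (map encode bs) = map (\<lambda>b. if b then B1 else B0) bs" for bs :: "bool list"
    by (induction bs) (simp_all add: encode_bool_def enc_bool_def)
  ultimately have "concat (map encode (nbits n)) = bits n" by simp
  then show ?thesis by (simp add: encode_list_def encode_nat_def enc_nat_def)
qed

text \<open>A number and its list of bits have the same encoding, so nothing has to be computed to
  pass from one to the other.\<close>

lemma FP_nbits [FP_intros]: "FP f \<Longrightarrow> FP (\<lambda>x. nbits (f x))"
  by (simp add: FP_def encode_nbits)

lemma FP_eq_0 [FP_intros]: "FP f \<Longrightarrow> FP (\<lambda>x. f x = (0::nat))"
  using FP_null[OF FP_nbits, of f] by simp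

definition dbl :: "bool \<Rightarrow> nat \<Rightarrow> nat" where
  "dbl b n = of_bool b + 2 * n"

lemma nbits_dbl: "b \<or> n \<noteq> 0 \<Longrightarrow> nbits (dbl b n) = b # nbits n"
  by (subst nbits.simps) (auto simp: dbl_def)

text \<open>Prefixing a bit to the bit list doubles the number and adds the bit. The exception is a
  0 bit in front of the number 0, since bit lists carry no leading zeros.\<close>

lemma FP_dbl [FP_intros]: "FP b \<Longrightarrow> FP f \<Longrightarrow> FP (\<lambda>x. dbl (b x) (f x))"
proof (rule FP_comp2[where g = dbl])
  let ?z = "\<lambda>p :: bool \<times> nat. \<not> fst p \<and> snd p = 0"
  show "FP (\<lambda>p. dbl (fst p) (snd p))" unfolding FP_def
  proof (rule ptime_if[where b = ?z])
    show "ptime UNIV encode (\<lambda>p. enc_bool (?z p))"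
    proof -
      have "FP ?z" by (intro FP_intros)
      then show ?thesis by (simp add: FP_def encode_bool_def)
    qed
    show "ptime {p \<in> UNIV. ?z p} encode (\<lambda>p. encode (dbl (fst p) (snd p)))"
      by (rule ptime_cong[OF ptime_const[of _ _ "encode (0::nat)"]]) (simp_all add: dbl_def)
    have "FP (\<lambda>p :: bool \<times> nat. fst p # nbits (snd p))" by (intro FP_intros)
    then have "ptime {p. \<not> ?z p} encode (\<lambda>p :: bool \<times> nat. encode (fst p # nbits (snd p)))"
      unfolding FP_def by (rule ptime_subset) simp
    then show "ptime {p \<in> UNIV. \<not> ?z p} encode (\<lambda>p. encode (dbl (fst p) (snd p)))"
    proof (rule ptime_cong[THEN ptime_subset])
      fix p :: "bool \<times> nat" assume "p \<in> {p. \<not> ?z p}"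
      then have "nbits (dbl (fst p) (snd p)) = fst p # nbits (snd p)" by (intro nbits_dbl) auto
      then show "encode (fst p # nbits (snd p)) = encode (dbl (fst p) (snd p))" by (metis encode_nbits)
    qed auto
  qed
qed

lemma size_of_nat: "size_of (n::nat) = length (nbits n) + 2"
proof -
  have "size_of xs = length xs + 2" for xs :: "bool list" by (induction xs) simp_all
  then show ?thesis by (metis encode_nbits)
qed

lemma less_power_nbits: "n < 2 ^ length (nbits n)"
proof (induction n rule: nbits.induct)
  case (1 n)
  show ?case
  proof (cases "n = 0")
    case False
    then have "length (nbits n) = Suc (length (nbits (n div 2)))" by (subst nbits.simps) simp
    then show ?thesis using 1[OF False] by simp
  qed simp
qed

lemma length_nbits_le: "n < 2 ^ k \<Longrightarrow> length (nbits n) \<le> k"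
proof (induction k arbitrary: n)
  case (Suc k)
  then show ?case by (subst nbits.simps) auto
qed simp

lemma length_nbits_mono: "m \<le> n \<Longrightarrow> length (nbits m) \<le> length (nbits n)"
  using length_nbits_le less_power_nbits le_less_trans by blast

lemma length_nbits_add: "length (nbits (m + n)) \<le> Suc (length (nbits m) + length (nbits n))"
proof (rule length_nbits_le)
  have "m < 2 ^ (length (nbits m) + length (nbits n))" "n < 2 ^ (length (nbits m) + length (nbits n))"
    using less_power_nbits[of m] less_power_nbits[of n]
    by (metis le_add1 le_add2 less_le_trans one_le_numeral power_increasing)+
  then show "m + n < 2 ^ Suc (length (nbits m) + length (nbits n))" by simp
qed

lemma length_nbits_mult: "length (nbits (m * n)) \<le> length (nbits m) + length (nbits n)"
proof (rule length_nbits_le)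
  show "m * n < 2 ^ (length (nbits m) + length (nbits n))"
    unfolding power_add using less_power_nbits[of m] less_power_nbits[of n] by (intro mult_strict_mono) auto
qed

lemma length_nbits_dbl: "length (nbits (dbl b n)) \<le> Suc (length (nbits n))"
  by (rule length_nbits_le) (use less_power_nbits[of n] in \<open>auto simp: dbl_def\<close>)

lemma size_of_nat_mono: "m \<le> n \<Longrightarrow> size_of m \<le> size_of (n::nat)"
  by (simp add: size_of_nat length_nbits_mono)

text \<open>Horner's rule from the most significant bit on. For \<open>a = 0\<close> it turns a bit
  list back into its number, which is how bitwise algorithms deliver their results.\<close>

lemma foldl_dbl: "foldl (\<lambda>n b. dbl b n) a (rev (nbits n)) = a * 2 ^ length (nbits n) + n"
proof (induction n arbitrary: a rule: nbits.induct)
  case (1 n)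
  show ?case
  proof (cases "n = 0")
    case False
    have e: "nbits n = odd n # nbits (n div 2)" using False by (subst nbits.simps) simp
    show ?thesis using 1[OF False, of a] by (simp add: e dbl_def mod_2_eq_odd[symmetric] del: mod_2_eq_odd)
  qed simp
qed

lemma FP_foldl_dbl [FP_intros]: "FP f \<Longrightarrow> FP g \<Longrightarrow> FP (\<lambda>x. foldl (\<lambda>n b. dbl b n) (f x) (g x))"
  by (rule FP_foldl[where q = "\<lambda>p. 1"])
    (auto intro!: FP_intros pbound_intros simp: size_of_nat length_nbits_dbl)

lemma nbits_div2: "nbits (n div 2) = tl (nbits n)"
  by (subst (2) nbits.simps) (simp)

lemma FP_div2 [FP_intros]: "FP f \<Longrightarrow> FP (\<lambda>x. f x div (2::nat))"
proof -
  assume f: "FP f"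
  have "FP (\<lambda>x. foldl (\<lambda>n b. dbl b n) 0 (rev (tl (nbits (f x)))))" by (intro FP_intros f)
  then show ?thesis by (simp add: foldl_dbl flip: nbits_div2)
qed

lemma FP_odd [FP_intros]: "FP f \<Longrightarrow> FP (\<lambda>x. odd (f x :: nat))"
proof -
  assume f: "FP f"
  have "FP (\<lambda>x. hd_or False (nbits (f x)))" by (intro FP_intros f)
  moreover have "hd_or False (nbits n) = odd n" for n by (subst nbits.simps) simp
  ultimately show ?thesis by simp
qed

lemma FP_even [FP_intros]: "FP f \<Longrightarrow> FP (\<lambda>x. even (f x :: nat))"
  using FP_not[OF FP_odd] by simp

lemma div_power_length_nbits: "length (nbits n) \<le> k \<Longrightarrow> n div 2 ^ k = 0"
  by (metis div_less less_le_trans less_power_nbits one_le_numeral power_increasing)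

lemma size_of_div2: "size_of (n div 2) \<le> size_of (n::nat)"
  by (rule size_of_nat_mono) simp

lemma size_of_Suc: "size_of (Suc n) \<le> Suc (size_of n)"
proof -
  have "length (nbits (Suc n)) \<le> Suc (length (nbits n))"
    by (rule length_nbits_le) (use less_power_nbits[of n] in simp)
  then show ?thesis by (simp add: size_of_nat)
qed

text \<open>State of binary addition: the unread parts of both summands, the carry, and the sum bits
  found so far. New bits go to the front, so the list ends up with the most significant bit first,
  as Horner's rule expects.\<close>

definition add_step :: "nat \<times> nat \<times> bool \<times> bool list \<Rightarrow> nat \<times> nat \<times> bool \<times> bool list" where
  "add_step s = (let a = fst s; b = fst (snd s); c = fst (snd (snd s)); w = snd (snd (snd s)) in
     (a div 2, b div 2, (if odd a then odd b \<or> c else odd b \<and> c), ((odd a = odd b) = c) # w))"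

lemma foldl_add_step:
  assumes "foldl (\<lambda>s _. add_step s) (a, b, c, w) xs = (a', b', c', w')"
  shows "a' = a div 2 ^ length xs \<and> b' = b div 2 ^ length xs \<and>
    foldl (\<lambda>n b. dbl b n) (a' + b' + of_bool c') w' = foldl (\<lambda>n b. dbl b n) (a + b + of_bool c) w"
  using assms
proof (induction xs arbitrary: a b c w)
  case (Cons x xs)
  let ?c = "if odd a then odd b \<or> c else odd b \<and> c"
  let ?d = "(odd a = odd b) = c"
  have "foldl (\<lambda>s _. add_step s) (a div 2, b div 2, ?c, ?d # w) xs = (a', b', c', w')"
    using Cons.prems by (simp add: add_step_def[of "(a, b, c, w)"])
  note IH = Cons.IH[OF this]
  have "dbl ?d (a div 2 + b div 2 + of_bool ?c) = a + b + of_bool c"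
    by (cases "odd a"; cases "odd b"; cases c) (auto simp: dbl_def elim!: oddE evenE)
  then show ?case using IH unfolding foldl.simps length_Cons power_Suc div_mult2_eq by metis
qed simp

lemma FP_add [FP_intros]: "FP f \<Longrightarrow> FP g \<Longrightarrow> FP (\<lambda>x. f x + g x :: nat)"
proof (rule FP_comp2[where g = "(+)"])
  \<comment> \<open>The list folded over serves only as a counter; it is long enough to shift both
    summands to 0.\<close>
  let ?r = "\<lambda>p :: nat \<times> nat. foldl (\<lambda>s _. add_step s) (fst p, snd p, False, []) (nbits (fst p) @ nbits (snd p))"
  have "FP ?r" unfolding add_step_def Let_def
    by (rule FP_foldl[where q = "\<lambda>p. 1"])
      (auto intro!: FP_intros pbound_intros add_mono le_SucI size_of_div2 simp: encode_prod_def)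
  then have "FP (\<lambda>p. foldl (\<lambda>n b. dbl b n) (if fst (snd (snd (?r p))) then 1 else 0) (snd (snd (snd (?r p)))))"
    by (intro FP_intros FP_comp[OF _ \<open>FP ?r\<close>])
  moreover have "foldl (\<lambda>n b. dbl b n) (if fst (snd (snd (?r p))) then 1 else 0) (snd (snd (snd (?r p)))) =
      fst p + snd p" for p
  proof -
    obtain a' b' c' w' where r: "?r p = (a', b', c', w')" by (cases "?r p")
    from foldl_add_step[OF r] show ?thesis
      using div_power_length_nbits[of "fst p" "length (nbits (fst p)) + length (nbits (snd p))"]
        div_power_length_nbits[of "snd p" "length (nbits (fst p)) + length (nbits (snd p))"]
      unfolding r by (cases c') auto
  qed
  ultimately show "FP (\<lambda>p :: nat \<times> nat. fst p + snd p)" by simp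
qed

text \<open>Bits are read from the least significant end, so the verdict of a higher position
  overrides the one found so far.\<close>

definition le_step :: "nat \<times> nat \<times> bool \<Rightarrow> nat \<times> nat \<times> bool" where
  "le_step s = (let a = fst s; b = fst (snd s) in
     (a div 2, b div 2, if odd a = odd b then snd (snd s) else odd b))"

lemma foldl_le_step:
  assumes "foldl (\<lambda>s _. le_step s) (a, b, r) xs = (a', b', r')"
  shows "a' = a div 2 ^ length xs \<and> b' = b div 2 ^ length xs \<and>
    ((a' < b' \<or> a' = b' \<and> r') \<longleftrightarrow> (a < b \<or> a = b \<and> r))"
  using assms
proof (induction xs arbitrary: a b r)
  case (Cons x xs)
  let ?r = "if odd a = odd b then r else odd b"
  have "foldl (\<lambda>s _. le_step s) (a div 2, b div 2, ?r) xs = (a', b', r')"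
    using Cons.prems by (simp add: le_step_def[of "(a, b, r)"] split: if_splits)
  note IH = Cons.IH[OF this]
  have "(a div 2 < b div 2 \<or> a div 2 = b div 2 \<and> ?r) \<longleftrightarrow> (a < b \<or> a = b \<and> r)"
    by (cases r; simp; presburger)
  then show ?case using IH unfolding length_Cons power_Suc div_mult2_eq by metis
qed simp

lemma FP_le [FP_intros]: "FP f \<Longrightarrow> FP g \<Longrightarrow> FP (\<lambda>x. f x \<le> (g x :: nat))"
proof (rule FP_comp2[where g = "(\<le>)"])
  let ?r = "\<lambda>p :: nat \<times> nat. foldl (\<lambda>s _. le_step s) (fst p, snd p, True) (nbits (fst p) @ nbits (snd p))"
  have "FP ?r" unfolding le_step_def Let_def
    by (rule FP_foldl[where q = "\<lambda>p. 1"])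
      (auto intro!: FP_intros pbound_intros add_mono le_SucI size_of_div2 simp: encode_prod_def)
  then have "FP (\<lambda>p. snd (snd (?r p)))" by (intro FP_intros FP_comp[OF _ \<open>FP ?r\<close>])
  moreover have "snd (snd (?r p)) = (fst p \<le> snd p)" for p
  proof -
    obtain a' b' r' where r: "?r p = (a', b', r')" by (cases "?r p")
    from foldl_le_step[OF r] show ?thesis
      using div_power_length_nbits[of "fst p" "length (nbits (fst p)) + length (nbits (snd p))"]
        div_power_length_nbits[of "snd p" "length (nbits (fst p)) + length (nbits (snd p))"]
      unfolding r by auto
  qed
  ultimately show "FP (\<lambda>p :: nat \<times> nat. fst p \<le> snd p)" by simp
qed

lemma FP_eq_nat [FP_intros]: "FP f \<Longrightarrow> FP g \<Longrightarrow> FP (\<lambda>x. f x = (g x :: nat))"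
  unfolding order_eq_iff by (intro FP_intros)

lemma FP_mult [FP_intros]: "FP f \<Longrightarrow> FP g \<Longrightarrow> FP (\<lambda>x. f x * g x :: nat)"
proof (rule FP_comp2[where g = "(*)"])
  \<comment> \<open>Multiplication by doubling and adding, starting at the most significant bit of
    the second factor.\<close>
  let ?h = "\<lambda>p a b. if b then dbl False a + fst p else dbl False a"
  have "FP (\<lambda>p :: nat \<times> nat. foldl (?h p) 0 (rev (nbits (snd p))))"
  proof (rule FP_foldl[where step = ?h])
    show "pbound UNIV (\<lambda>p. 2 + size_of p) (\<lambda>p. size_of p)" by (intro pbound_intros)
    show "size_of (?h e a x) \<le> size_of a + (2 + size_of (e, x))" for e :: "nat \<times> nat" and a x
      using length_nbits_add[of "dbl False a" "fst e"] length_nbits_dbl[of False a]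
      by (auto simp: encode_prod_def size_of_nat)
  qed (intro FP_intros)+
  moreover have "foldl (?h p) a (rev (nbits n)) = a * 2 ^ length (nbits n) + n * fst p"
      for p :: "nat \<times> nat" and a n
  proof (induction n arbitrary: a rule: nbits.induct)
    case (1 n)
    show ?case
    proof (cases "n = 0")
      case False
      have e: "nbits n = odd n # nbits (n div 2)" using False by (subst nbits.simps) simp
      show ?thesis unfolding e using 1[OF False, of a]
        by (auto simp: dbl_def algebra_simps elim!: oddE evenE)
    qed simp
  qed
  ultimately show "FP (\<lambda>p :: nat \<times> nat. fst p * snd p)" by (simp add: mult.commute)
qed

lemma FP_Suc [FP_intros]: "FP f \<Longrightarrow> FP (\<lambda>x. Suc (f x))"
  using FP_add[OF _ FP_const[of 1], of f] by simp

definition nth_or :: "'a \<Rightarrow> 'a list \<Rightarrow> nat \<Rightarrow> 'a" where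
  "nth_or d xs i = (if i < length xs then xs ! i else d)"

lemma fst_foldl_count: "fst (foldl (\<lambda>s x. (Suc (fst s), g s x)) (k, a) xs) = k + length xs"
  by (induction xs rule: rev_induct) auto

lemma FP_nth_or [FP_intros]: "FP d \<Longrightarrow> FP f \<Longrightarrow> FP i \<Longrightarrow> FP (\<lambda>x. nth_or (d x) (f x) (i x))"
proof -
  assume f: "FP d" "FP f" "FP i"
  let ?h = "\<lambda>j s x. (Suc (fst s), if fst s = j then x else snd s)"
  have "FP (\<lambda>x. snd (foldl (?h (i x)) (0, d x) (f x)))"
  proof (rule FP_snd, rule FP_foldl)
    show "pbound UNIV (\<lambda>p. 2 + size_of p) (\<lambda>p. size_of p)" by (intro pbound_intros)
    show "size_of (?h (i e) a x) \<le> size_of a + (2 + size_of (e, x))" for e x and a :: "nat \<times> 'b"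
      using size_of_Suc[of "fst a"] by (auto simp: encode_prod_def)
  qed (intro FP_intros f FP_comp[OF f(3)])+
  moreover have "snd (foldl (?h j) (k, a) xs) = (if k \<le> j \<and> j < k + length xs then xs ! (j - k) else a)"
    for j k a and xs :: "'b list"
  proof (induction xs arbitrary: k a)
    case (Cons x xs)
    show ?case using Cons[of "Suc k"] by (auto simp: nth_Cons')
  qed auto
  then have "snd (foldl (?h j) (0, a) xs) = nth_or a xs j" for j a and xs :: "'b list"
    by (simp add: nth_or_def)
  ultimately show ?thesis by (simp only:)
qed

text \<open>The new entry contains the counter, whose size depends on the accumulator, so the
  additive criterion \<open>FP_foldl\<close> does not apply. Instead the counter is bounded by the
  number of steps.\<close>

lemma FP_indexed [FP_intros]: "FP f \<Longrightarrow> FP (\<lambda>x. zip [0..<length (f x)] (f x))"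
proof -
  assume f: "FP f"
  let ?h = "\<lambda>s x. (Suc (fst s), (fst s, x) # snd s)"
  have "FP (\<lambda>x. rev (snd (foldl ?h (0, []) (f x))))"
  proof (intro FP_rev FP_snd, rule FP_foldl_bounded[where c = 3])
    fix e ys zs assume e: "f e = ys @ zs"
    let ?n = "size_of (e, (0::nat, [] :: (nat \<times> 'b) list), f e)"
    have "size_of (foldl ?h (0, []) us) \<le> 6 + size_of us + length us * (3 + length us)"
        if "length us \<le> length ys" for us
      using that
    proof (induction us rule: rev_induct)
      case (snoc u us)
      have "length (nbits (length us)) \<le> length us" "length (nbits (Suc (length us))) \<le> Suc (length us)"
        by (rule length_nbits_le, rule less_exp)+
      have fl: "fst (foldl ?h (0, []) us) = length us" using fst_foldl_count[of "\<lambda>s x. (fst s, x) # snd s"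
          0 "[]" us] by simp
      have "size_of (foldl ?h (0, []) (us @ [u])) \<le> size_of (foldl ?h (0, []) us) + 1 + size_of (length us)
          + size_of u"
        using size_of_Suc[of "length us"] by (simp add: fl encode_prod_def)
      also have "\<dots> \<le> 6 + size_of (us @ [u]) + length (us @ [u]) * (3 + length (us @ [u]))"
        using snoc size_of_append[of us "[u]"] \<open>length (nbits (length us)) \<le> length us\<close>
        by (simp add: size_of_nat algebra_simps)
      finally show ?case .
    qed (simp add: encode_prod_def size_of_nat)
    from this[of ys] have "size_of (foldl ?h (0, []) ys) \<le> 6 + size_of ys + length ys * (3 + length ys)" by simp
    moreover have "size_of ys \<le> size_of (f e)" using size_of_append[of ys zs] length_le_size_of[of zs] e
      by (simp add: encode_list_def)
    moreover have "length ys \<le> size_of (f e)" using length_le_size_of[of ys] calculation(2) by linarith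
    moreover have "size_of (f e) \<le> ?n" "2 \<le> ?n" by (auto simp: encode_prod_def size_of_nat)
    ultimately have "size_of (foldl ?h (0, []) ys) \<le> 6 + ?n + ?n * (3 + ?n)"
      by (meson add_mono le_trans mult_mono order_refl zero_le)
    also have "\<dots> \<le> (?n + 2) ^ 3" by (simp add: power3_eq_cube algebra_simps)
    finally show "size_of (foldl ?h (0, []) ys) \<le> (?n + 2) ^ 3" .
  qed (intro FP_intros f)+
  moreover have "snd (foldl ?h (k, a) xs) = rev (zip [k..<k + length xs] xs) @ a" for k a and xs :: "'b list"
  proof (induction xs arbitrary: k a)
    case (Cons x xs)
    show ?case using Cons[of "Suc k"] by (simp add: upt_rec)
  qed simp
  ultimately show ?thesis by simp
qed

lemma FP_length [FP_intros]: "FP f \<Longrightarrow> FP (\<lambda>x. length (f x))"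
proof -
  assume f: "FP f"
  have "FP (\<lambda>x. foldl (\<lambda>n _. Suc n) 0 (f x))"
  proof (rule FP_foldl)
    show "pbound UNIV (\<lambda>p. 2) (\<lambda>p. size_of p)" by (intro pbound_intros)
    show "size_of (Suc a) \<le> size_of a + 2" for a
      using size_of_Suc[of a] by simp
  qed (intro FP_intros f)+
  moreover have "foldl (\<lambda>n _. Suc n) k xs = k + length xs" for k and xs :: "'b list"
    by (induction xs arbitrary: k) auto
  ultimately show ?thesis by simp
qed

lemma FP_sum_list [FP_intros]: "FP f \<Longrightarrow> FP (\<lambda>x. sum_list (f x) :: nat)"
proof -
  assume f: "FP f"
  have "FP (\<lambda>x. foldl (+) 0 (f x))"
  proof (rule FP_foldl)
    show "pbound UNIV (\<lambda>p. 1 + size_of p) (\<lambda>p. size_of p)" by (intro pbound_intros)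
    show "size_of (a + x) \<le> size_of a + (1 + size_of (e, x))" for a x :: nat and e :: 'a
      using length_nbits_add[of a x] by (simp add: size_of_nat encode_prod_def)
  qed (intro FP_intros f)+
  moreover have "foldl (+) k xs = k + sum_list xs" for k :: nat and xs
    by (induction xs arbitrary: k) auto
  ultimately show ?thesis by simp
qed

lemma FP_eq_const_bool_list: "FP f \<Longrightarrow> FP (\<lambda>x. f x = (c :: bool list))"
proof (induction c arbitrary: f)
  case Nil
  then show ?case by (rule FP_null)
next
  case (Cons b c)
  have "FP (\<lambda>x. f x \<noteq> [] \<and> hd_or False (f x) = b \<and> tl (f x) = c)"
    by (intro FP_intros Cons)
  moreover have "(f x \<noteq> [] \<and> hd_or False (f x) = b \<and> tl (f x) = c) = (f x = b # c)" for x
    by (cases "f x") auto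
  ultimately show ?case by simp
qed

text \<open>On a finite set of arguments nothing has to be computed: the values are stored in the program.\<close>

lemma FP_finite_table:
  assumes "finite (S :: (bool list \<times> bool list) set)" "FP f"
  shows "FP (\<lambda>x. if f x \<in> S then g (f x) else d)"
  using assms(1)
proof induction
  case empty
  then show ?case by (simp add: FP_const)
next
  case (insert s S)
  have "FP (\<lambda>x. if fst (f x) = fst s \<and> snd (f x) = snd s then g s else if f x \<in> S then g (f x) else d)"
    by (intro FP_if FP_conj FP_eq_const_bool_list FP_intros assms(2) insert.IH)
  moreover have "(if fst (f x) = fst s \<and> snd (f x) = snd s then g s else if f x \<in> S then g (f x) else d) =
      (if f x \<in> insert s S then g (f x) else d)" for x
    by (cases "f x = s") (auto dest: prod_eqI)
  ultimately show ?case by simp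
qed

section \<open>Instances as data\<close>

definition rat_rep :: "rat \<Rightarrow> bool \<times> nat \<times> nat" where
  "rat_rep r = (case quotient_of r of (a, b) \<Rightarrow> (a < 0, nat \<bar>a\<bar>, nat b))"

definition truth_table :: "brel \<Rightarrow> bool list" where
  "truth_table R = map (\<lambda>t. t \<in> tuples R) (List.n_lists (arity R) [False, True])"

text \<open>The instance rewritten in types of class \<open>data\<close> such that its encoding is
  literally \<open>enc_wmo\<close> (see \<open>encode_wmo_rep\<close>). Computations on instances
  thereby become functions in \<open>FP\<close>.\<close>

definition wmo_rep :: "wmo_instance \<Rightarrow>
    (bool \<times> nat \<times> nat) list \<times> (bool list \<times> nat list) list \<times> (bool \<times> nat \<times> nat)" where
  "wmo_rep I = (map rat_rep (weights I),
     map (\<lambda>C. (truth_table (fst C), snd C)) (constraints I), rat_rep (threshold I))"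

lemma encode_rat_rep: "encode (rat_rep r) = enc_rat r"
  by (cases "quotient_of r") (simp add: rat_rep_def enc_rat_def encode_pair encode_nat_def encode_bool_def)

lemma encode_wmo_rep: "encode (wmo_rep I) = enc_wmo I"
proof -
  have 1: "encode (map f xs) = enc_list e xs" if "\<And>x. encode (f x) = e x" for f :: "'x \<Rightarrow> 'y::data" and e xs
    using that by (simp add: encode_list_def enc_list_def o_def)
  have 2: "encode xs = enc_list encode xs" for xs :: "'y::data list"
    by (simp add: encode_list_def enc_list_def)
  have 3: "encode (truth_table R) = enc_brel R" for R
    unfolding truth_table_def enc_brel_def by (rule 1) (simp add: encode_bool_def)
  have 4: "encode (truth_table (fst C), snd C) = enc_constraint C" for C
    by (simp only: encode_pair 3 2[of "snd C"] enc_constraint_def encode_nat_def)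
  show ?thesis unfolding wmo_rep_def encode_pair enc_wmo_def
    by (intro arg_cong2[where f = "(@)"] 1 4 encode_rat_rep)
qed

lemma rat_rep_nonneg:
  assumes "0 \<le> r"
  obtains a b where "rat_rep r = (False, a, b)" "b > 0" "r = of_nat a / of_nat b" "coprime a b"
proof -
  obtain p q where pq: "quotient_of r = (p, q)" by (cases "quotient_of r")
  have q: "q > 0" by (rule quotient_of_denom_pos[OF pq])
  have r: "r = of_int p / of_int q" by (rule quotient_of_div[OF pq])
  have p: "p \<ge> 0" using assms q unfolding r by (simp add: zero_le_divide_iff)
  have c: "coprime p q" by (rule quotient_of_coprime[OF pq])
  show ?thesis
  proof (rule that[of "nat p" "nat q"])
    show "r = of_nat (nat p) / of_nat (nat q)" using r p q by simp
    have "coprime (int (nat p)) (int (nat q))" using c p q by simp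
    then show "coprime (nat p) (nat q)" by (simp only: coprime_int_iff)
  qed (use pq p q in \<open>auto simp: rat_rep_def\<close>)
qed

lemma rat_rep_neg: "fst (rat_rep r) \<longleftrightarrow> r < 0"
proof -
  obtain p q where pq: "quotient_of r = (p, q)" by (cases "quotient_of r")
  have q: "q > 0" by (rule quotient_of_denom_pos[OF pq])
  have r: "r = of_int p / of_int q" by (rule quotient_of_div[OF pq])
  have "r < 0 \<longleftrightarrow> p < 0" using q by (simp add: r divide_less_0_iff)
  then show ?thesis by (simp add: rat_rep_def pq)
qed

lemma rat_rep_fraction:
  assumes "b > 0" "coprime a b"
  shows "rat_rep (of_nat a / of_nat b) = (False, a, b)"
proof -
  have "(of_nat a / of_nat b :: rat) = Fract (int a) (int b)"
    by (simp add: Fract_of_int_quotient)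
  then have "quotient_of (of_nat a / of_nat b) = (int a, int b)"
    using assms by (simp add: quotient_of_Fract normalize_stable)
  then show ?thesis by (simp add: rat_rep_def)
qed

text \<open>Fractions are added over the product of the denominators, without cancelling.\<close>

definition sel_step :: "nat \<times> nat \<Rightarrow> (bool \<times> nat \<times> nat) \<times> bool \<Rightarrow> nat \<times> nat" where
  "sel_step s x = (fst s * snd (snd (fst x)) + (if snd x then fst (snd (fst x)) * snd s else 0),
     snd s * snd (snd (fst x)))"

definition sel_sum :: "((bool \<times> nat \<times> nat) \<times> bool) list \<Rightarrow> nat \<times> nat" where
  "sel_sum xs = foldl sel_step (0, 1) xs"

text \<open>Numerator and denominator are bounded jointly: a step with the fraction
  \<open>a / b\<close> multiplies their sum by at most \<open>a + b\<close>, so the bit lengths add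
  up to no more than the size of the list, up to a constant.\<close>

lemma sel_sum_size: "size_of (sel_sum xs) \<le> 2 * (2 + size_of xs) + 4"
proof -
  define B where "B xs = (\<Sum>x\<leftarrow>xs. 1 + size_of (fst x))" for xs :: "((bool \<times> nat \<times> nat) \<times> bool) list"
  have "length (nbits (fst (sel_sum xs) + snd (sel_sum xs))) \<le> 1 + B xs"
  proof (induction xs rule: rev_induct)
    case Nil then show ?case by (simp add: sel_sum_def B_def nbits.simps[of "Suc 0"])
  next
    case (snoc x xs)
    obtain n d where nd: "sel_sum xs = (n, d)" by (cases "sel_sum xs")
    obtain g a b c where x: "x = ((g, a, b), c)" by (metis prod.collapse)
    have s: "sel_sum (xs @ [x]) = sel_step (n, d) x" using nd by (simp add: sel_sum_def)
    have "fst (sel_sum (xs @ [x])) + snd (sel_sum (xs @ [x])) \<le> (n + d) * (a + b)"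
      unfolding s by (simp add: sel_step_def x algebra_simps)
    then have "length (nbits (fst (sel_sum (xs @ [x])) + snd (sel_sum (xs @ [x])))) \<le> length (nbits (n +
        d)) + length (nbits (a + b))"
      using length_nbits_mono length_nbits_mult le_trans by blast
    also have "\<dots> \<le> 1 + B xs + Suc (length (nbits a) + length (nbits b))"
      using snoc nd length_nbits_add[of a b] by simp
    also have "\<dots> \<le> 1 + B (xs @ [x])" by (simp add: B_def x encode_pair size_of_nat)
    finally show ?case .
  qed
  moreover have "B xs \<le> size_of xs"
    unfolding B_def by (induction xs) (auto simp: encode_prod_def)
  ultimately have "length (nbits (fst (sel_sum xs) + snd (sel_sum xs))) \<le> 1 + size_of xs" by linarith
  moreover have "length (nbits (fst (sel_sum xs))) \<le> length (nbits (fst (sel_sum xs) + snd (sel_sum xs)))"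
    "length (nbits (snd (sel_sum xs))) \<le> length (nbits (fst (sel_sum xs) + snd (sel_sum xs)))"
    by (intro length_nbits_mono; simp)+
  ultimately show ?thesis by (simp add: encode_prod_def size_of_nat)
qed

lemma FP_sel_sum [FP_intros]: "FP f \<Longrightarrow> FP (\<lambda>x. sel_sum (f x))"
proof -
  assume f: "FP f"
  show ?thesis unfolding sel_sum_def
  proof (rule FP_foldl_bounded[OF _ f, where c = 4])
    fix e ys zs assume e: "f e = ys @ zs"
    let ?n = "size_of (e, (0::nat, 1::nat), f e)"
    have "size_of ys \<le> size_of (f e)" using e by (simp add: encode_list_def)
    then have "size_of (foldl sel_step (0, 1) ys) \<le> 2 * (2 + ?n) + 4"
      using sel_sum_size[of ys] by (simp add: sel_sum_def encode_pair)
    also have "\<dots> \<le> (?n + 2) * 4" by simp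
    also have "\<dots> \<le> (?n + 2) * (?n + 2) ^ 3"
      using power_mono[of 2 "?n + 2" 3] by (intro mult_left_mono) simp_all
    finally show "size_of (foldl sel_step (0, 1) ys) \<le> (?n + 2) ^ 4"
        by (simp add: power_Suc[symmetric] del: power_Suc)
  qed (unfold sel_step_def, (intro FP_intros)+)
qed

definition sel_le :: "((bool \<times> nat \<times> nat) \<times> bool) list \<Rightarrow> ((bool \<times> nat \<times> nat) \<times> bool) list \<Rightarrow> bool" where
  "sel_le xs ys \<longleftrightarrow> fst (sel_sum xs) * snd (sel_sum ys) \<le> fst (sel_sum ys) * snd (sel_sum xs)"

lemma FP_sel_le [FP_intros]: "FP f \<Longrightarrow> FP g \<Longrightarrow> FP (\<lambda>x. sel_le (f x) (g x))"
  unfolding sel_le_def by (intro FP_intros)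

lemma sel_sum_value:
  assumes "\<forall>w\<in>set ws. 0 \<le> fst w"
  shows "snd (sel_sum (map (\<lambda>w. (rat_rep (fst w), snd w)) ws)) > 0 \<and>
    (of_nat (fst (sel_sum (map (\<lambda>w. (rat_rep (fst w), snd w)) ws))) :: rat) =
      (\<Sum>w\<leftarrow>ws. fst w * of_bool (snd w)) * of_nat (snd (sel_sum (map (\<lambda>w. (rat_rep (fst w), snd w)) ws)))"
  using assms
proof (induction ws rule: rev_induct)
  case Nil
  then show ?case by (simp add: sel_sum_def)
next
  case (snoc w ws)
  have "0 \<le> fst w" using snoc.prems by simp
  then obtain a b where ab: "rat_rep (fst w) = (False, a, b)" "b > 0" "fst w = of_nat a / of_nat b"
    by (rule rat_rep_nonneg)
  let ?f = "map (\<lambda>w. (rat_rep (fst w), snd w))"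
  obtain n d where nd: "sel_sum (?f ws) = (n, d)" by (cases "sel_sum (?f ws)")
  have s: "sel_sum (?f (ws @ [w])) = sel_step (n, d) (rat_rep (fst w), snd w)" using nd
      by (simp add: sel_sum_def)
  have IH: "d > 0" "(of_nat n :: rat) = (\<Sum>w\<leftarrow>ws. fst w * of_bool (snd w)) * of_nat d"
    using snoc nd by auto
  show ?case unfolding s ab(1) using IH ab(2,3) by (cases "snd w") (auto simp: sel_step_def field_simps)
qed

lemma sel_le_value:
  assumes "\<forall>w\<in>set ws. 0 \<le> fst w" "\<forall>w\<in>set vs. 0 \<le> fst w"
  shows "sel_le (map (\<lambda>w. (rat_rep (fst w), snd w)) ws) (map (\<lambda>w. (rat_rep (fst w), snd w)) vs) \<longleftrightarrow>
    (\<Sum>w\<leftarrow>ws. fst w * of_bool (snd w)) \<le> (\<Sum>w\<leftarrow>vs. fst w * of_bool (snd w))"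
proof -
  have *: "a * e \<le> b * d \<longleftrightarrow> X \<le> Y"
    if "0 < d \<and> (of_nat a :: rat) = X * of_nat d" "0 < e \<and> (of_nat b :: rat) = Y * of_nat e"
        for a b d e :: nat and X Y
  proof -
    have "a * e \<le> b * d \<longleftrightarrow> (of_nat (a * e) :: rat) \<le> of_nat (b * d)" by (simp only: of_nat_le_iff)
    also have "\<dots> \<longleftrightarrow> X * (of_nat d * of_nat e) \<le> Y * (of_nat d * of_nat e)"
      unfolding of_nat_mult using that by (simp only: mult_ac)
    also have "\<dots> \<longleftrightarrow> X \<le> Y" using that by (intro mult_le_cancel_right_pos) simp
    finally show ?thesis .
  qed
  show ?thesis unfolding sel_le_def by (rule *[OF sel_sum_value[OF assms(1)] sel_sum_value[OF assms(2)]])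
qed

section \<open>Checking an assignment\<close>

definition select :: "(bool \<times> nat \<times> nat) list \<Rightarrow> (nat \<Rightarrow> bool) \<Rightarrow> ((bool \<times> nat \<times> nat) \<times> bool) list" where
  "select ws h = map (\<lambda>p. (snd p, h (fst p))) (zip [0..<length ws] ws)"

lemma FP_select [FP_intros]:
  "FP f \<Longrightarrow> FP (\<lambda>p. h (fst p) (snd p)) \<Longrightarrow> FP (\<lambda>x. select (f x) (h x))"
  unfolding select_def by (intro FP_intros) (auto intro!: FP_comp2[where g = h] FP_intros)

lemma select_rat_rep:
  "select (map rat_rep ws) h = map (\<lambda>w. (rat_rep (fst w), snd w)) (map (\<lambda>i. (ws ! i, h i)) [0..<length ws])"
  unfolding select_def by (rule nth_equalityI) auto

lemma sum_list_select: "(\<Sum>w\<leftarrow>map (\<lambda>i. (ws ! i, h i)) [0..<length ws]. fst w * of_bool (snd w)) =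
    (\<Sum>i<length ws. ws ! i * of_bool (h i) :: rat)"
  by (simp add: o_def interv_sum_list_conv_sum_set_nat atLeast0LessThan)

lemma sel_le_select:
  assumes "\<forall>w\<in>set ws. 0 \<le> w"
  shows "sel_le (select (map rat_rep ws) h) (select (map rat_rep ws) h') \<longleftrightarrow>
    (\<Sum>i<length ws. ws ! i * of_bool (h i)) \<le> (\<Sum>i<length ws. ws ! i * of_bool (h' i))"
  unfolding select_rat_rep sum_list_select[symmetric] by (rule sel_le_value) (use assms in auto)

text \<open>Satisfaction as a finite table keyed by truth tables, since encoded instances mention
  relations only in this form.\<close>

definition sat_set :: "brel set \<Rightarrow> (bool list \<times> bool list) set" where
  "sat_set \<Gamma> = {(truth_table R, t) | R t. R \<in> \<Gamma> \<and> t \<in> tuples R}"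

lemma mem_n_lists: "t \<in> set (List.n_lists k [False, True]) \<longleftrightarrow> length t = k"
  unfolding set_n_lists by auto

lemma finite_bool_lists: "finite {t :: bool list. length t = k}"
  using finite_lists_length_eq[of "UNIV :: bool set" k] by simp

lemma finite_sat_set: "constraint_language \<Gamma> \<Longrightarrow> finite (sat_set \<Gamma>)"
proof -
  assume G: "constraint_language \<Gamma>"
  have "sat_set \<Gamma> = (\<Union>R\<in>\<Gamma>. Pair (truth_table R) ` tuples R)" by (auto simp: sat_set_def)
  moreover have "finite (tuples R)" if "R \<in> \<Gamma>" for R
    by (rule finite_subset[OF _ finite_bool_lists[of "arity R"]]) (use G that in \<open>auto simp:
        constraint_language_def\<close>)
  ultimately show ?thesis using G by (auto simp: constraint_language_def)
qed

text \<open>A truth table has length \<open>2 ^ arity\<close>, so it determines the arity, and in a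
  constraint language all tuples have that length. Hence relations of \<Gamma> with equal truth
  tables have equal tuples.\<close>

lemma mem_sat_set:
  assumes "constraint_language \<Gamma>" "R \<in> \<Gamma>"
  shows "(truth_table R, t) \<in> sat_set \<Gamma> \<longleftrightarrow> t \<in> tuples R"
proof
  assume "(truth_table R, t) \<in> sat_set \<Gamma>"
  then obtain R' where R': "R' \<in> \<Gamma>" "truth_table R = truth_table R'" "t \<in> tuples R'" by (auto simp: sat_set_def)
  have len: "length (truth_table R) = 2 ^ arity R" for R by (simp add: truth_table_def length_n_lists
      numeral_2_eq_2)
  have "(2::nat) ^ arity R = 2 ^ arity R'" using len R'(2) by metis
  then have a: "arity R = arity R'" by simp
  have "length t = arity R" using assms(1) R' a by (auto simp: constraint_language_def)
  moreover have "\<forall>t\<in>set (List.n_lists (arity R) [False, True]). (t \<in> tuples R) = (t \<in> tuples R')"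
    using R'(2) unfolding truth_table_def a by (simp add: map_eq_conv)
  ultimately show "t \<in> tuples R" using R'(3) mem_n_lists by blast
qed (use assms in \<open>auto simp: sat_set_def\<close>)

text \<open>The comparison of fractions ignores signs. A negative threshold is met by every value
  and is therefore treated separately; otherwise it enters as a list with a single selected weight.
  Variables beyond the end of \<open>h\<close> count as 0.\<close>

definition wmo_check :: "(bool list \<times> bool list) set \<Rightarrow>
    ((bool \<times> nat \<times> nat) list \<times> (bool list \<times> nat list) list \<times> (bool \<times> nat \<times> nat)) \<Rightarrow> bool list \<Rightarrow> bool" where
  "wmo_check S I h \<longleftrightarrow> (\<forall>C\<in>set (fst (snd I)). if (fst C, map (nth_or False h) (snd C)) \<in> S then True else False) \<and>
     (fst (snd (snd I)) \<or> sel_le (select [snd (snd I)] (\<lambda>_. True)) (select (fst I) (nth_or False h)))"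

lemma FP_wmo_check:
  assumes "finite S" "FP f" "FP g"
  shows "FP (\<lambda>x. wmo_check S (f x) (g x))"
  unfolding wmo_check_def
  by (intro FP_intros assms FP_finite_table[where g = "\<lambda>_. True" and S = S] FP_comp[OF assms(2)] FP_comp[OF
      assms(3)])

lemma wmo_value_nonneg: "I \<in> wmo_instances \<Gamma> \<Longrightarrow> 0 \<le> wmo_value I h"
  unfolding wmo_value_def wmo_var_def
  by (rule sum_nonneg) (auto simp: wmo_instances_def)

lemma wmo_instances_constraint:
  assumes "I \<in> wmo_instances \<Gamma>" "(R, vs) \<in> set (constraints I)"
  shows "R \<in> \<Gamma>" "length vs = arity R" "set vs \<subseteq> {..<length (weights I)}"
  using assms by (auto simp: wmo_instances_def wmo_var_def)

lemma wmo_check_correct: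
  assumes "constraint_language \<Gamma>" "I \<in> wmo_instances \<Gamma>"
  shows "wmo_check (sat_set \<Gamma>) (wmo_rep I) h \<longleftrightarrow>
    wmo_solution I (nth_or False h) \<and> threshold I \<le> wmo_value I (nth_or False h)"
proof -
  have 1: "(\<forall>C\<in>set (fst (snd (wmo_rep I))). if (fst C, map (nth_or False h) (snd C)) \<in> sat_set \<Gamma> then True
      else False) \<longleftrightarrow>
      wmo_solution I (nth_or False h)"
    unfolding wmo_solution_def wmo_rep_def
    using mem_sat_set[OF assms(1) wmo_instances_constraint(1)[OF assms(2)]] by auto
  have w: "\<forall>w\<in>set (weights I). 0 \<le> w" using assms(2) by (auto simp: wmo_instances_def)
  have "(fst (rat_rep (threshold I)) \<or> sel_le (select [rat_rep (threshold I)] (\<lambda>_. True)) (select (map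
      rat_rep (weights I)) (nth_or False h))) \<longleftrightarrow>
     threshold I \<le> wmo_value I (nth_or False h)"
  proof (cases "threshold I < 0")
    case True
    then show ?thesis using wmo_value_nonneg[OF assms(2), of "nth_or False h"] by (simp add: rat_rep_neg)
  next
    case False
    have "sel_le (select (map rat_rep [threshold I]) (\<lambda>_. True)) (select (map rat_rep (weights I)) (nth_or
        False h)) \<longleftrightarrow>
       (\<Sum>i<length [threshold I]. [threshold I] ! i * of_bool True) \<le>
       (\<Sum>i<length (weights I). weights I ! i * of_bool (nth_or False h i))"
      unfolding select_rat_rep sum_list_select[symmetric]
      by (rule sel_le_value) (use False w in auto)
    then show ?thesis using False by (simp add: rat_rep_neg wmo_value_def wmo_var_def)
  qed
  then show ?thesis using 1 by (simp add: wmo_check_def wmo_rep_def)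
qed

lemma wmo_cong:
  assumes "I \<in> wmo_instances \<Gamma>" "\<And>v. v < length (weights I) \<Longrightarrow> h v = h' v"
  shows "wmo_solution I h = wmo_solution I h'" "wmo_value I h = wmo_value I h'"
proof -
  have "map h vs = map h' vs" if "(R, vs) \<in> set (constraints I)" for R vs
    using assms(2) wmo_instances_constraint(3)[OF assms(1) that] by (intro map_cong) auto
  then show "wmo_solution I h = wmo_solution I h'" 
    unfolding wmo_solution_def by (intro ball_cong refl) (metis (mono_tags, lifting) case_prod_beta
        prod.collapse)
  show "wmo_value I h = wmo_value I h'" unfolding wmo_value_def wmo_var_def
      by (rule sum.cong) (use assms(2) in auto)
qed

lemma wmo_yes_iff_check:
  assumes "constraint_language \<Gamma>" "I \<in> wmo_instances \<Gamma>"
  shows "wmo_yes I \<longleftrightarrow> (\<exists>h. length h = length (weights I) \<and> wmo_check (sat_set \<Gamma>) (wmo_rep I) h)"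
proof
  assume "wmo_yes I"
  then obtain h where h: "wmo_solution I h" "threshold I \<le> wmo_value I h" by (auto simp: wmo_yes_def)
  let ?h = "map h [0..<length (weights I)]"
  have "nth_or False ?h v = h v" if "v < length (weights I)" for v using that by (simp add: nth_or_def)
  then have "wmo_check (sat_set \<Gamma>) (wmo_rep I) ?h"
    unfolding wmo_check_correct[OF assms] using h wmo_cong[OF assms(2)] by metis
  then show "\<exists>h. length h = length (weights I) \<and> wmo_check (sat_set \<Gamma>) (wmo_rep I) h"
    by (intro exI[of _ ?h]) simp
qed (auto simp: wmo_check_correct[OF assms] wmo_yes_def)

section \<open>Greatest solutions\<close>

type_synonym wmo_data = "(bool \<times> nat \<times> nat) list \<times> (bool list \<times> nat list) list \<times> (bool \<times> nat \<times> nat)"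

definition decides :: "brel set \<Rightarrow> (wmo_data \<Rightarrow> bool) \<Rightarrow> bool" where
  "decides \<Gamma> d \<longleftrightarrow> (\<forall>I\<in>wmo_instances \<Gamma>. d (wmo_rep I) \<longleftrightarrow> wmo_yes I)"

definition one_valid :: "brel \<Rightarrow> bool" where
  "one_valid R \<longleftrightarrow> replicate (arity R) True \<in> tuples R"

definition or_closed :: "brel \<Rightarrow> bool" where
  "or_closed R \<longleftrightarrow> (\<forall>s\<in>tuples R. \<forall>t\<in>tuples R. map2 (\<or>) s t \<in> tuples R)"

text \<open>The join of all tuples of a relation that lie below a given tuple; the relation is given
  by its truth table.\<close>

definition lower_join :: "(bool list \<times> bool list) set \<Rightarrow> bool list \<times> bool list \<Rightarrow> bool list" where
  "lower_join S p = map (\<lambda>i. \<exists>t. (fst p, t) \<in> S \<and> list_all2 (\<le>) t (snd p) \<and> t ! i) [0..<length (snd p)]"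

text \<open>The arguments at which tables are looked up. Finiteness of this set allows any function
  on it to be stored in a program.\<close>

definition table_dom :: "brel set \<Rightarrow> (bool list \<times> bool list) set" where
  "table_dom \<Gamma> = {(truth_table R, t) | R t. R \<in> \<Gamma> \<and> length t = arity R}"

lemma finite_table_dom: "constraint_language \<Gamma> \<Longrightarrow> finite (table_dom \<Gamma>)"
proof -
  assume G: "constraint_language \<Gamma>"
  have "table_dom \<Gamma> = (\<Union>R\<in>\<Gamma>. Pair (truth_table R) ` {t. length t = arity R})" by (auto simp: table_dom_def)
  then show ?thesis using G finite_bool_lists by (auto simp: constraint_language_def)
qed

text \<open>\<open>Z\<close> lists the variables already known to be 0. A variable of the constraint
  \<open>C\<close> joins them if at one of its positions no tuple compatible with this knowledge is
  1. Outside the table the looked-up list is empty and the default \<open>True\<close> kills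
  nothing.\<close>

definition killed_by :: "brel set \<Rightarrow> nat list \<Rightarrow> bool list \<times> nat list \<Rightarrow> nat list" where
  "killed_by \<Gamma> Z C = map snd (filter (\<lambda>p. \<not> nth_or True
     (let q = (fst C, map (\<lambda>v. \<not> (\<exists>z\<in>set Z. z = v)) (snd C)) in if q \<in> table_dom \<Gamma> then lower_join (sat_set
         \<Gamma>) q else []) (fst p))
     (zip [0..<length (snd C)] (snd C)))"

definition kill :: "brel set \<Rightarrow> (bool list \<times> nat list) list \<Rightarrow> nat list \<Rightarrow> nat list" where
  "kill \<Gamma> cs Z = concat (map (killed_by \<Gamma> Z) cs)"

text \<open>Propagation downwards from the all-one assignment. The sets of killed variables
  increase, so as many rounds as there are variables reach the fixpoint; \<open>fst I\<close> is
  folded over only to count the rounds.\<close>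

definition max_model :: "brel set \<Rightarrow> wmo_data \<Rightarrow> bool list" where
  "max_model \<Gamma> I = (let Z = foldl (\<lambda>Z _. kill \<Gamma> (fst (snd I)) Z) [] (fst I) in
     map (\<lambda>p. \<not> (\<exists>z\<in>set Z. z = fst p)) (zip [0..<length (fst I)] (fst I)))"

lemma FP_kill:
  assumes "constraint_language \<Gamma>" "FP f" "FP g"
  shows "FP (\<lambda>x. kill \<Gamma> (f x) (g x))"
  unfolding kill_def killed_by_def Let_def
  by (intro FP_intros assms(2,3) FP_comp[OF assms(3)]
      FP_finite_table[OF finite_table_dom[OF assms(1)], where g = "lower_join (sat_set \<Gamma>)"])

lemma size_of_filter_zip: "size_of (map snd (filter P (zip [k..<k + length vs] vs))) \<le> size_of vs"
proof (induction vs arbitrary: k)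
  case (Cons v vs)
  show ?case using Cons[of "Suc k"] by (simp add: upt_conv_Cons del: upt_Suc)
qed simp

lemma size_of_concat_map:
  assumes "\<And>c. size_of (g c) \<le> size_of c"
  shows "size_of (concat (map g cs)) \<le> size_of cs"
proof (induction cs)
  case (Cons c cs)
  then show ?case using assms[of c] size_of_append[of "g c" "concat (map g cs)"] by simp
qed simp

text \<open>The new list is rebuilt from the constraints and contains only occurrences of variables
  in them. So the lists do not grow from round to round, in spite of repetitions.\<close>

lemma size_of_kill: "size_of (kill \<Gamma> cs Z) \<le> size_of cs"
  unfolding kill_def
proof (rule size_of_concat_map)
  fix C :: "bool list \<times> nat list"
  have "size_of (killed_by \<Gamma> Z C) \<le> size_of (snd C)"
    unfolding killed_by_def using size_of_filter_zip[where k = 0 and vs = "snd C"] unfolding add_0 by blast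
  then show "size_of (killed_by \<Gamma> Z C) \<le> size_of C" by (simp add: encode_prod_def)
qed

lemma FP_max_model:
  assumes "constraint_language \<Gamma>" "FP f"
  shows "FP (\<lambda>x. max_model \<Gamma> (f x))"
proof -
  have F: "FP (\<lambda>x. foldl (\<lambda>Z _. kill \<Gamma> (fst (snd (f x))) Z) [] (fst (f x)))"
  proof (rule FP_foldl[where q = "\<lambda>p. size_of (fst (snd (f (fst p))))"])
    have "FP (\<lambda>p :: 'a \<times> bool \<times> nat \<times> nat. fst (snd (f (fst p))))" by (intro FP_intros FP_comp[OF assms(2)])
    then show "pbound UNIV (\<lambda>p :: 'a \<times> bool \<times> nat \<times> nat. size_of (fst (snd (f (fst p))))) size_of"
        by (rule FP_size)
    show "size_of (kill \<Gamma> (fst (snd (f e))) a) \<le> size_of a + size_of (fst (snd (f (fst (e, x)))))"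
      for e a and x :: "bool \<times> nat \<times> nat" using size_of_kill[of \<Gamma> "fst (snd (f e))" a] by simp
  qed (intro FP_intros FP_kill assms FP_comp[OF assms(2)])+
  show ?thesis unfolding max_model_def Let_def by (intro FP_intros assms(2) FP_comp[OF F])
qed

lemma bool_le_list_all2: "list_all2 (\<le>) s t \<longleftrightarrow> length s = length t \<and> (\<forall>i<length s. s ! i \<longrightarrow> t ! i)"
  by (auto simp: list_all2_conv_all_nth)

lemma lower_join_truth_table:
  assumes "constraint_language \<Gamma>" "R \<in> \<Gamma>"
  shows "lower_join (sat_set \<Gamma>) (truth_table R, b) =
    map (\<lambda>i. \<exists>t\<in>tuples R. list_all2 (\<le>) t b \<and> t ! i) [0..<length b]"
  by (auto simp: lower_join_def mem_sat_set[OF assms])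

lemma or_closed_join:
  assumes R: "or_closed R" "\<And>t. t \<in> tuples R \<Longrightarrow> length t = k" and "finite A" "A \<noteq> {}" "A \<subseteq> tuples R"
  shows "map (\<lambda>i. \<exists>t\<in>A. t ! i) [0..<k] \<in> tuples R"
  using assms(3-5)
proof (induction rule: finite_ne_induct)
  case (singleton t)
  then have "length t = k" using R(2) by simp
  then have "map (\<lambda>i. \<exists>t\<in>{t}. t ! i) [0..<k] = t" by (auto intro: nth_equalityI)
  then show ?case using singleton by simp
next
  case (insert t A)
  have t: "length t = k" "t \<in> tuples R" using R(2) insert by auto
  have "map2 (\<or>) t (map (\<lambda>i. \<exists>t\<in>A. t ! i) [0..<k]) \<in> tuples R"
    using R(1) t insert unfolding or_closed_def by blast
  also have "map2 (\<or>) t (map (\<lambda>i. \<exists>t\<in>A. t ! i) [0..<k]) = map (\<lambda>i. \<exists>t\<in>insert t A. t ! i) [0..<k]"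
    using t by (auto intro: nth_equalityI)
  finally show ?case .
qed

text \<open>Propagation discards only variables that are 0 in every solution, so its result lies
  above all solutions and, weights being nonnegative, has the greatest value. It is a solution
  itself: with 1-valid relations nothing is discarded; otherwise the fixpoint restricts on each
  constraint to the join of the tuples below it, of which there is at least one because some
  solution exists.\<close>

lemma decides_max_model:
  assumes G: "constraint_language \<Gamma>"
    and cases: "(\<forall>R\<in>\<Gamma>. tuples R = {} \<or> one_valid R) \<or> (\<forall>R\<in>\<Gamma>. or_closed R)"
  shows "decides \<Gamma> (\<lambda>I. wmo_check (sat_set \<Gamma>) I (max_model \<Gamma> I))"
  unfolding decides_def
proof (intro ballI iffI)
  fix I assume I: "I \<in> wmo_instances \<Gamma>"
  show "wmo_yes I" if "wmo_check (sat_set \<Gamma>) (wmo_rep I) (max_model \<Gamma> (wmo_rep I))"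
    using that unfolding wmo_check_correct[OF G I] wmo_yes_def by blast
  assume "wmo_yes I"
  then obtain g where g: "wmo_solution I g" "threshold I \<le> wmo_value I g" by (auto simp: wmo_yes_def)
  let ?n = "length (weights I)"
  define F where "F = kill \<Gamma> (fst (snd (wmo_rep I)))"
  define h where "h Z v = (v \<notin> set Z)" for Z :: "nat list" and v
  define m where "m R vs Z i \<longleftrightarrow> (\<exists>t\<in>tuples R. list_all2 (\<le>) t (map (h Z) vs) \<and> t ! i)" for R vs Z i
  have killed: "set (F Z) = {vs ! i | R vs i. (R, vs) \<in> set (constraints I) \<and> i < length vs \<and>
      \<not> m R vs Z i}" for Z
  proof -
    have 1: "set (killed_by \<Gamma> Z (truth_table R, vs)) = {vs ! i | i. i < length vs \<and> \<not> m R vs Z i}"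
      if C: "(R, vs) \<in> set (constraints I)" for R vs
    proof -
      have R: "R \<in> \<Gamma>" "length vs = arity R" using wmo_instances_constraint[OF I C] by auto
      have hZ: "(\<lambda>v. \<not> (\<exists>z\<in>set Z. z = v)) = h Z" by (auto simp: h_def)
      have "(truth_table R, map (h Z) vs) \<in> table_dom \<Gamma>" using R by (auto simp: table_dom_def)
      then have "killed_by \<Gamma> Z (truth_table R, vs) = map snd (filter (\<lambda>p. \<not> nth_or True
          (map (m R vs Z) [0..<length vs]) (fst p)) (zip [0..<length vs] vs))"
        unfolding killed_by_def Let_def fst_conv snd_conv hZ
        by (simp add: lower_join_truth_table[OF G R(1)] m_def[abs_def])
      then show ?thesis by (force simp: nth_or_def set_zip)
    qed
    have "set (F Z) = (\<Union>C\<in>set (constraints I). set (killed_by \<Gamma> Z (truth_table (fst C), snd C)))"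
      by (simp add: F_def kill_def wmo_rep_def)
    also have "\<dots> = {vs ! i | R vs i. (R, vs) \<in> set (constraints I) \<and> i < length vs \<and> \<not> m R vs Z i}"
      using 1 by fastforce
    finally show ?thesis .
  qed
  have sub: "set (F Z) \<subseteq> {..<?n}" for Z
    unfolding killed using wmo_instances_constraint(3)[OF I] by force
  have m_mono: "m R vs Z' i \<Longrightarrow> m R vs Z i" if "set Z \<subseteq> set Z'" for R vs Z Z' i
    using that unfolding m_def bool_le_list_all2 h_def by fastforce
  have F_mono: "set (F Z) \<subseteq> set (F Z')" if "set Z \<subseteq> set Z'" for Z Z'
    unfolding killed using m_mono[OF that] by blast
  define Zs where "Zs k = (F ^^ k) []" for k
  have step: "set (Zs k) \<subseteq> set (Zs (Suc k))" for k
  proof (induction k)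
    case (Suc k) then show ?case using F_mono[of "Zs k" "Zs (Suc k)"] by (simp add: Zs_def)
  qed (simp add: Zs_def)
  have sound: "\<not> g v" if "v \<in> set (Zs k)" for v k
    using that
  proof (induction k arbitrary: v)
    case (Suc k)
    then have "v \<in> set (F (Zs k))" by (simp add: Zs_def)
    then obtain R vs i where C: "(R, vs) \<in> set (constraints I)" "i < length vs" "\<not> m R vs (Zs k) i" "v = vs ! i"
      unfolding killed by blast
    have "map g vs \<in> tuples R" using g(1) C(1) by (auto simp: wmo_solution_def)
    moreover have "list_all2 (\<le>) (map g vs) (map (h (Zs k)) vs)"
      using Suc.IH by (auto simp: bool_le_list_all2 h_def)
    ultimately have "\<not> map g vs ! i" using C(3) unfolding m_def by blast
    then show ?case using C by simp
  qed (simp add: Zs_def)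
  have fixp: "set (Zs (Suc ?n)) = set (Zs ?n)"
  proof (rule ccontr)
    assume ne: "set (Zs (Suc ?n)) \<noteq> set (Zs ?n)"
    \<comment> \<open>A set that repeats once stays constant. So a change in the last round would
      mean \<open>Suc ?n\<close> strict increases among sets of at most \<open>?n\<close>
      variables.\<close>
    have F_cong: "set (F Z) = set (F Z')" if "set Z = set Z'" for Z Z'
      using F_mono[of Z Z'] F_mono[of Z' Z] that by auto
    have "set (Zs (Suc k)) \<noteq> set (Zs k)" if "k \<le> ?n" for k
    proof
      assume eq: "set (Zs (Suc k)) = set (Zs k)"
      have "set (Zs (Suc (k + j))) = set (Zs (k + j))" for j
      proof (induction j)
        case (Suc j)
        from F_cong[OF this] show ?case by (simp add: Zs_def)
      qed (simp add: eq)
      from this[of "?n - k"] that ne show False by simp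
    qed
    then have lt: "card (set (Zs k)) < card (set (Zs (Suc k)))" if "k \<le> ?n" for k
      using that step[of k] by (intro psubset_card_mono) auto
    have "k \<le> card (set (Zs k))" if "k \<le> Suc ?n" for k
      using that
    proof (induction k)
      case (Suc k) then show ?case using lt[of k] by simp
    qed simp
    from this[of "Suc ?n"] have "Suc ?n \<le> card (set (Zs (Suc ?n)))" by simp
    moreover have "set (Zs (Suc ?n)) \<subseteq> {..<?n}" using sub[of "Zs ?n"] by (simp add: Zs_def)
    then have "card (set (Zs (Suc ?n))) \<le> ?n" using card_mono[of "{..<?n}"] by fastforce
    ultimately show False by simp
  qed
  define Z where "Z = Zs ?n"
  have "foldl (\<lambda>Z _. F Z) Z0 xs = (F ^^ length xs) Z0" for Z0 and xs :: "(bool \<times> nat \<times> nat) list"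
    by (induction xs arbitrary: Z0) (simp_all add: funpow_swap1)
  then have "foldl (\<lambda>Z _. F Z) [] (fst (wmo_rep I)) = Z" by (simp add: Z_def Zs_def wmo_rep_def)
  then have mm: "max_model \<Gamma> (wmo_rep I) = map (h Z) [0..<?n]"
    unfolding max_model_def Let_def F_def[symmetric]
    by (auto simp: h_def wmo_rep_def intro!: nth_equalityI)
  have nth: "nth_or False (max_model \<Gamma> (wmo_rep I)) v = h Z v" if "v < ?n" for v
    using that by (simp add: mm nth_or_def)
  have sol: "map (h Z) vs \<in> tuples R" if C: "(R, vs) \<in> set (constraints I)" for R vs
  proof -
    have R: "R \<in> \<Gamma>" "length vs = arity R" using wmo_instances_constraint[OF I C] by auto
    have gR: "map g vs \<in> tuples R" using g(1) C by (auto simp: wmo_solution_def)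
    have gle: "list_all2 (\<le>) (map g vs) (map (h Z) vs)"
      using sound by (auto simp: bool_le_list_all2 h_def Z_def)
    have len: "length t = arity R" if "t \<in> tuples R" for t using G R that
        by (auto simp: constraint_language_def)
    from cases show ?thesis
    proof
      assume one: "\<forall>R\<in>\<Gamma>. tuples R = {} \<or> one_valid R"
      have "set (F Z') = {}" if "set Z' = {}" for Z'
      proof -
        have "m R vs Z' i" if "(R, vs) \<in> set (constraints I)" "i < length vs" for R vs i
        proof -
          have "map g vs \<in> tuples R" using g(1) that by (auto simp: wmo_solution_def)
          then have "one_valid R" using one wmo_instances_constraint(1)[OF I that(1)] by auto
          then have "replicate (length vs) True \<in> tuples R"
            using wmo_instances_constraint(2)[OF I that(1)] by (simp add: one_valid_def)
          then show ?thesis unfolding m_def using that \<open>set Z' = {}\<close>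
            by (intro bexI[of _ "replicate (length vs) True"]) (auto simp: bool_le_list_all2 h_def)
        qed
        then show ?thesis unfolding killed by blast
      qed
      then have "set (Zs k) = {}" for k by (induction k) (simp_all add: Zs_def)
      then have "map (h Z) vs = replicate (arity R) True"
        using R(2) by (auto simp: h_def Z_def intro!: nth_equalityI)
      then show ?thesis using one R(1) gR by (auto simp: one_valid_def)
    next
      assume "\<forall>R\<in>\<Gamma>. or_closed R"
      then have "or_closed R" using R by blast
      let ?A = "{t \<in> tuples R. list_all2 (\<le>) t (map (h Z) vs)}"
      have "finite ?A" by (rule finite_subset[OF _ finite_bool_lists[of "arity R"]]) (use len in auto)
      then have "map (\<lambda>i. \<exists>t\<in>?A. t ! i) [0..<arity R] \<in> tuples R"
        by (intro or_closed_join[OF \<open>or_closed R\<close> len]) (use gR gle in auto)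
      \<comment> \<open>At the fixpoint a position of the bound is 1 iff some tuple below the bound
        is 1 there.\<close>
      also have "map (\<lambda>i. \<exists>t\<in>?A. t ! i) [0..<arity R] = map (h Z) vs"
      proof (rule nth_equalityI)
        fix i assume "i < length (map (\<lambda>i. \<exists>t\<in>?A. t ! i) [0..<arity R])"
        then have i: "i < length vs" using R by simp
        have "h Z (vs ! i)" if "m R vs Z i" using that i unfolding m_def bool_le_list_all2 by auto
        moreover have "vs ! i \<in> set Z" if "\<not> m R vs Z i"
        proof -
          have "vs ! i \<in> set (F Z)" unfolding killed using C i that by blast
          then show ?thesis using fixp by (simp add: Z_def Zs_def)
        qed
        ultimately have "m R vs Z i = h Z (vs ! i)" by (auto simp: h_def)
        then show "map (\<lambda>i. \<exists>t\<in>?A. t ! i) [0..<arity R] ! i = map (h Z) vs ! i"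
          using i R by (simp add: m_def Bex_def conj_ac)
      qed (simp add: R)
      finally show ?thesis .
    qed
  qed
  have "wmo_solution I (h Z)" using sol by (auto simp: wmo_solution_def)
  moreover have "wmo_value I g \<le> wmo_value I (h Z)"
    unfolding wmo_value_def wmo_var_def
  proof (intro sum_mono mult_left_mono)
    show "of_bool (g v) \<le> (of_bool (h Z v) :: rat)" for v using sound by (auto simp: h_def Z_def)
    show "0 \<le> weights I ! v" if "v \<in> {..<?n}" for v using I that by (auto simp: wmo_instances_def)
  qed
  ultimately show "wmo_check (sat_set \<Gamma>) (wmo_rep I) (max_model \<Gamma> (wmo_rep I))"
    unfolding wmo_check_correct[OF G I] using wmo_cong[OF I nth] g(2) by auto
qed

section \<open>Systems of equations modulo 2\<close>

definition maj :: "bool \<Rightarrow> bool \<Rightarrow> bool \<Rightarrow> bool" where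
  "maj x y z \<longleftrightarrow> (if x = y then x else z)"

definition closed3 :: "(bool \<Rightarrow> bool \<Rightarrow> bool \<Rightarrow> bool) \<Rightarrow> bool list set \<Rightarrow> bool" where
  "closed3 f T \<longleftrightarrow> (\<forall>a\<in>T. \<forall>b\<in>T. \<forall>c\<in>T. map (\<lambda>i. f (a ! i) (b ! i) (c ! i)) [0..<length a] \<in> T)"

text \<open>Inserting the operation into its own third argument negates that argument twice.\<close>

lemma closed3_maj:
  assumes "closed3 (\<lambda>x y z. maj x y (\<not> z)) T"
  shows "closed3 maj T"
  unfolding closed3_def
proof (intro ballI)
  fix a b c assume abc: "a \<in> T" "b \<in> T" "c \<in> T"
  let ?d = "\<lambda>c. map (\<lambda>i. maj (a ! i) (b ! i) (\<not> c ! i)) [0..<length a]"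
  have "?d (?d c) \<in> T" using assms abc unfolding closed3_def by blast
  also have "?d (?d c) = map (\<lambda>i. maj (a ! i) (b ! i) (c ! i)) [0..<length a]" by (auto simp: maj_def)
  finally show "map (\<lambda>i. maj (a ! i) (b ! i) (c ! i)) [0..<length a] \<in> T" .
qed

text \<open>The Boolean case of the Baker-Pixley theorem.\<close>

lemma maj_closed_two_decomposable:
  assumes T: "closed3 maj T" "\<And>t. t \<in> T \<Longrightarrow> length t = k" "T \<noteq> {}" and t: "length t = k"
    and pairs: "\<And>i j. i < k \<Longrightarrow> j < k \<Longrightarrow> \<exists>r\<in>T. r ! i = t ! i \<and> r ! j = t ! j"
  shows "t \<in> T"
proof -
  have "S \<subseteq> {..<k} \<Longrightarrow> card S = n \<Longrightarrow> \<exists>r\<in>T. \<forall>i\<in>S. r ! i = t ! i" for S n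
  proof (induction n arbitrary: S rule: less_induct)
    case (less n)
    have fin: "finite S" using less.prems finite_subset by blast
    show ?case
    proof (cases "n \<le> 2")
      case True
      then consider "S = {}" | i where "S = {i}" | i j where "S = {i, j}"
        using less.prems fin by (metis One_nat_def card_1_singletonE card_2_iff card_eq_0_iff le_SucE
            le_zero_eq numeral_2_eq_2)
      then show ?thesis using pairs T(3) less.prems(1) by cases auto
    next
      case False
      then have "\<not> card S \<le> 2" using less.prems by simp
      then obtain x where x: "x \<in> S" by (metis card.empty ex_in_conv le0)
      have "\<not> card (S - {x}) \<le> 1" using x fin False less.prems by simp
      then obtain y where y: "y \<in> S - {x}" by (metis card.empty ex_in_conv le0)
      have "card (S - {x} - {y}) > 0" using x y fin False less.prems by simp
      then obtain z where z: "z \<in> S - {x} - {y}" by (metis card_gt_0_iff ex_in_conv)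
      \<comment> \<open>The three distinct indices \<open>x\<close>, \<open>y\<close>,
        \<open>z\<close> are left out in turn. At every index of \<open>S\<close> at least two of
        the three resulting tuples agree with \<open>t\<close>, hence so does their
        majority.\<close>
      have ex: "\<exists>r\<in>T. \<forall>i\<in>S - {w}. r ! i = t ! i" if "w \<in> S" for w
        using less.IH[of "card (S - {w})" "S - {w}"] less.prems that fin card_Diff1_less[OF fin that] by auto
      obtain a where a: "a \<in> T" "\<forall>i\<in>S - {x}. a ! i = t ! i" using ex[of x] x by blast
      obtain b where b: "b \<in> T" "\<forall>i\<in>S - {y}. b ! i = t ! i" using ex[of y] y by blast
      obtain c where c: "c \<in> T" "\<forall>i\<in>S - {z}. c ! i = t ! i" using ex[of z] z by blast
      let ?r = "map (\<lambda>i. maj (a ! i) (b ! i) (c ! i)) [0..<length a]"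
      have "?r \<in> T" using T(1) a b c unfolding closed3_def by blast
      moreover have "\<forall>i\<in>S. ?r ! i = t ! i"
      proof
        fix i assume i: "i \<in> S"
        then have "i < length a" using less.prems(1) T(2)[OF a(1)] by auto
        then have "?r ! i = maj (a ! i) (b ! i) (c ! i)" by simp
        also have "\<dots> = t ! i" using a(2) b(2) c(2) i y z by (auto simp: maj_def)
        finally show "?r ! i = t ! i" .
      qed
      ultimately show ?thesis by blast
    qed
  qed
  from this[of "{..<k}" k] obtain r where "r \<in> T" "\<forall>i<k. r ! i = t ! i" by auto
  moreover have "r = t" using calculation T(2) t by (auto intro: nth_equalityI)
  ultimately show ?thesis by simp
qed

text \<open>Such a set is the solution set of the equations between two coordinates that hold on it.
  The appended \<open>True\<close> acts as a coordinate \<open>k\<close> of constant value 1, which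
  covers equations in one variable. By two-decomposability it suffices to realise each pair of
  entries of \<open>t\<close>.\<close>

lemma two_affine_mem:
  assumes T: "closed3 (\<lambda>x y z. maj x y (\<not> z)) T" "\<And>t. t \<in> T \<Longrightarrow> length t = k" "T \<noteq> {}" and t: "length t = k"
    and eqs: "\<And>i j b. i \<le> k \<Longrightarrow> j \<le> k \<Longrightarrow> (\<forall>r\<in>T. ((r @ [True]) ! i \<noteq> (r @ [True]) ! j) = b) \<Longrightarrow>
      ((t @ [True]) ! i \<noteq> (t @ [True]) ! j) = b"
  shows "t \<in> T"
proof (rule maj_closed_two_decomposable[OF closed3_maj[OF T(1)] T(2,3) t])
  fix i j assume ij: "i < k" "j < k"
  have nth: "(r @ [True]) ! l = r ! l" "(r @ [True]) ! k = True" if "l < k" "length r = k" for r l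
    using that by (simp_all add: nth_append)
  have const: "\<exists>r\<in>T. r ! l = t ! l" if "l < k" for l
  proof (rule ccontr)
    assume no: "\<not> (\<exists>r\<in>T. r ! l = t ! l)"
    have "((t @ [True]) ! l \<noteq> (t @ [True]) ! k) = (t ! l)"
      by (rule eqs) (use that no T(2) nth in auto)
    then show False using nth[OF that t] by simp
  qed
  show "\<exists>r\<in>T. r ! i = t ! i \<and> r ! j = t ! j"
  proof (rule ccontr)
    assume no: "\<not> (\<exists>r\<in>T. r ! i = t ! i \<and> r ! j = t ! j)"
    obtain r where r: "r \<in> T" "r ! i = t ! i" using const ij by blast
    obtain s where s: "s \<in> T" "s ! j = t ! j" using const ij by blast
    have rs: "r ! j = (\<not> t ! j)" "s ! i = (\<not> t ! i)" using no r s by auto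
    have "\<exists>u\<in>T. (u ! i \<noteq> u ! j) = (t ! i \<noteq> t ! j)"
    proof (rule ccontr)
      assume no': "\<not> ?thesis"
      have "((t @ [True]) ! i \<noteq> (t @ [True]) ! j) = (\<not> (t ! i \<noteq> t ! j))"
        by (rule eqs) (use ij no' T(2) nth in auto)
      then show False using nth[OF ij(1) t] nth[OF ij(2) t] by argo
    qed
    then obtain u where u: "u \<in> T" "(u ! i \<noteq> u ! j) = (t ! i \<noteq> t ! j)" by blast
    have u': "u ! i = (\<not> t ! i)" "u ! j = (\<not> t ! j)" using u no by auto
    \<comment> \<open>At \<open>i\<close> and \<open>j\<close>, \<open>r\<close> errs only at
      \<open>j\<close>, \<open>s\<close> only at \<open>i\<close>, and \<open>u\<close> at both.
      Negating \<open>u\<close> therefore gives a majority for \<open>t\<close> at both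
      positions.\<close>
    let ?w = "map (\<lambda>i. maj (r ! i) (s ! i) (\<not> u ! i)) [0..<length r]"
    have "?w \<in> T" using T(1) r s u unfolding closed3_def by blast
    moreover have "?w ! i = t ! i" "?w ! j = t ! j"
      using ij T(2)[OF r(1)] r s rs u' by (auto simp: maj_def)
    ultimately show False using no by blast
  qed
qed

text \<open>Equations between positions of a tuple, the position after the last one being the
  constant 1. An empty relation yields both \<open>b = False\<close> and \<open>b = True\<close>,
  hence a contradiction.\<close>

definition pair_eqs :: "(bool list \<times> bool list) set \<Rightarrow> bool list \<times> bool list \<Rightarrow> (nat \<times> nat \<times> bool) list" where
  "pair_eqs S p = filter (\<lambda>(i, j, b). \<forall>r. (fst p, r) \<in> S \<longrightarrow> ((r @ [True]) ! i \<noteq> (r @ [True]) ! j) = b)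
     (List.product [0..<Suc (length (snd p))] (List.product [0..<Suc (length (snd p))] [False, True]))"

text \<open>The variable \<open>n\<close> after the last one stands for the constant 1.\<close>

definition instance_eqs :: "brel set \<Rightarrow> wmo_data \<Rightarrow> (nat \<times> nat \<times> bool) list" where
  "instance_eqs \<Gamma> I = concat (map (\<lambda>C. map (\<lambda>e. (nth_or 0 (snd C @ [length (fst I)]) (fst e),
     nth_or 0 (snd C @ [length (fst I)]) (fst (snd e)), snd (snd e)))
       (let q = (fst C, map (\<lambda>_. False) (snd C)) in if q \<in> table_dom \<Gamma> then pair_eqs (sat_set \<Gamma>) q else
           [])) (fst (snd I)))"

lemma FP_instance_eqs:
  assumes "constraint_language \<Gamma>" "FP f"
  shows "FP (\<lambda>x. instance_eqs \<Gamma> (f x))"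
  unfolding instance_eqs_def Let_def
  by (intro FP_intros assms(2) FP_comp[OF assms(2)]
      FP_finite_table[OF finite_table_dom[OF assms(1)], where g = "pair_eqs (sat_set \<Gamma>)"])

text \<open>An entry \<open>(a, s)\<close> at position \<open>v\<close> of the labelling says that \<open>x\<^sub>v = x\<^sub>a + s\<close>.\<close>

definition merge :: "(nat \<times> bool) list \<Rightarrow> nat \<times> nat \<times> bool \<Rightarrow> (nat \<times> bool) list" where
  "merge \<sigma> e = (let p = nth_or (0, False) \<sigma> (fst e); q = nth_or (0, False) \<sigma> (fst (snd e)) in
     if fst p = fst q then \<sigma>
     else map (\<lambda>z. if fst z = fst p then (fst q, snd z \<noteq> (snd p = (snd q = snd (snd e)))) else z) \<sigma>)"

text \<open>Initially every variable represents itself. The threshold is appended to the weights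
  merely as a dummy that provides one more label, the one of the constant.\<close>

definition labels :: "brel set \<Rightarrow> wmo_data \<Rightarrow> (nat \<times> bool) list" where
  "labels \<Gamma> I = foldl merge (map (\<lambda>p. (fst p, False)) (zip [0..<length (fst I @ [snd (snd I)])] (fst I @
      [snd (snd I)])))
     (instance_eqs \<Gamma> I)"

lemma size_of_list_le: "(\<And>x. x \<in> set xs \<Longrightarrow> size_of x \<le> B) \<Longrightarrow> size_of xs \<le> 2 + length xs * B"
proof (induction xs)
  case (Cons x xs)
  have "size_of x \<le> B" "size_of xs \<le> 2 + length xs * B" using Cons by simp_all
  then show ?case by simp
qed simp

lemma FP_merge: "FP f \<Longrightarrow> FP g \<Longrightarrow> FP (\<lambda>x. merge (f x) (g x))"
proof (rule FP_comp2[where g = merge])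
  show "FP (\<lambda>p. merge (fst p) (snd p))" unfolding merge_def Let_def by (intro FP_intros)
qed

lemma merge_inv:
  assumes "length \<sigma> = Suc n" "\<forall>z\<in>set \<sigma>. fst z \<le> n"
  shows "length (merge \<sigma> e) = Suc n \<and> (\<forall>z\<in>set (merge \<sigma> e). fst z \<le> n)"
proof -
  have "fst (nth_or (0, False) \<sigma> i) \<le> n" for i using assms by (auto simp: nth_or_def)
  then show ?thesis using assms by (auto simp: merge_def Let_def)
qed

text \<open>All intermediate labellings have \<open>n + 1\<close> entries with representatives at
  most \<open>n\<close>, which bounds their size.\<close>

lemma FP_labels:
  assumes "constraint_language \<Gamma>" "FP f"
  shows "FP (\<lambda>x. labels \<Gamma> (f x))"
  unfolding labels_def
proof (rule FP_foldl_bounded[where c = 3])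
  let ?init = "\<lambda>x. map (\<lambda>p. (fst p, False)) (zip [0..<length (fst (f x) @ [snd (snd (f x))])] (fst (f x) @
      [snd (snd (f x))]))"
  fix x ys zs
  let ?n = "length (fst (f x))"
  let ?s = "size_of (x, ?init x, instance_eqs \<Gamma> (f x))"
  have "length (foldl merge (?init x) ys) = Suc ?n \<and> (\<forall>z\<in>set (foldl merge (?init x) ys). fst z \<le> ?n)"
  proof (induction ys rule: rev_induct)
    case Nil
    show ?case by (auto simp: set_zip simp del: upt_Suc)
  next
    case (snoc y ys)
    then show ?case unfolding foldl_append foldl.simps by (intro merge_inv) blast+
  qed
  then have l: "length (foldl merge (?init x) ys) = Suc ?n" "\<And>z. z \<in> set (foldl merge (?init x) ys) \<Longrightarrow>
      fst z \<le> ?n"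
    by blast+
  have z: "size_of z \<le> size_of ?n + 1" if "z \<in> set (foldl merge (?init x) ys)" for z
    using size_of_nat_mono[OF l(2)[OF that]] by (simp add: encode_prod_def)
  have n: "Suc ?n \<le> ?s" using length_le_size_of[of "?init x"] by (simp add: encode_pair)
  have "length (nbits ?n) \<le> ?n" by (rule length_nbits_le) (rule less_exp)
  then have b: "size_of ?n + 1 \<le> ?s + 2" using n by (simp add: size_of_nat)
  have "size_of (foldl merge (?init x) ys) \<le> 2 + Suc ?n * (?s + 2)"
    unfolding l(1)[symmetric] by (rule size_of_list_le) (rule order_trans[OF z b])
  also have "\<dots> \<le> (?s + 2) + (?s + 2) * (?s + 2)" using n by (intro add_mono mult_right_mono) auto
  also have "\<dots> \<le> (?s + 2) ^ 3" by (simp add: power3_eq_cube algebra_simps)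
  finally show "size_of (foldl merge (?init x) ys) \<le> (?s + 2) ^ 3" .
qed (intro FP_intros FP_merge FP_instance_eqs assms)+

text \<open>\<open>c\<close> is the label of the constant. The representative of its component gets
  the value that makes the constant 1; every other representative gets the value that selects the
  greater total weight. A contradictory equation inside a component goes unnoticed by
  \<open>merge\<close>; the concluding check rejects the result.\<close>

definition two_affine_model :: "brel set \<Rightarrow> wmo_data \<Rightarrow> bool list" where
  "two_affine_model \<Gamma> I = (let \<sigma> = labels \<Gamma> I; c = nth_or (0, False) \<sigma> (length (fst I)) in
     map (\<lambda>z. snd z \<noteq> (if fst z = fst c then \<not> snd c
       else sel_le (select (fst I) (\<lambda>v. fst (nth_or (0, False) \<sigma> v) = fst z \<and> snd (nth_or (0, False) \<sigma> v)))
         (select (fst I) (\<lambda>v. fst (nth_or (0, False) \<sigma> v) = fst z \<and> \<not> snd (nth_or (0, False) \<sigma> v))))) \<sigma>)"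

lemma FP_two_affine_model:
  assumes "constraint_language \<Gamma>" "FP f"
  shows "FP (\<lambda>x. two_affine_model \<Gamma> (f x))"
  unfolding two_affine_model_def Let_def
  by (intro FP_intros FP_labels assms FP_comp[OF assms(2)] FP_comp[OF FP_labels[OF assms]])

text \<open>A solution shows that the equations are consistent. The labelling then describes all
  assignments satisfying them: one bit per component, with the bit of the component of the constant
  prescribed. The value is a sum over components, so taking the better bit in each of them is
  optimal.\<close>

lemma decides_two_affine_model:
  assumes G: "constraint_language \<Gamma>"
    and closed: "\<forall>R\<in>\<Gamma>. closed3 (\<lambda>x y z. maj x y (\<not> z)) (tuples R)"
  shows "decides \<Gamma> (\<lambda>I. wmo_check (sat_set \<Gamma>) I (two_affine_model \<Gamma> I))"
  unfolding decides_def
proof (intro ballI iffI)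
  fix I assume I: "I \<in> wmo_instances \<Gamma>"
  show "wmo_yes I" if "wmo_check (sat_set \<Gamma>) (wmo_rep I) (two_affine_model \<Gamma> (wmo_rep I))"
    using that unfolding wmo_check_correct[OF G I] wmo_yes_def by blast
  assume "wmo_yes I"
  then obtain g0 where g0: "wmo_solution I g0" "threshold I \<le> wmo_value I g0" by (auto simp: wmo_yes_def)
  let ?n = "length (weights I)"
  \<comment> \<open>The index \<open>?n\<close> is no variable of \<open>I\<close>, so it is free to
    carry the constant 1.\<close>
  define g where "g = g0(?n := True)"
  have g: "wmo_solution I g" "threshold I \<le> wmo_value I g"
    using wmo_cong[OF I, of g0 g] g0 by (auto simp: g_def)
  have gn: "g ?n" by (simp add: g_def)
  let ?E = "instance_eqs \<Gamma> (wmo_rep I)"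
  have n: "length (fst (wmo_rep I)) = ?n" by (simp add: wmo_rep_def)
  have E: "set ?E = {((vs @ [?n]) ! i, (vs @ [?n]) ! j, b) | R vs i j b. (R, vs) \<in> set (constraints I) \<and>
      i \<le> length vs \<and> j \<le> length vs \<and> (\<forall>r\<in>tuples R. ((r @ [True]) ! i \<noteq> (r @ [True]) ! j) = b)}"
  proof -
    have 1: "set (pair_eqs (sat_set \<Gamma>) (truth_table R, map (\<lambda>_. False) vs)) =
        {(i, j, b). i \<le> length vs \<and> j \<le> length vs \<and> (\<forall>r\<in>tuples R. ((r @ [True]) ! i \<noteq> (r @ [True]) ! j) = b)}"
      if "(R, vs) \<in> set (constraints I)" for R :: brel and vs :: "nat list"
      using mem_sat_set[OF G wmo_instances_constraint(1)[OF I that]]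
      by (auto simp: pair_eqs_def less_Suc_eq_le simp del: upt_Suc)
    have 2: "(truth_table R, map (\<lambda>_. False) vs) \<in> table_dom \<Gamma>" if "(R, vs) \<in> set (constraints I)"
        for R and vs :: "nat list"
      using wmo_instances_constraint[OF I that] by (auto simp: table_dom_def)
    have 3: "nth_or 0 (vs @ [?n]) i = (vs @ [?n]) ! i" if "i \<le> length vs" for vs i
      using that by (simp add: nth_or_def)
    have "set ?E = (\<Union>C\<in>set (constraints I). (\<lambda>e. (nth_or 0 (snd C @ [?n]) (fst e),
        nth_or 0 (snd C @ [?n]) (fst (snd e)), snd (snd e))) `
        set (pair_eqs (sat_set \<Gamma>) (truth_table (fst C), map (\<lambda>_. False) (snd C))))"
      unfolding instance_eqs_def n Let_def using 2 by (auto simp: wmo_rep_def)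
    also have "\<dots> = {((vs @ [?n]) ! i, (vs @ [?n]) ! j, b) | R vs i j b. (R, vs) \<in> set (constraints I) \<and>
      i \<le> length vs \<and> j \<le> length vs \<and> (\<forall>r\<in>tuples R. ((r @ [True]) ! i \<noteq> (r @ [True]) ! j) = b)}" (is "?L = ?R")
    proof (intro set_eqI iffI)
      fix e assume "e \<in> ?L"
      then obtain R vs d where C: "(R, vs) \<in> set (constraints I)"
        "d \<in> set (pair_eqs (sat_set \<Gamma>) (truth_table R, map (\<lambda>_. False) vs))"
        "e = (nth_or 0 (vs @ [?n]) (fst d), nth_or 0 (vs @ [?n]) (fst (snd d)), snd (snd d))" by auto
      obtain i j b where d: "d = (i, j, b)" by (cases d)
      have "i \<le> length vs" "j \<le> length vs" "\<forall>r\<in>tuples R. ((r @ [True]) ! i \<noteq> (r @ [True]) ! j) = b"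
        using C(2) unfolding 1[OF C(1)] d by auto
      moreover from this have "e = ((vs @ [?n]) ! i, (vs @ [?n]) ! j, b)" using C(3) d 3 by simp
      ultimately show "e \<in> ?R" using C(1) by blast
    next
      fix e assume "e \<in> ?R"
      then obtain R vs i j b where C: "(R, vs) \<in> set (constraints I)" "i \<le> length vs" "j \<le> length vs"
        "\<forall>r\<in>tuples R. ((r @ [True]) ! i \<noteq> (r @ [True]) ! j) = b" "e = ((vs @ [?n]) ! i, (vs @ [?n]) ! j,
            b)" by blast
      have "(i, j, b) \<in> set (pair_eqs (sat_set \<Gamma>) (truth_table R, map (\<lambda>_. False) vs))"
        unfolding 1[OF C(1)] using C by blast
      then show "e \<in> ?L" using C(1-3,5) 3 by (intro UN_I[of "(R, vs)"] image_eqI[of _ _ "(i, j, b)"]) auto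
    qed
    finally show ?thesis .
  qed
  have nth_map: "map x vs @ [x ?n] = map x (vs @ [?n])" for x and vs :: "nat list" by simp
  have Eok: "u \<le> ?n \<and> v \<le> ?n \<and> (g u \<noteq> g v) = b" if "(u, v, b) \<in> set ?E" for u v b
  proof -
    obtain R vs i j where C: "(R, vs) \<in> set (constraints I)" "i \<le> length vs" "j \<le> length vs"
      "\<forall>r\<in>tuples R. ((r @ [True]) ! i \<noteq> (r @ [True]) ! j) = b" "u = (vs @ [?n]) ! i" "v = (vs @ [?n]) ! j"
      using \<open>(u, v, b) \<in> set ?E\<close> unfolding E by blast
    have "map g vs \<in> tuples R" using g(1) C(1) by (auto simp: wmo_solution_def)
    then have "((map g vs @ [g ?n]) ! i \<noteq> (map g vs @ [g ?n]) ! j) = b" using C(4) gn by simp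
    then have "(g u \<noteq> g v) = b" unfolding nth_map using C by (simp del: map_append)
    moreover have "u \<in> set (vs @ [?n])" "v \<in> set (vs @ [?n])" using C
        by (metis length_append_singleton less_Suc_eq_le nth_mem)+
    ultimately show ?thesis using wmo_instances_constraint(3)[OF I C(1)] by auto
  qed
  define resp where "resp \<sigma> x \<longleftrightarrow> (\<forall>v\<le>?n. x v = (x (fst (\<sigma> ! v)) \<noteq> snd (\<sigma> ! v)))"
      for \<sigma> :: "(nat \<times> bool) list" and x
  \<comment> \<open>Representatives represent themselves, and every assignment respecting the labels
    satisfies the equations processed so far. That \<open>g\<close> respects them too guarantees
    that no equation contradicts earlier ones.\<close>
  define inv where "inv \<sigma> es \<longleftrightarrow> length \<sigma> = Suc ?n \<and> resp \<sigma> g \<and>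
    (\<forall>v\<le>?n. fst (\<sigma> ! v) \<le> ?n \<and> \<sigma> ! (fst (\<sigma> ! v)) = (fst (\<sigma> ! v), False)) \<and>
    (\<forall>x. resp \<sigma> x \<longrightarrow> (\<forall>(u, v, b)\<in>set es. (x u \<noteq> x v) = b))" for \<sigma> es
  have inv_step: "inv (merge \<sigma> e) (es @ [e])" if inv: "inv \<sigma> es" and e: "e \<in> set ?E" for \<sigma> es e
  proof -
    obtain u v b where uvb: "e = (u, v, b)" by (cases e)
    have uv: "u \<le> ?n" "v \<le> ?n" "(g u \<noteq> g v) = b" using Eok e uvb by auto
    have len: "length \<sigma> = Suc ?n" and rg: "resp \<sigma> g"
      and idem: "\<And>v. v \<le> ?n \<Longrightarrow> fst (\<sigma> ! v) \<le> ?n \<and> \<sigma> ! (fst (\<sigma> ! v)) = (fst (\<sigma> ! v), False)"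
      and old: "\<And>x. resp \<sigma> x \<Longrightarrow> \<forall>(u, v, b)\<in>set es. (x u \<noteq> x v) = b"
      using inv unfolding inv_def by auto
    obtain a s where as: "\<sigma> ! u = (a, s)" by (cases "\<sigma> ! u")
    obtain c t where ct: "\<sigma> ! v = (c, t)" by (cases "\<sigma> ! v")
    have nu: "nth_or (0, False) \<sigma> u = (a, s)" "nth_or (0, False) \<sigma> v = (c, t)"
      using uv len as ct by (auto simp: nth_or_def)
    have gu: "g u = (g a \<noteq> s)" "g v = (g c \<noteq> t)" using rg uv as ct unfolding resp_def by fastforce+
    show ?thesis
    proof (cases "a = c")
      case True
      then have "merge \<sigma> e = \<sigma>" using nu uvb by (simp add: merge_def Let_def)
      moreover have "(x u \<noteq> x v) = b" if "resp \<sigma> x" for x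
      proof -
        have "x u = (x a \<noteq> s)" "x v = (x c \<noteq> t)" using that uv as ct unfolding resp_def by fastforce+
        then show ?thesis using gu uv(3) True by auto
      qed
      ultimately show ?thesis using inv unfolding inv_def uvb by auto
    next
      case False
      \<comment> \<open>From \<open>x u = x a + s\<close>, \<open>x v = x c + t\<close> and
        \<open>x u + x v = b\<close> follows \<open>x a = x c + (s + t + b)\<close> modulo 2; the
        two nested Boolean equalities compute this sum.\<close>
      let ?d = "s = (t = b)"
      have m: "merge \<sigma> e = map (\<lambda>z. if fst z = a then (c, snd z \<noteq> ?d) else z) \<sigma>"
        using nu uvb False by (simp add: merge_def Let_def)
      have mn: "merge \<sigma> e ! w = (if fst (\<sigma> ! w) = a then (c, snd (\<sigma> ! w) \<noteq> ?d) else \<sigma> ! w)" if "w \<le> ?n" for w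
        using that len by (simp add: m)
      have ac: "\<sigma> ! a = (a, False)" "\<sigma> ! c = (c, False)" "a \<le> ?n" "c \<le> ?n"
        using idem[OF uv(1)] idem[OF uv(2)] as ct by auto
      have ga: "g a = (g c \<noteq> ?d)" using gu uv(3) by auto
      have 1: "resp (merge \<sigma> e) g"
        unfolding resp_def
      proof (intro allI impI)
        fix w assume w: "w \<le> ?n"
        have "g w = (g (fst (\<sigma> ! w)) \<noteq> snd (\<sigma> ! w))" using rg w unfolding resp_def by blast
        then show "g w = (g (fst (merge \<sigma> e ! w)) \<noteq> snd (merge \<sigma> e ! w))"
          using mn[OF w] ga by (cases "fst (\<sigma> ! w) = a") auto
      qed
      have 2: "fst (merge \<sigma> e ! w) \<le> ?n \<and> merge \<sigma> e ! (fst (merge \<sigma> e ! w)) = (fst (merge \<sigma> e ! w), False)"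
          if w: "w \<le> ?n" for w
        using mn[OF w] mn[OF ac(4)] idem[OF w] ac False mn[of "fst (\<sigma> ! w)"] by (cases "fst (\<sigma> ! w) = a") auto
      have 3: "resp \<sigma> x \<and> (x u \<noteq> x v) = b" if x: "resp (merge \<sigma> e) x" for x
      proof -
        have xw: "x w = (x (fst (merge \<sigma> e ! w)) \<noteq> snd (merge \<sigma> e ! w))" if "w \<le> ?n" for w
          using x that unfolding resp_def by blast
        have xa: "x a = (x c \<noteq> ?d)" using xw[OF ac(3)] mn[OF ac(3)] ac by auto
        have "x w = (x (fst (\<sigma> ! w)) \<noteq> snd (\<sigma> ! w))" if "w \<le> ?n" for w
          using xw[OF that] mn[OF that] xa by (cases "fst (\<sigma> ! w) = a") auto
        then have r: "resp \<sigma> x" unfolding resp_def by blast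
        then have "x u = (x a \<noteq> s)" "x v = (x c \<noteq> t)" using uv as ct unfolding resp_def by fastforce+
        then show ?thesis using r xa by auto
      qed
      show ?thesis unfolding inv_def using 1 2 3 old len m uvb by auto
    qed
  qed
  define \<sigma> where "\<sigma> = labels \<Gamma> (wmo_rep I)"
  have "inv \<sigma> ?E"
  proof -
    define \<sigma>0 where "\<sigma>0 = map (\<lambda>p. (fst p, False)) (zip [0..<length (fst (wmo_rep I) @ [snd (snd (wmo_rep I))])]
      (fst (wmo_rep I) @ [snd (snd (wmo_rep I))]))"
    have s0: "length \<sigma>0 = Suc ?n" "\<And>v. v \<le> ?n \<Longrightarrow> \<sigma>0 ! v = (v, False)"
      by (simp_all add: \<sigma>0_def n del: upt_Suc)
    then have "inv \<sigma>0 []" by (auto simp: inv_def resp_def)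
    then have "inv (foldl merge \<sigma>0 es) es" if "set es \<subseteq> set ?E" for es
      using that
    proof (induction es rule: rev_induct)
      case (snoc e es) then show ?case using inv_step by simp
    qed simp
    then show ?thesis unfolding \<sigma>_def labels_def \<sigma>0_def[symmetric] by blast
  qed
  then have len: "length \<sigma> = Suc ?n" and rg: "resp \<sigma> g"
    and idem: "\<And>v. v \<le> ?n \<Longrightarrow> fst (\<sigma> ! v) \<le> ?n \<and> \<sigma> ! (fst (\<sigma> ! v)) = (fst (\<sigma> ! v), False)"
    and complete: "\<And>x u v b. resp \<sigma> x \<Longrightarrow> (u, v, b) \<in> set ?E \<Longrightarrow> (x u \<noteq> x v) = b"
    unfolding inv_def by blast+
  let ?w = "\<lambda>v. weights I ! v"
  define P where "P a s = (\<Sum>v<?n. ?w v * of_bool (fst (\<sigma> ! v) = a \<and> snd (\<sigma> ! v) = s))" for a s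
  define ch where "ch a \<longleftrightarrow> (if a = fst (\<sigma> ! ?n) then \<not> snd (\<sigma> ! ?n) else P a True \<le> P a False)" for a
  define h where "h v \<longleftrightarrow> snd (\<sigma> ! v) \<noteq> ch (fst (\<sigma> ! v))" for v
  have w0: "\<forall>w\<in>set (weights I). 0 \<le> w" using I by (auto simp: wmo_instances_def)
  have nthor: "nth_or (0, False) \<sigma> v = \<sigma> ! v" if "v \<le> ?n" for v using that len by (simp add: nth_or_def)
  have model: "two_affine_model \<Gamma> (wmo_rep I) = map h [0..<Suc ?n]"
  proof -
    have "sel_le (select (fst (wmo_rep I)) (\<lambda>v. fst (nth_or (0, False) \<sigma> v) = a \<and> snd (nth_or (0, False) \<sigma> v)))
         (select (fst (wmo_rep I)) (\<lambda>v. fst (nth_or (0, False) \<sigma> v) = a \<and> \<not> snd (nth_or (0, False) \<sigma> v))) \<longleftrightarrow>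
       P a True \<le> P a False" for a
    proof -
      have e: "(\<Sum>v<?n. ?w v * of_bool (fst (nth_or (0, False) \<sigma> v) = a \<and>
          snd (nth_or (0, False) \<sigma> v))) = P a True"
        "(\<Sum>v<?n. ?w v * of_bool (fst (nth_or (0, False) \<sigma> v) = a \<and> \<not> snd (nth_or (0, False) \<sigma> v))) = P a False"
        unfolding P_def using nthor by (auto intro!: sum.cong)
      show ?thesis unfolding e[symmetric] using sel_le_select[OF w0] by (simp add: wmo_rep_def)
    qed
    then have "two_affine_model \<Gamma> (wmo_rep I) = map (\<lambda>z. snd z \<noteq> ch (fst z)) \<sigma>"
      unfolding two_affine_model_def Let_def \<sigma>_def[symmetric] n ch_def nthor[OF order_refl] by simp
    also have "\<dots> = map h [0..<Suc ?n]"
      by (rule nth_equalityI) (use len in \<open>auto simp: h_def simp del: upt_Suc\<close>)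
    finally show ?thesis .
  qed
  have nth: "nth_or False (two_affine_model \<Gamma> (wmo_rep I)) v = h v" if "v < ?n" for v
    using that unfolding model nth_or_def by (simp del: upt_Suc)
  have rh: "resp \<sigma> h" unfolding resp_def h_def using idem by auto
  have hn: "h ?n" by (simp add: h_def ch_def)
  have "map h vs \<in> tuples R" if C: "(R, vs) \<in> set (constraints I)" for R vs
  proof (rule two_affine_mem)
    have R: "R \<in> \<Gamma>" "length vs = arity R" using wmo_instances_constraint[OF I C] by auto
    show "closed3 (\<lambda>x y z. maj x y (\<not> z)) (tuples R)" using closed R by blast
    show "length t = arity R" if "t \<in> tuples R" for t using G R that by (auto simp: constraint_language_def)
    show "tuples R \<noteq> {}" using g(1) C by (auto simp: wmo_solution_def)
    show "length (map h vs) = arity R" using R by simp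
    fix i j b assume ij: "i \<le> arity R" "j \<le> arity R" "\<forall>r\<in>tuples R. ((r @ [True]) ! i \<noteq> (r @ [True]) ! j) = b"
    have "((vs @ [?n]) ! i, (vs @ [?n]) ! j, b) \<in> set ?E" 
      unfolding E mem_Collect_eq using C ij R(2) by (intro exI[of _ R] exI[of _ vs] exI[of _ i] exI[of _ j]
          exI[of _ b]) simp
    from complete[OF rh this] have "(map h (vs @ [?n]) ! i \<noteq> map h (vs @ [?n]) ! j) = b" using ij R
        by (simp del: map_append)
    then show "((map h vs @ [True]) ! i \<noteq> (map h vs @ [True]) ! j) = b" using hn by simp
  qed
  then have sol: "wmo_solution I h" by (auto simp: wmo_solution_def)
  \<comment> \<open>Every variable contributes to the component of its representative only, and it
    is set iff the value of the representative differs from its sign. Exchanging the sums groups the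
    value by components.\<close>
  have val: "wmo_value I x = (\<Sum>a\<le>?n. if x a then P a False else P a True)" if x: "resp \<sigma> x" for x
  proof -
    have "wmo_value I x = (\<Sum>v<?n. \<Sum>a\<le>?n. ?w v * of_bool (fst (\<sigma> ! v) = a \<and> x v))"
      unfolding wmo_value_def wmo_var_def
    proof (rule sum.cong)
      fix v assume v: "v \<in> {..<?n}"
      have "(\<Sum>a\<le>?n. ?w v * of_bool (fst (\<sigma> ! v) = a \<and> x v)) = (\<Sum>a\<in>{fst (\<sigma> ! v)}. ?w v * of_bool (fst (\<sigma> !
          v) = a \<and> x v))"
        by (rule sum.mono_neutral_right) (use idem[of v] v in auto)
      also have "\<dots> = ?w v * of_bool (x v)" by simp
      finally show "?w v * of_bool (x v) = (\<Sum>a\<le>?n. ?w v * of_bool (fst (\<sigma> ! v) = a \<and> x v))" by (rule sym)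
    qed simp
    also have "\<dots> = (\<Sum>a\<le>?n. \<Sum>v<?n. ?w v * of_bool (fst (\<sigma> ! v) = a \<and> x v))" by (rule sum.swap)
    also have "\<dots> = (\<Sum>a\<le>?n. if x a then P a False else P a True)"
    proof (rule sum.cong[OF refl])
      fix a assume "a \<in> {..?n}"
      have "(fst (\<sigma> ! v) = a \<and> x v) = (fst (\<sigma> ! v) = a \<and> snd (\<sigma> ! v) = (\<not> x a))" if "v < ?n" for v
        using x that unfolding resp_def by (metis less_imp_le)
      then show "(\<Sum>v<?n. ?w v * of_bool (fst (\<sigma> ! v) = a \<and> x v)) = (if x a then P a False else P a True)"
        unfolding P_def by (auto intro!: sum.cong)
    qed
    finally show ?thesis .
  qed
  have "wmo_value I g \<le> wmo_value I h"
    unfolding val[OF rg] val[OF rh]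
  proof (rule sum_mono)
    fix a assume a: "a \<in> {..?n}"
    show "(if g a then P a False else P a True) \<le> (if h a then P a False else P a True)"
    proof (cases "\<exists>v\<le>?n. fst (\<sigma> ! v) = a")
      case True
      then have sa: "\<sigma> ! a = (a, False)" using idem by blast
      then have ha: "h a = ch a" by (simp add: h_def)
      have "g a = h a" if "a = fst (\<sigma> ! ?n)"
      proof -
        have "g ?n = (g a \<noteq> snd (\<sigma> ! ?n))" using rg that unfolding resp_def by blast
        then show ?thesis using gn ha that by (auto simp: ch_def)
      qed
      then show ?thesis using ha by (auto simp: ch_def split: if_splits)
    next
      case False
      then have "P a s = 0" for s unfolding P_def by (intro sum.neutral) (auto simp: less_imp_le)
      then show ?thesis by simp
    qed
  qed
  then show "wmo_check (sat_set \<Gamma>) (wmo_rep I) (two_affine_model \<Gamma> (wmo_rep I))"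
    unfolding wmo_check_correct[OF G I] using wmo_cong[OF I nth] sol g(2) by auto
qed

section \<open>Gadgets\<close>

definition sat_all :: "(brel \<times> nat list) list \<Rightarrow> (nat \<Rightarrow> bool) \<Rightarrow> bool" where
  "sat_all G h \<longleftrightarrow> (\<forall>(R, is)\<in>set G. map h is \<in> tuples R)"

lemma sat_all_simps [simp]:
  "sat_all [] h" "sat_all ((R, is) # G) h \<longleftrightarrow> map h is \<in> tuples R \<and> sat_all G h"
  by (simp_all add: sat_all_def)

text \<open>
  A gadget replaces a constraint \<open>R_II2\<close> on the slots 0 to 7. Its weight counts the slots in \<open>Ix\<close>
  that are set; among the assignments admitted by \<open>G\<close> those satisfying \<open>R_II2\<close> are the heaviest.
\<close>

definition gadget :: "brel set \<Rightarrow> (brel \<times> nat list) list \<Rightarrow> nat list \<Rightarrow> nat \<Rightarrow> bool" where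
  "gadget \<Gamma> G Ix K \<longleftrightarrow> (\<forall>(R, is)\<in>set G. R \<in> \<Gamma> \<and> length is = arity R \<and> set is \<subseteq> {..<8}) \<and> set Ix \<subseteq> {..<8} \<and>
     (\<forall>h. sat_all G h \<longrightarrow> length (filter h Ix) \<le> K) \<and>
     (\<forall>h. sat_all G h \<and> length (filter h Ix) = K \<longleftrightarrow> map h [0..<8] \<in> tuples R_II2)"

lemma map_upt_8: "map h [0..<8] = [h 0, h 1, h 2, h 3, h 4, h 5, h 6, h (7::nat)]"
  by (simp add: upt_rec numeral_eq_Suc)

lemma mem_R_II2: "map h [0..<8] \<in> tuples R_II2 \<longleftrightarrow>
    (h 0, h 1, h 2) \<in> {(False, False, True), (False, True, False), (True, False, False)} \<and>
    h 3 = (\<not> h 0) \<and> h 4 = (\<not> h 1) \<and> h 5 = (\<not> h 2) \<and> \<not> h 6 \<and> h 7"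
  unfolding map_upt_8 R_II2_def by auto

section \<open>Substituting slots for the columns of witness tuples\<close>

definition pat1 :: "bool list \<Rightarrow> nat list" where
  "pat1 t = map (\<lambda>b. if b then 7 else 6) t"

text \<open>Position \<open>i\<close> receives the slot belonging to the column
  \<open>(s ! i, t ! i)\<close>. With 0 on slot 6 and 1 on slot 7, the values (1,0), (0,1), (1,1),
  (0,0) of \<open>u\<close> and \<open>v\<close> produce \<open>s\<close>, \<open>t\<close>, their
  disjunction and their conjunction.\<close>

definition pat2 :: "bool list \<Rightarrow> bool list \<Rightarrow> nat \<Rightarrow> nat \<Rightarrow> nat list" where
  "pat2 s t u v = map (\<lambda>i. if s ! i then (if t ! i then 7 else u) else (if t ! i then v else 6)) [0..<length s]"

text \<open>The same with the columns of three tuples; each of \<open>p\<close>, \<open>q\<close>,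
  \<open>r\<close> is meant to be a slot together with its complement. The values (1,0,0), (0,1,0),
  (0,0,1) of the first components produce \<open>a\<close>, \<open>b\<close>, \<open>c\<close>,
  while (1,1,0) produces \<open>maj a b (\<not> c)\<close> and (0,0,0) produces
  \<open>maj a b c\<close>.\<close>

definition pat3 :: "bool list \<Rightarrow> bool list \<Rightarrow> bool list \<Rightarrow> nat \<times> nat \<Rightarrow> nat \<times> nat \<Rightarrow> nat \<times> nat \<Rightarrow> nat list" where
  "pat3 a b c p q r = map (\<lambda>i. if a ! i
     then (if b ! i then (if c ! i then 7 else snd r) else (if c ! i then snd q else fst p))
     else (if b ! i then (if c ! i then snd p else fst q) else (if c ! i then fst r else 6))) [0..<length a]"

lemma pat1_sat:
  assumes "t \<in> tuples R" "length t = arity R" "\<not> one_valid R" "h 7"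
  shows "map h (pat1 t) \<in> tuples R \<longleftrightarrow> \<not> h 6"
proof (cases "h 6")
  case True
  then have "map h (pat1 t) = replicate (arity R) True"
    using assms by (auto simp: pat1_def intro!: nth_equalityI split: if_splits)
  then show ?thesis using assms(3) True by (simp add: one_valid_def)
next
  case False
  then have "map h (pat1 t) = t" using assms by (auto simp: pat1_def intro!: nth_equalityI split: if_splits)
  then show ?thesis using assms(1) False by simp
qed

lemma pat2_sat:
  assumes "s \<in> T" "t \<in> T" "length s = length t" "map2 (\<or>) s t \<notin> T" "\<not> h 6" "h 7"
  shows "map h (pat2 s t u v) \<in> T \<longleftrightarrow> h u \<noteq> h v \<or> \<not> h u \<and> \<not> h v \<and> map2 (\<and>) s t \<in> T"
proof -
  have "map h (pat2 s t u v) = s" if "h u" "\<not> h v"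
    using assms that by (auto simp: pat2_def intro!: nth_equalityI split: if_splits)
  moreover have "map h (pat2 s t u v) = t" if "\<not> h u" "h v"
    using assms that by (auto simp: pat2_def intro!: nth_equalityI split: if_splits)
  moreover have "map h (pat2 s t u v) = map2 (\<or>) s t" if "h u" "h v"
    using assms that by (auto simp: pat2_def intro!: nth_equalityI split: if_splits)
  moreover have "map h (pat2 s t u v) = map2 (\<and>) s t" if "\<not> h u" "\<not> h v"
    using assms that by (auto simp: pat2_def intro!: nth_equalityI split: if_splits)
  ultimately show ?thesis using assms by (cases "h u"; cases "h v") simp_all
qed

lemma pat3_sat:
  assumes T: "a \<in> T" "b \<in> T" "c \<in> T" "length a = k" "length b = k" "length c = k"
    and no: "map (\<lambda>i. maj (a ! i) (b ! i) (\<not> c ! i)) [0..<length a] \<notin> T" and h: "\<not> h 6" "h 7"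
    and neg: "h (snd p) = (\<not> h (fst p))" "h (snd q) = (\<not> h (fst q))" "h (snd r) = (\<not> h (fst r))"
  shows "(h (fst p), h (fst q), h (fst r)) \<in> {(True, False, False), (False, True, False), (False, False,
      True)} \<Longrightarrow>
      map h (pat3 a b c p q r) \<in> T"
    and "h (fst p) \<Longrightarrow> h (fst q) \<Longrightarrow> \<not> h (fst r) \<Longrightarrow> map h (pat3 a b c p q r) \<notin> T"
    and "\<not> h (fst p) \<Longrightarrow> \<not> h (fst q) \<Longrightarrow> \<not> h (fst r) \<Longrightarrow>
      map h (pat3 a b c p q r) \<in> T \<longleftrightarrow> map (\<lambda>i. maj (a ! i) (b ! i) (c ! i)) [0..<length a] \<in> T"
proof -
  have "map h (pat3 a b c p q r) = a" if "h (fst p)" "\<not> h (fst q)" "\<not> h (fst r)"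
    using assms that by (auto simp: pat3_def intro!: nth_equalityI split: if_splits)
  moreover have "map h (pat3 a b c p q r) = b" if "\<not> h (fst p)" "h (fst q)" "\<not> h (fst r)"
    using assms that by (auto simp: pat3_def intro!: nth_equalityI split: if_splits)
  moreover have "map h (pat3 a b c p q r) = c" if "\<not> h (fst p)" "\<not> h (fst q)" "h (fst r)"
    using assms that by (auto simp: pat3_def intro!: nth_equalityI split: if_splits)
  ultimately show "(h (fst p), h (fst q), h (fst r)) \<in> {(True, False, False), (False, True, False), (False,
      False, True)} \<Longrightarrow>
      map h (pat3 a b c p q r) \<in> T" using T by auto
  have "map h (pat3 a b c p q r) = map (\<lambda>i. maj (a ! i) (b ! i) (\<not> c ! i)) [0..<length a]"
    if "h (fst p)" "h (fst q)" "\<not> h (fst r)"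
    using h neg that by (auto simp: pat3_def maj_def intro!: nth_equalityI split: if_splits)
  then show "h (fst p) \<Longrightarrow> h (fst q) \<Longrightarrow> \<not> h (fst r) \<Longrightarrow> map h (pat3 a b c p q r) \<notin> T" using no by simp
  have "map h (pat3 a b c p q r) = map (\<lambda>i. maj (a ! i) (b ! i) (c ! i)) [0..<length a]"
    if "\<not> h (fst p)" "\<not> h (fst q)" "\<not> h (fst r)"
    using h neg that by (auto simp: pat3_def maj_def intro!: nth_equalityI split: if_splits)
  then show "\<not> h (fst p) \<Longrightarrow> \<not> h (fst q) \<Longrightarrow> \<not> h (fst r) \<Longrightarrow>
      map h (pat3 a b c p q r) \<in> T \<longleftrightarrow> map (\<lambda>i. maj (a ! i) (b ! i) (c ! i)) [0..<length a] \<in> T" by simp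
qed

lemma mem_pat1: "i \<in> set (pat1 t) \<Longrightarrow> i < 8"
  by (auto simp: pat1_def split: if_splits)

lemma mem_pat2: "i \<in> set (pat2 s t u v) \<Longrightarrow> u < 8 \<Longrightarrow> v < 8 \<Longrightarrow> i < 8"
  by (auto simp: pat2_def split: if_splits)

lemma mem_pat3: "i \<in> set (pat3 a b c (p, p') (q, q') (r, r')) \<Longrightarrow>
    p < 8 \<Longrightarrow> p' < 8 \<Longrightarrow> q < 8 \<Longrightarrow> q' < 8 \<Longrightarrow> r < 8 \<Longrightarrow> r' < 8 \<Longrightarrow> i < 8"
  by (auto simp: pat3_def split: if_splits)

lemma length_pat [simp]: "length (pat1 t) = length t" "length (pat2 s t u v) = length s"
  "length (pat3 a b c p q r) = length a"
  by (simp_all add: pat1_def pat2_def pat3_def)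

text \<open>Slot 7 is counted ten times, more often than all other slots together, so an assignment
  of maximal weight sets it to 1. Only then do the substituted patterns have their intended
  meaning.\<close>

lemma gadgetI:
  assumes "\<And>R is. (R, is) \<in> set G \<Longrightarrow> R \<in> \<Gamma> \<and> length is = arity R \<and> set is \<subseteq> {..<8}" "set Ix \<subseteq> {..<7}"
      "length Ix < 10"
    and h7: "\<And>h. h 7 \<Longrightarrow> \<not> h 6 \<Longrightarrow> sat_all G h \<Longrightarrow> length (filter h Ix) \<le> K \<and>
      (length (filter h Ix) = K \<longrightarrow> map h [0..<8] \<in> tuples R_II2)"
    and h6: "\<And>h. h 7 \<Longrightarrow> sat_all G h \<Longrightarrow> \<not> h 6"
    and R: "\<And>h. map h [0..<8] \<in> tuples R_II2 \<Longrightarrow> sat_all G h \<and> length (filter h Ix) = K"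
  shows "gadget \<Gamma> G (Ix @ replicate 10 7) (K + 10)"
  unfolding gadget_def
proof (intro conjI allI impI iffI)
  show "\<forall>(R, is)\<in>set G. R \<in> \<Gamma> \<and> length is = arity R \<and> set is \<subseteq> {..<8}" using assms(1) by blast
  show "set (Ix @ replicate 10 7) \<subseteq> {..<8}" using assms(2) by fastforce
  fix h
  have len: "length (filter h (Ix @ replicate 10 7)) = length (filter h Ix) + (if h 7 then 10 else 0)"
    by (simp add: filter_replicate)
  have lt: "length (filter h Ix) < 10" using assms(3) length_filter_le[of h Ix] by linarith
  show "length (filter h (Ix @ replicate 10 7)) \<le> K + 10" if "sat_all G h"
    unfolding len using that h7[of h] h6[of h] lt by auto
  show "map h [0..<8] \<in> tuples R_II2" if "sat_all G h \<and> length (filter h (Ix @ replicate 10 7)) = K + 10"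
    using that h7[of h] h6[of h] lt unfolding len by (auto split: if_splits)
  show "sat_all G h" "length (filter h (Ix @ replicate 10 7)) = K + 10" if "map h [0..<8] \<in> tuples R_II2"
    unfolding len using R[OF that] that unfolding mem_R_II2 by auto
qed

lemma ex_gadget:
  assumes G: "constraint_language \<Gamma>" and R0: "R0 \<in> \<Gamma>" "tuples R0 \<noteq> {}" "\<not> one_valid R0"
    and R1: "R1 \<in> \<Gamma>" "\<not> or_closed R1"
    and R2: "R2 \<in> \<Gamma>" "\<not> closed3 (\<lambda>x y z. maj x y (\<not> z)) (tuples R2)"
  shows "\<exists>G Ix K. gadget \<Gamma> G Ix K"
proof -
  have len: "length t = arity R" if "R \<in> \<Gamma>" "t \<in> tuples R" for R t using G that
      by (auto simp: constraint_language_def)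
  obtain t0 where t0: "t0 \<in> tuples R0" using R0 by blast
  have l0: "length t0 = arity R0" using len R0(1) t0 by blast
  let ?g0 = "(R0, pat1 t0)"
  note g0 = pat1_sat[OF t0 l0 R0(3)]
  obtain s t where st: "s \<in> tuples R1" "t \<in> tuples R1" "map2 (\<or>) s t \<notin> tuples R1"
    using R1 by (auto simp: or_closed_def)
  have l1: "length s = arity R1" "length t = arity R1" using len R1(1) st by blast+
  have lst: "length s = length t" using l1 by simp
  note g1 = pat2_sat[OF st(1,2) lst st(3)]
  show ?thesis
  proof (cases "map2 (\<and>) s t \<in> tuples R1")
    case True
    \<comment> \<open>Here every \<open>pat2\<close> constraint is a NAND. The slots 0 to 2 have
      weight 2 and the intended complements weight 1, so setting exactly one of the slots 0 to 2
      earns up to 2 + 1 + 1, whereas setting none earns at most 3.\<close>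
    let ?G = "[?g0, (R1, pat2 s t 0 1), (R1, pat2 s t 0 2), (R1, pat2 s t 1 2),
      (R1, pat2 s t 0 3), (R1, pat2 s t 1 4), (R1, pat2 s t 2 5)]"
    let ?Ix = "[0, 0, 1, 1, 2, 2, 3, 4, 5]"
    have sat: "sat_all ?G h \<longleftrightarrow> \<not> (h 0 \<and> h 1) \<and> \<not> (h 0 \<and> h 2) \<and> \<not> (h 1 \<and> h 2) \<and>
        \<not> (h 0 \<and> h 3) \<and> \<not> (h 1 \<and> h 4) \<and> \<not> (h 2 \<and> h 5)" if "h 7" "\<not> h 6" for h
    proof -
      have "map h (pat2 s t u v) \<in> tuples R1 \<longleftrightarrow> \<not> (h u \<and> h v)" for u v
        using g1[of h u v, OF that(2,1)] True by blast
      then show ?thesis using g0[of h, OF that(1)] that(2) by simp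
    qed
    have "gadget \<Gamma> ?G (?Ix @ replicate 10 7) (4 + 10)"
    proof (rule gadgetI)
      show "R \<in> \<Gamma> \<and> length is = arity R \<and> set is \<subseteq> {..<8}" if "(R, is) \<in> set ?G" for R "is"
        using that R0(1) R1(1) l0 l1 by (auto dest: mem_pat1 mem_pat2)
      show "length (filter h ?Ix) \<le> 4 \<and> (length (filter h ?Ix) = 4 \<longrightarrow> map h [0..<8] \<in> tuples R_II2)"
        if "h 7" "\<not> h 6" "sat_all ?G h" for h
        using that(3) unfolding sat[OF that(1,2)] mem_R_II2 using that(1,2) by auto
      show "\<not> h 6" if "h 7" "sat_all ?G h" for h using that g0[of h, OF that(1)] by simp
      show "sat_all ?G h \<and> length (filter h ?Ix) = 4" if "map h [0..<8] \<in> tuples R_II2" for h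
      proof -
        have "h 7" "\<not> h 6" using that unfolding mem_R_II2 by auto
        from sat[OF this] that show ?thesis unfolding mem_R_II2 by auto
      qed
    qed auto
    then show ?thesis by blast
  next
    case False
    obtain a b c where abc: "a \<in> tuples R2" "b \<in> tuples R2" "c \<in> tuples R2"
      "map (\<lambda>i. maj (a ! i) (b ! i) (\<not> c ! i)) [0..<length a] \<notin> tuples R2"
      using R2 by (auto simp: closed3_def)
    have l2: "length a = arity R2" "length b = arity R2" "length c = arity R2" using len R2(1) abc by blast+
    note g2 = pat3_sat[OF abc(1-3) l2 abc(4)]
    \<comment> \<open>Without the conjunction, \<open>pat2\<close> expresses disequality, so the
      slots 3 to 5 become the complements that \<open>pat3\<close> requires.\<close>
    let ?NE = "[?g0, (R1, pat2 s t 0 3), (R1, pat2 s t 1 4), (R1, pat2 s t 2 5)]"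
    have ne: "sat_all ?NE h \<longleftrightarrow> h 3 = (\<not> h 0) \<and> h 4 = (\<not> h 1) \<and> h 5 = (\<not> h 2)" if "h 7" "\<not> h 6" for h
    proof -
      have "map h (pat2 s t u v) \<in> tuples R1 \<longleftrightarrow> h v = (\<not> h u)" for u v
        using g1[of h u v, OF that(2,1)] False by blast
      then show ?thesis using g0[of h, OF that(1)] that(2) by simp
    qed
    show ?thesis
    proof (cases "map (\<lambda>i. maj (a ! i) (b ! i) (c ! i)) [0..<length a] \<in> tuples R2")
      case True
      let ?G = "?NE @ [(R2, pat3 a b c (0, 3) (1, 4) (6, 7)), (R2, pat3 a b c (0, 3) (2, 5) (6, 7)),
        (R2, pat3 a b c (1, 4) (2, 5) (6, 7))]"
      let ?Ix = "[0, 1, 2]"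
      have sat: "sat_all ?G h \<longleftrightarrow> h 3 = (\<not> h 0) \<and> h 4 = (\<not> h 1) \<and> h 5 = (\<not> h 2) \<and>
          \<not> (h 0 \<and> h 1) \<and> \<not> (h 0 \<and> h 2) \<and> \<not> (h 1 \<and> h 2)" if h: "h 7" "\<not> h 6" for h
      proof (cases "h 3 = (\<not> h 0) \<and> h 4 = (\<not> h 1) \<and> h 5 = (\<not> h 2)")
        case n: True
        have nand: "map h (pat3 a b c p q (6, 7)) \<in> tuples R2 \<longleftrightarrow> \<not> (h (fst p) \<and> h (fst q))"
          if "h (snd p) = (\<not> h (fst p))" "h (snd q) = (\<not> h (fst q))" for p q
        proof -
          have n3: "h (snd (6::nat, 7::nat)) = (\<not> h (fst (6::nat, 7::nat)))" using h by simp
          note gg = g2[of h p q "(6, 7)", OF h(2,1) that n3]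
          show ?thesis using gg True h by (cases "h (fst p)"; cases "h (fst q)") simp_all
        qed
        have app: "sat_all (A @ B) h \<longleftrightarrow> sat_all A h \<and> sat_all B h" for A B by (auto simp: sat_all_def)
        show ?thesis unfolding app ne[of h, OF h]
          using n nand[of "(0, 3)" "(1, 4)"] nand[of "(0, 3)" "(2, 5)"] nand[of "(1, 4)" "(2, 5)"] by simp
      next
        case False
        moreover have "sat_all ?G h \<Longrightarrow> sat_all ?NE h" by simp
        ultimately show ?thesis using ne[of h, OF h] by blast
      qed
      have "gadget \<Gamma> ?G (?Ix @ replicate 10 7) (1 + 10)"
      proof (rule gadgetI)
        show "R \<in> \<Gamma> \<and> length is = arity R \<and> set is \<subseteq> {..<8}" if "(R, is) \<in> set ?G" for R "is"
          using that R0(1) R1(1) R2(1) l0 l1 l2 by (auto dest: mem_pat1 mem_pat2 mem_pat3)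
        show "length (filter h ?Ix) \<le> 1 \<and> (length (filter h ?Ix) = 1 \<longrightarrow> map h [0..<8] \<in> tuples R_II2)"
          if "h 7" "\<not> h 6" "sat_all ?G h" for h
          using that(3) unfolding sat[OF that(1,2)] mem_R_II2 using that(1,2) by auto
        show "\<not> h 6" if "h 7" "sat_all ?G h" for h using that g0[of h, OF that(1)] by simp
        show "sat_all ?G h \<and> length (filter h ?Ix) = 1" if "map h [0..<8] \<in> tuples R_II2" for h
        proof -
          have "h 7" "\<not> h 6" using that unfolding mem_R_II2 by auto
          from sat[OF this] that show ?thesis unfolding mem_R_II2 by auto
        qed
      qed auto
      then show ?thesis by blast
    next
      case no000: False
      let ?G = "?NE @ [(R2, pat3 a b c (0, 3) (1, 4) (2, 5)), (R2, pat3 a b c (0, 3) (2, 5) (1, 4)),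
        (R2, pat3 a b c (1, 4) (2, 5) (0, 3))]"
      let ?Ix = "[3, 4, 5]"
      have ne': "h 3 = (\<not> h 0) \<and> h 4 = (\<not> h 1) \<and> h 5 = (\<not> h 2)" if "h 7" "\<not> h 6" "sat_all ?G h" for h
      proof -
        have "sat_all ?NE h" using that(3) by simp
        then show ?thesis unfolding ne[of h, OF that(1,2)] .
      qed
      have "gadget \<Gamma> ?G (?Ix @ replicate 10 7) (2 + 10)"
      proof (rule gadgetI)
        show "R \<in> \<Gamma> \<and> length is = arity R \<and> set is \<subseteq> {..<8}" if "(R, is) \<in> set ?G" for R "is"
          using that R0(1) R1(1) R2(1) l0 l1 l2 by (auto dest: mem_pat1 mem_pat2 mem_pat3)
        show "length (filter h ?Ix) \<le> 2 \<and> (length (filter h ?Ix) = 2 \<longrightarrow> map h [0..<8] \<in> tuples R_II2)"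
          if h: "h 7" "\<not> h 6" "sat_all ?G h" for h
        proof -
          note n = ne'[OF h]
          have "\<not> (\<not> h 0 \<and> \<not> h 1 \<and> \<not> h 2)"
            using g2(3)[of h "(0, 3)" "(1, 4)" "(2, 5)", OF h(2,1)] n h(3) no000 by auto
          moreover have "\<not> (h 0 \<and> h 1 \<and> \<not> h 2)" using g2(2)[of h "(0, 3)" "(1, 4)"
              "(2, 5)", OF h(2,1)] n h(3) by auto
          moreover have "\<not> (h 0 \<and> h 2 \<and> \<not> h 1)" using g2(2)[of h "(0, 3)" "(2, 5)"
              "(1, 4)", OF h(2,1)] n h(3) by auto
          moreover have "\<not> (h 1 \<and> h 2 \<and> \<not> h 0)" using g2(2)[of h "(1, 4)" "(2, 5)"
              "(0, 3)", OF h(2,1)] n h(3) by auto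
          ultimately show ?thesis unfolding mem_R_II2 using n h(1,2) by auto
        qed
        show "\<not> h 6" if "h 7" "sat_all ?G h" for h using that g0[of h, OF that(1)] by simp
        show "sat_all ?G h \<and> length (filter h ?Ix) = 2" if R: "map h [0..<8] \<in> tuples R_II2" for h
        proof -
          have h: "h 7" "\<not> h 6" and n: "h 3 = (\<not> h 0)" "h 4 = (\<not> h 1)" "h 5 = (\<not> h 2)"
            using R unfolding mem_R_II2 by auto
          have "sat_all ?NE h" using ne[OF h] n by simp
          moreover have "map h (pat3 a b c (0, 3) (1, 4) (2, 5)) \<in> tuples R2"
            by (rule g2(1)) (use h n R in \<open>auto simp: mem_R_II2\<close>)
          moreover have "map h (pat3 a b c (0, 3) (2, 5) (1, 4)) \<in> tuples R2"
            by (rule g2(1)) (use h n R in \<open>auto simp: mem_R_II2\<close>)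
          moreover have "map h (pat3 a b c (1, 4) (2, 5) (0, 3)) \<in> tuples R2"
            by (rule g2(1)) (use h n R in \<open>auto simp: mem_R_II2\<close>)
          ultimately show ?thesis using R n unfolding mem_R_II2 by auto
        qed
      qed auto
      then show ?thesis by blast
    qed
  qed
qed

section \<open>Replacing constraints and boosting weights\<close>

definition occurrences :: "nat list \<Rightarrow> nat list list \<Rightarrow> nat list" where
  "occurrences Ix cs = concat (map (\<lambda>vs. map (nth_or 0 vs) Ix) cs)"

definition boost_data :: "(brel \<times> nat list) list \<Rightarrow> nat \<Rightarrow> nat \<Rightarrow> nat list \<Rightarrow> wmo_data \<Rightarrow> wmo_data" where
  "boost_data G K M occ I = (let t = (if fst (snd (snd I)) then (False, 0, 1) else snd (snd I)) in
     (map (\<lambda>p. (False, fst (snd (snd p)) + M * length (filter (\<lambda>u. u = fst p) occ) * snd (snd (snd p)), snd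
         (snd (snd p))))
        (zip [0..<length (fst I)] (fst I)),
      concat (map (\<lambda>C. map (\<lambda>g. (fst g, map (nth_or 0 (snd C)) (snd g))) (map (\<lambda>g. (truth_table (fst g),
          snd g)) G)) (fst (snd I))),
      (False, fst (snd t) + M * (K * length (fst (snd I))) * snd (snd t), snd (snd t))))"

text \<open>Denominators are at least 1, so the sum of the numerators bounds the total weight. This
  yields the natural number \<open>M\<close> without adding fractions.\<close>

definition hard_data :: "(brel \<times> nat list) list \<Rightarrow> nat list \<Rightarrow> nat \<Rightarrow> wmo_data \<Rightarrow> wmo_data" where
  "hard_data G Ix K I = boost_data G K (Suc (sum_list (map (\<lambda>w. fst (snd w)) (fst I))))
     (occurrences Ix (map snd (fst (snd I)))) I"

lemma FP_hard_data: "FP (hard_data G Ix K)"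
  unfolding hard_data_def[abs_def] boost_data_def Let_def occurrences_def by (intro FP_intros)

text \<open>A negative threshold is raised to 0; otherwise the new threshold could be reached
  without maximal gadget weight in every constraint.\<close>

definition boost_instance :: "(brel \<times> nat list) list \<Rightarrow> nat \<Rightarrow> nat \<Rightarrow> nat list \<Rightarrow> wmo_instance \<Rightarrow> wmo_instance" where
  "boost_instance G K M occ I =
     \<lparr>weights = map (\<lambda>v. weights I ! v + of_nat (M * length (filter (\<lambda>u. u = v) occ))) [0..<length (weights I)],
      constraints = concat (map (\<lambda>C. map (\<lambda>g. (fst g, map (nth_or 0 (snd C)) (snd g))) G) (constraints I)),
      threshold = max 0 (threshold I) + of_nat (M * (K * length (constraints I)))\<rparr>"

definition hard_instance :: "(brel \<times> nat list) list \<Rightarrow> nat list \<Rightarrow> nat \<Rightarrow> wmo_instance \<Rightarrow> wmo_instance" where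
  "hard_instance G Ix K I = boost_instance G K (Suc (sum_list (map (\<lambda>w. fst (snd (rat_rep w))) (weights I))))
     (occurrences Ix (map snd (constraints I))) I"

text \<open>Encoded fractions are in lowest terms. Adding a multiple of the denominator to the
  numerator keeps them so, hence the boosted weights can be written down without computing a
  gcd.\<close>

lemma rat_rep_add_nat:
  assumes "0 \<le> r"
  shows "rat_rep (r + of_nat k) = (False, fst (snd (rat_rep r)) + k * snd (snd (rat_rep r)), snd (snd
      (rat_rep r)))"
proof -
  obtain a b where r: "rat_rep r = (False, a, b)" "b > 0" "r = of_nat a / of_nat b" "coprime a b"
    using assms by (rule rat_rep_nonneg)
  have "r + of_nat k = of_nat (a + k * b) / of_nat b" using r by (simp add: field_simps)
  moreover have "coprime (a + k * b) b" using r(4) by (simp add: coprime_iff_gcd_eq_1 gcd.commute[of _ b]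
      gcd_add_mult add.commute[of a])
  ultimately show ?thesis using r(1) rat_rep_fraction[OF r(2), of "a + k * b"] by simp
qed

lemma wmo_rep_boost_instance:
  assumes I: "I \<in> wmo_instances \<Gamma>"
  shows "wmo_rep (boost_instance G K M occ I) = boost_data G K M occ (wmo_rep I)"
proof -
  have w: "0 \<le> weights I ! v" if "v < length (weights I)" for v using I that by (auto simp: wmo_instances_def)
  have t: "rat_rep (max 0 (threshold I)) = (if fst (rat_rep (threshold I)) then (False, 0, 1) else rat_rep
      (threshold I))"
    by (auto simp: rat_rep_neg max_def) (simp add: rat_rep_def)
  have 1: "map rat_rep (map (\<lambda>v. weights I ! v + of_nat (N v)) [0..<length (weights I)]) =
      map (\<lambda>p. (False, fst (snd (snd p)) + N (fst p) * snd (snd (snd p)), snd (snd (snd p))))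
        (zip [0..<length (map rat_rep (weights I))] (map rat_rep (weights I)))" for N
    by (rule nth_equalityI) (auto simp: rat_rep_add_nat w)
  have 2: "rat_rep (max 0 (threshold I) + of_nat k) = (False, fst (snd (rat_rep (max 0 (threshold I)))) +
      k * snd (snd (rat_rep (max 0 (threshold I)))), snd (snd (rat_rep (max 0 (threshold I)))))" for k
    by (rule rat_rep_add_nat) simp
  show ?thesis
    unfolding boost_data_def boost_instance_def wmo_rep_def Let_def fst_conv snd_conv
        wmo_instance.select_convs 1 2
    by (simp add: t map_concat o_def)
qed

lemma wmo_rep_hard_instance:
  assumes I: "I \<in> wmo_instances \<Gamma>"
  shows "wmo_rep (hard_instance G Ix K I) = hard_data G Ix K (wmo_rep I)"
  unfolding hard_instance_def wmo_rep_boost_instance[OF I] hard_data_def by (simp add: wmo_rep_def o_def)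

lemma hard_instance_correct:
  assumes gad: "gadget \<Gamma> G Ix K" and I: "I \<in> wmo_instances {R_II2}"
  shows "hard_instance G Ix K I \<in> wmo_instances \<Gamma>"
    and "wmo_yes (hard_instance G Ix K I) \<longleftrightarrow> wmo_yes I"
    and "length (weights (hard_instance G Ix K I)) = length (weights I)"
proof -
  let ?J = "hard_instance G Ix K I" and ?n = "length (weights I)"
  define M where "M = Suc (sum_list (map (\<lambda>w. fst (snd (rat_rep w))) (weights I)))"
  define occ where "occ = occurrences Ix (map snd (constraints I))"
  have J: "weights ?J = map (\<lambda>v. weights I ! v + of_nat (M * length (filter (\<lambda>u. u = v) occ))) [0..<?n]"
    "constraints ?J = concat (map (\<lambda>C. map (\<lambda>g. (fst g, map (nth_or 0 (snd C)) (snd g))) G) (constraints I))"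
    "threshold ?J = max 0 (threshold I) + of_nat (M * (K * length (constraints I)))"
    unfolding hard_instance_def boost_instance_def M_def occ_def by (simp_all only: wmo_instance.select_convs)
  show len: "length (weights ?J) = ?n" by (simp add: J)
  have w: "0 \<le> weights I ! v" if "v < ?n" for v using I that by (auto simp: wmo_instances_def)
  have C: "length vs = 8" "set vs \<subseteq> {..<?n}" if "(R, vs) \<in> set (constraints I)" for R vs
    using wmo_instances_constraint[OF I that] by (auto simp: R_II2_def)
  have Gs: "R \<in> \<Gamma> \<and> length is = arity R \<and> set is \<subseteq> {..<8}" if "(R, is) \<in> set G" for R "is"
    using gad that unfolding gadget_def by blast
  have Ix: "set Ix \<subseteq> {..<8}" using gad unfolding gadget_def by blast
  have nth: "nth_or 0 vs i = vs ! i" "vs ! i < ?n" if "(R, vs) \<in> set (constraints I)" "i < 8" for R vs i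
    using C[OF that(1)] that(2) subsetD[OF C(2)[OF that(1)] nth_mem[of i vs]] by (auto simp: nth_or_def)
  show "?J \<in> wmo_instances \<Gamma>"
    unfolding wmo_instances_def
  proof (intro CollectI conjI ballI)
    show "0 \<le> x" if "x \<in> set (weights ?J)" for x using that w by (auto simp: J)
    fix D assume "D \<in> set (constraints ?J)"
    then obtain R vs R' "is" where D: "(R, vs) \<in> set (constraints I)" "(R', is) \<in> set G"
      "D = (R', map (nth_or 0 vs) is)" by (auto simp: J)
    have "nth_or 0 vs i < ?n" if "i \<in> set is" for i using nth[OF D(1)] Gs[OF D(2)] that by fastforce
    then show "case D of (R, vs) \<Rightarrow> R \<in> \<Gamma> \<and> length vs = arity R \<and> set vs \<subseteq> wmo_var ?J"
      unfolding D(3) wmo_var_def len using Gs[OF D(2)] by auto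
  qed
  define gw where "gw h vs = length (filter (\<lambda>i. h (vs ! i)) Ix)" for h :: "nat \<Rightarrow> bool" and vs :: "nat list"
  have sol: "wmo_solution ?J h \<longleftrightarrow> (\<forall>(R, vs)\<in>set (constraints I). sat_all G (\<lambda>i. h (vs ! i)))" for h
  proof -
    have e: "map h (map (nth_or 0 vs) is) = map (\<lambda>i. h (vs ! i)) is"
      if "(R, vs) \<in> set (constraints I)" "(R', is) \<in> set G" for R vs R' "is"
      using nth(1)[OF that(1)] Gs[OF that(2)] by auto
    have "wmo_solution ?J h \<longleftrightarrow> (\<forall>C\<in>set (constraints I). \<forall>g\<in>set G. map h (map (nth_or 0 (snd C)) (snd g)) \<in>
        tuples (fst g))"
      by (auto simp: wmo_solution_def J)
    also have "\<dots> \<longleftrightarrow> (\<forall>C\<in>set (constraints I). \<forall>g\<in>set G. map (\<lambda>i. h (snd C ! i)) (snd g) \<in> tuples (fst g))"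
      by (intro ball_cong refl) (use e in \<open>metis prod.collapse\<close>)
    finally show ?thesis by (auto simp: sat_all_def case_prod_beta)
  qed
  have val: "wmo_value ?J h = wmo_value I h + of_nat (M * (\<Sum>C\<leftarrow>constraints I. gw h (snd C)))" for h
  proof -
    \<comment> \<open>Double counting: the occurrences of set variables, grouped by
      variable.\<close>
    have count: "(\<Sum>v<?n. length (filter (\<lambda>u. u = v) us) * of_bool (h v)) = length (filter h us)"
      if "set us \<subseteq> {..<?n}" for us
      using that
    proof (induction us)
      case (Cons u us)
      have "(\<Sum>v<?n. length (filter (\<lambda>x. x = v) (u # us)) * of_bool (h v)) =
          (\<Sum>v<?n. (if v = u then of_bool (h v) else 0) + length (filter (\<lambda>x. x = v) us) * of_bool (h v))"
        by (rule sum.cong) auto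
      also have "\<dots> = of_bool (h u) + length (filter h us)"
        using Cons by (simp add: sum.distrib sum.delta)
      finally show ?case by simp
    qed simp
    have occs: "length (filter h (occurrences Ix (map snd cs))) = (\<Sum>C\<leftarrow>cs. gw h (snd C)) \<and>
        set (occurrences Ix (map snd cs)) \<subseteq> {..<?n}" if "set cs \<subseteq> set (constraints I)" for cs
      using that
    proof (induction cs)
      case (Cons D cs)
      obtain R vs where D: "D = (R, vs)" by (cases D)
      then have "(R, vs) \<in> set (constraints I)" using Cons.prems by simp
      note n = nth[OF this]
      have "filter h (map (nth_or 0 vs) Ix) = map (nth_or 0 vs) (filter (\<lambda>i. h (vs ! i)) Ix)"
        unfolding filter_map o_def using n(1) Ix by (intro arg_cong[where f = "map _"] filter_cong) auto
      then have "length (filter h (map (nth_or 0 vs) Ix)) = gw h vs" by (simp add: gw_def)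
      moreover have "set (map (nth_or 0 vs) Ix) \<subseteq> {..<?n}" using n Ix by fastforce
      ultimately show ?case using Cons D by (simp add: occurrences_def)
    qed (simp add: occurrences_def)
    have "wmo_value ?J h = (\<Sum>v<?n. weights I ! v * of_bool (h v) +
        of_nat (M * (length (filter (\<lambda>u. u = v) occ) * of_bool (h v))))"
      unfolding wmo_value_def wmo_var_def len by (rule sum.cong) (auto simp: J algebra_simps)
    also have "\<dots> = wmo_value I h + of_nat (M * (\<Sum>v<?n. length (filter (\<lambda>u. u = v) occ) * of_bool (h v)))"
      unfolding sum.distrib wmo_value_def wmo_var_def sum_distrib_left of_nat_sum ..
    also have "(\<Sum>v<?n. length (filter (\<lambda>u. u = v) occ) * of_bool (h v)) = (\<Sum>C\<leftarrow>constraints I. gw h (snd C))"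
      using count occs[of "constraints I"] by (simp add: occ_def)
    finally show ?thesis .
  qed
  have big: "wmo_value I h < of_nat M" for h
  proof -
    have "wmo_value I h \<le> (\<Sum>v<?n. of_nat (fst (snd (rat_rep (weights I ! v)))))"
      unfolding wmo_value_def wmo_var_def
    proof (rule sum_mono)
      fix v assume "v \<in> {..<?n}"
      then obtain a b where "rat_rep (weights I ! v) = (False, a, b)" "b > 0"
          "weights I ! v = of_nat a / of_nat b"
        using rat_rep_nonneg[OF w[of v]] by blast
      then show "weights I ! v * of_bool (h v) \<le> of_nat (fst (snd (rat_rep (weights I ! v))))"
        by (auto simp: divide_le_eq mult_le_cancel_left1)
    qed
    also have "\<dots> = of_nat (\<Sum>v<?n. fst (snd (rat_rep (weights I ! v))))" by simp
    also have "(\<Sum>v<?n. fst (snd (rat_rep (weights I ! v)))) = sum_list (map (\<lambda>w. fst (snd (rat_rep w)))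
        (weights I))"
      by (simp add: sum_list_sum_nth atLeast0LessThan)
    also have "\<dots> < M" by (simp add: M_def)
    finally show ?thesis by simp
  qed
  have gR: "sat_all G (\<lambda>i. h (vs ! i)) \<Longrightarrow> gw h vs \<le> K"
    "sat_all G (\<lambda>i. h (vs ! i)) \<and> gw h vs = K \<longleftrightarrow> map h vs \<in> tuples R_II2" if "(R, vs) \<in> set (constraints I)"
        for h R vs
  proof -
    have e: "map (\<lambda>i. h (vs ! i)) [0..<8] = map h vs" by (rule nth_equalityI) (use C(1)[OF that] in auto)
    have "\<forall>h. sat_all G h \<longrightarrow> length (filter h Ix) \<le> K"
      "\<forall>h. sat_all G h \<and> length (filter h Ix) = K \<longleftrightarrow> map h [0..<8] \<in> tuples R_II2"
      using gad unfolding gadget_def by blast+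
    from this[THEN spec, of "\<lambda>i. h (vs ! i)"] show "sat_all G (\<lambda>i. h (vs ! i)) \<Longrightarrow> gw h vs \<le> K"
      "sat_all G (\<lambda>i. h (vs ! i)) \<and> gw h vs = K \<longleftrightarrow> map h vs \<in> tuples R_II2"
      unfolding gw_def e by blast+
  qed
  have RI: "R = R_II2" if "(R, vs) \<in> set (constraints I)" for R vs
      using wmo_instances_constraint(1)[OF I that] by simp
  show "wmo_yes ?J \<longleftrightarrow> wmo_yes I"
  proof
    assume "wmo_yes I"
    then obtain h where h: "wmo_solution I h" "threshold I \<le> wmo_value I h" by (auto simp: wmo_yes_def)
    have all: "sat_all G (\<lambda>i. h (vs ! i)) \<and> gw h vs = K" if "(R, vs) \<in> set (constraints I)" for R vs
      using gR(2)[OF that, of h] h(1) that RI[OF that] by (auto simp: wmo_solution_def)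
    have "(\<Sum>C\<leftarrow>cs. gw h (snd C)) = K * length cs" if "set cs \<subseteq> set (constraints I)" for cs
      using that
    proof (induction cs)
      case (Cons C cs) then show ?case using all[of "fst C" "snd C"] by simp
    qed simp
    then have "wmo_value ?J h = wmo_value I h + of_nat (M * (K * length (constraints I)))" by (simp add: val)
    then have "threshold ?J \<le> wmo_value ?J h" using h(2) wmo_value_nonneg[OF I, of h] by (simp add: J)
    moreover have "wmo_solution ?J h" unfolding sol using all by blast
    ultimately show "wmo_yes ?J" by (auto simp: wmo_yes_def)
  next
    assume "wmo_yes ?J"
    then obtain h where h: "wmo_solution ?J h" "threshold ?J \<le> wmo_value ?J h" by (auto simp: wmo_yes_def)
    have sat: "sat_all G (\<lambda>i. h (vs ! i))" if "(R, vs) \<in> set (constraints I)" for R vs using h(1) that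
        unfolding sol by blast
    have le: "(\<Sum>C\<leftarrow>cs. gw h (snd C)) \<le> K * length cs \<and>
       ((\<exists>C\<in>set cs. gw h (snd C) \<noteq> K) \<longrightarrow> Suc (\<Sum>C\<leftarrow>cs. gw h (snd C)) \<le> K * length cs)"
           if "set cs \<subseteq> set (constraints I)" for cs
      using that
    proof (induction cs)
      case (Cons C cs)
      have "gw h (snd C) \<le> K" using gR(1)[of "fst C" "snd C" h] sat[of "fst C" "snd C"] Cons.prems by simp
      then show ?case using Cons by auto
    qed simp
    have thr: "of_nat (M * (K * length (constraints I))) \<le> wmo_value I h + of_nat (M * (\<Sum>C\<leftarrow>constraints I.
        gw h (snd C)))"
      using h(2) unfolding val J(3) by linarith
    \<comment> \<open>One gadget below \<open>K\<close> costs at least \<open>M\<close>, more than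
      the original weights can make up for.\<close>
    have "gw h (snd C) = K" if "C \<in> set (constraints I)" for C
    proof (rule ccontr)
      assume "gw h (snd C) \<noteq> K"
      then have "Suc (\<Sum>C\<leftarrow>constraints I. gw h (snd C)) \<le> K * length (constraints I)"
          using le[of "constraints I"] that by blast
      then have "M * Suc (\<Sum>C\<leftarrow>constraints I. gw h (snd C)) \<le> M * (K * length (constraints I))"
          by (rule mult_le_mono2)
      then have "M + M * (\<Sum>C\<leftarrow>constraints I. gw h (snd C)) \<le> M * (K * length (constraints I))" by simp
      then have "(of_nat (M + M * (\<Sum>C\<leftarrow>constraints I. gw h (snd C))) :: rat) \<le> of_nat (M * (K * length
          (constraints I)))"
        by (simp only: of_nat_le_iff)
      then show False using thr big[of h] unfolding of_nat_add by linarith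
    qed
    then have "map h vs \<in> tuples R" if "(R, vs) \<in> set (constraints I)" for R vs
      using gR(2)[OF that, of h] sat[OF that] RI[OF that] that by force
    then have "wmo_solution I h" by (auto simp: wmo_solution_def)
    moreover have "(of_nat (M * (\<Sum>C\<leftarrow>constraints I. gw h (snd C))) :: rat) \<le> of_nat (M * (K * length
        (constraints I)))"
      unfolding of_nat_le_iff using le[of "constraints I"] by (intro mult_le_mono2) blast
    then have "threshold I \<le> wmo_value I h" using h(2) unfolding val J(3) by linarith
    ultimately show "wmo_yes I" by (auto simp: wmo_yes_def)
  qed
qed

section \<open>Polynomial-time computability and clocked programs\<close>

lemma pbound_poly: "pbound D (\<lambda>i. poly (p :: nat poly) (s i)) s"
proof (induction p)
  case 0
  then show ?case by (simp add: pbound_const)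
next
  case (pCons a p)
  then show ?case by (simp add: pbound_intros)
qed

lemma ptime_imp_poly_time_computable:
  assumes "ptime D ein (\<lambda>i. eout (f i))"
  shows "poly_time_computable ein eout D f"
proof -
  obtain P c where P: "\<forall>i\<in>D. runs P (clean (ein i)) (clean (eout (f i))) ((length (ein i) + 2) ^ c)"
    using assms unfolding ptime_def by blast
  have "poly ([:2, 1:] ^ c) n = (n + 2) ^ c" for n :: nat by (simp add: add.commute)
  then have "outputs_within P [ein i] (poly ([:2, 1:] ^ c) (length (ein i))) (eout (f i))" if "i \<in> D" for i
    using P that unfolding outputs_within_def runs_def clean_init_store[symmetric]
    by (metis clean_simps(1))
  then show ?thesis unfolding poly_time_computable_def by blast
qed

section \<open>Erasing leftovers of a computation\<close>

fun clear_upto :: "nat \<Rightarrow> prog" where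
  "clear_upto 0 = Skip"
| "clear_upto (Suc n) = Seq (clear (Suc n)) (clear_upto n)"

lemma runs_clear_upto:
  "(\<And>i. 0 < i \<Longrightarrow> i \<le> n \<Longrightarrow> length (s i) \<le> B) \<Longrightarrow>
    runs (clear_upto n) s (\<lambda>i. if 0 < i \<and> i \<le> n then [] else s i) (n * (2 * B + 1) + 1)"
proof (induction n arbitrary: s)
  case 0
  have "(\<lambda>i. if 0 < i \<and> i \<le> 0 then [] else s i) = s" by auto
  then show ?case using runs_Skip[of s] by (simp del: One_nat_def)
next
  case (Suc n)
  let ?s = "s(Suc n := [])"
  have "runs (clear (Suc n)) s ?s (2 * B + 1)"
    by (rule runs_mono[OF runs_clear]) (use Suc.prems in auto)
  moreover have "runs (clear_upto n) ?s (\<lambda>i. if 0 < i \<and> i \<le> n then [] else ?s i) (n * (2 * B + 1) + 1)"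
    by (rule Suc.IH) (use Suc.prems in auto)
  ultimately have "runs (clear_upto (Suc n)) s (\<lambda>i. if 0 < i \<and> i \<le> n then [] else ?s i) ((2 * B + 1) + (n *
      (2 * B + 1) + 1))"
    unfolding clear_upto.simps by (rule runs_Seq)
  then show ?case by (rule runs_cong) (auto simp: fun_eq_iff)
qed

lemma exec_untouched:
  assumes "exec P s t s'" "below N P" "N \<le> i"
  shows "s' i = s i"
proof -
  have "exec P s t (\<lambda>i. if i < N then s' i else s i)" by (rule exec_frame[OF assms(1,2)]) simp
  then have "(\<lambda>i. if i < N then s' i else s i) = s'" using exec_deterministic[OF assms(1)] by blast
  then have "(\<lambda>i. if i < N then s' i else s i) i = s' i" by (rule fun_cong)
  then show ?thesis using assms(3) by simp
qed

text \<open>The computation model allows arbitrary leftovers on the other stacks. They lie below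
  \<open>N\<close> and each is no longer than the running time, so erasing them takes polynomial
  time.\<close>

lemma poly_time_computable_imp_ptime:
  assumes "poly_time_computable ein eout D f"
  shows "ptime D ein (\<lambda>i. eout (f i))"
proof -
  obtain P and p :: "nat poly" where P: "\<forall>x\<in>D. outputs_within P [ein x] (poly p (length (ein x))) (eout (f x))"
    using assms unfolding poly_time_computable_def by blast
  obtain N where N: "N > 0" "below N P" using ex_below by blast
  let ?T = "\<lambda>i. poly p (length (ein i))"
  show ?thesis
  proof (rule ptimeI)
    show "pbound D (\<lambda>i. ?T i + (N * (2 * ?T i + 1) + 1)) (\<lambda>i. length (ein i))"
      by (intro pbound_intros pbound_poly)
    fix i assume i: "i \<in> D"
    then obtain t s where s: "exec P (clean (ein i)) t s" "t \<le> ?T i" "s 0 = eout (f i)"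
      using P unfolding outputs_within_def clean_init_store[symmetric] by blast
    have "length (s k) \<le> ?T i" if "0 < k" for k
      using exec_length[OF s(1), of k] that s(2) by simp
    then have 1: "runs (clear_upto N) s (\<lambda>k. if 0 < k \<and> k \<le> N then [] else s k) (N * (2 * ?T i + 1) + 1)"
      by (intro runs_clear_upto) simp
    have e: "(\<lambda>k. if 0 < k \<and> k \<le> N then [] else s k) = clean (eout (f i))"
      using exec_untouched[OF s(1) N(2)] s(3) by (auto simp: fun_eq_iff clean_def)
    have 2: "runs P (clean (ein i)) s (?T i)" using s unfolding runs_def by blast
    show "runs (Seq P (clear_upto N)) (clean (ein i)) (clean (eout (f i))) (?T i + (N * (2 * ?T i + 1) + 1))"
      by (rule runs_Seq[OF 2 1[unfolded e]])
  qed
qed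

text \<open>
  An NP verifier has to halt on every word, but programs for \<open>FP\<close> functions are only controlled on
  encodings. The following transformation makes every loop stop when the clock stack \<open>k\<close> is empty;
  the stack \<open>f\<close> holds the outcomes of the loop tests.
\<close>

definition loop_test :: "nat \<Rightarrow> nat \<Rightarrow> nat \<Rightarrow> symbol option set \<Rightarrow> prog" where
  "loop_test k f r A = IfTop r A (IfTop k (range Some) (Push f B1) (Push f B0)) (Push f B0)"

text \<open>A loop test sees a single stack, so the conjunction of the original test with a nonempty
  clock has to be recorded on \<open>f\<close> first. Every iteration pops one clock symbol.\<close>

fun clocked :: "nat \<Rightarrow> nat \<Rightarrow> prog \<Rightarrow> prog" where
  "clocked k f (Seq p q) = Seq (clocked k f p) (clocked k f q)"
| "clocked k f (IfTop r A p q) = IfTop r A (clocked k f p) (clocked k f q)"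
| "clocked k f (WhileTop r A p) = Seq (loop_test k f r A) (Seq (WhileTop f {Some B1}
     (Seq (Pop f) (Seq (clocked k f p) (Seq (Pop k) (loop_test k f r A))))) (Pop f))"
| "clocked k f p = p"

lemma exec_loop_test:
  "\<exists>t\<le>3. exec (loop_test k f r A) s t (s(f := (if top_of (s r) \<in> A \<and> s k \<noteq> [] then B1 else B0) # s f))"
proof -
  let ?b = "if top_of (s r) \<in> A \<and> s k \<noteq> [] then B1 else B0"
  have "runs (loop_test k f r A) s (s(f := ?b # s f)) (Suc (Suc 1))"
    unfolding loop_test_def
  proof (rule runs_If)
    show "runs (IfTop k (range Some) (Push f B1) (Push f B0)) s (s(f := ?b # s f)) (Suc 1)"
        if "top_of (s r) \<in> A"
      by (rule runs_If; rule runs_cong[OF runs_Push]) (use that in auto)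
    show "runs (Push f B0) s (s(f := ?b # s f)) (Suc 1)" if "top_of (s r) \<notin> A"
      by (rule runs_cong[OF runs_Push]) (use that in auto)
  qed
  then show ?thesis by (auto simp: runs_def numeral_3_eq_3)
qed

text \<open>The clock length times \<open>b\<close> is a potential that pays for the running time.
  In this amortised form the estimate composes along sequences and through nested loops, whose
  bodies draw on the same clock.\<close>

lemma clocked_halts:
  assumes "below N P" "N \<le> k" "N \<le> f" "k \<noteq> f"
  shows "\<exists>a b. \<forall>s. \<exists>t s'. exec (clocked k f P) s t s' \<and> s' f = s f \<and> length (s' k) \<le> length (s k) \<and>
    t + b * length (s' k) \<le> a + b * length (s k)"
  (is "\<exists>a b. \<forall>s. ?H P a b s")
  using assms(1)
proof (induction P)
  case Skip
  show ?case by (rule exI[of _ 1], rule exI[of _ 0]) (use exec_Skip in fastforce)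
next
  case (Push r x)
  have "r \<noteq> k" "r \<noteq> f" using Push assms by auto
  then have "?H (Push r x) 1 0 s" for s
    unfolding clocked.simps by (intro exI[of _ 1] exI[of _ "s(r := x # s r)"] conjI exec_Push) simp_all
  then show ?case by blast
next
  case (Pop r)
  have "r \<noteq> k" "r \<noteq> f" using Pop assms by auto
  then have "?H (Pop r) 1 0 s" for s
    unfolding clocked.simps by (intro exI[of _ 1] exI[of _ "s(r := tl (s r))"] conjI exec_Pop) simp_all
  then show ?case by blast
next
  case (Seq p q)
  obtain a b where p: "\<forall>s. ?H p a b s" using Seq by auto
  obtain a' b' where q: "\<forall>s. ?H q a' b' s" using Seq by auto
  have "?H (Seq p q) (a + a') (b + b') s" for s
  proof -
    obtain t1 s1 where 1: "exec (clocked k f p) s t1 s1" "s1 f = s f" "length (s1 k) \<le> length (s k)"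
      "t1 + b * length (s1 k) \<le> a + b * length (s k)" using p by blast
    obtain t2 s2 where 2: "exec (clocked k f q) s1 t2 s2" "s2 f = s1 f" "length (s2 k) \<le> length (s1 k)"
      "t2 + b' * length (s2 k) \<le> a' + b' * length (s1 k)" using q by blast
    have m: "b * length (s2 k) \<le> b * length (s1 k)" "b' * length (s1 k) \<le> b' * length (s k)"
      using 1(3) 2(3) by (simp_all add: mult_le_mono2)
    have "exec (clocked k f (Seq p q)) s (t1 + t2) s2" using exec_Seq[OF 1(1) 2(1)] by simp
    moreover have "t1 + t2 + (b + b') * length (s2 k) \<le> (a + a') + (b + b') * length (s k)"
      unfolding add_mult_distrib using 1(4) 2(4) m by linarith
    ultimately show ?thesis using 1 2 by (intro exI[of _ "t1 + t2"] exI[of _ s2]) simp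
  qed
  then show ?case by blast
next
  case (IfTop r A p q)
  obtain a b where p: "\<forall>s. ?H p a b s" using IfTop by auto
  obtain a' b' where q: "\<forall>s. ?H q a' b' s" using IfTop by auto
  have "?H (IfTop r A p q) (a + a' + 1) (b + b') s" for s
  proof (cases "top_of (s r) \<in> A")
    case True
    obtain t1 s1 where 1: "exec (clocked k f p) s t1 s1" "s1 f = s f" "length (s1 k) \<le> length (s k)"
      "t1 + b * length (s1 k) \<le> a + b * length (s k)" using p by blast
    have "b' * length (s1 k) \<le> b' * length (s k)" using 1(3) by (simp add: mult_le_mono2)
    then have "Suc t1 + (b + b') * length (s1 k) \<le> (a + a' + 1) + (b + b') * length (s k)"
      unfolding add_mult_distrib using 1(4) by linarith
    then show ?thesis using 1 exec_IfTrue[OF True 1(1)] by (intro exI[of _ "Suc t1"] exI[of _ s1]) simp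
  next
    case False
    obtain t1 s1 where 1: "exec (clocked k f q) s t1 s1" "s1 f = s f" "length (s1 k) \<le> length (s k)"
      "t1 + b' * length (s1 k) \<le> a' + b' * length (s k)" using q by blast
    have "b * length (s1 k) \<le> b * length (s k)" using 1(3) by (simp add: mult_le_mono2)
    then have "Suc t1 + (b + b') * length (s1 k) \<le> (a + a' + 1) + (b + b') * length (s k)"
      unfolding add_mult_distrib using 1(4) by linarith
    then show ?thesis using 1 exec_IfFalse[OF False 1(1)] by (intro exI[of _ "Suc t1"] exI[of _ s1]) simp
  qed
  then show ?case by blast
next
  case (WhileTop r A p)
  have r: "r \<noteq> k" "r \<noteq> f" using WhileTop.prems assms by auto
  obtain a b where p: "\<forall>s. ?H p a b s" using WhileTop by auto
  \<comment> \<open>A clock symbol has to pay for the constant cost \<open>a\<close> of the body,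
    for the rate \<open>b\<close> at which the body itself uses the clock, and for the 6 units of
    overhead of one iteration.\<close>
  define B where "B = a + b + 6"
  let ?test = "loop_test k f r A"
  let ?body = "Seq (Pop f) (Seq (clocked k f p) (Seq (Pop k) ?test))"
  let ?W = "WhileTop f {Some B1} ?body"
  have loop: "\<exists>t s'. exec ?W s t s' \<and> s' f = B0 # w \<and> length (s' k) \<le> length (s k) \<and>
      t + B * length (s' k) \<le> 1 + B * length (s k)"
    if "s f = (if top_of (s r) \<in> A \<and> s k \<noteq> [] then B1 else B0) # w" for s w
    using that
  proof (induction "length (s k)" arbitrary: s rule: less_induct)
    case less
    show ?case
    proof (cases "top_of (s r) \<in> A \<and> s k \<noteq> []")
      case False
      then have "s f = B0 # w" using less.prems by auto
      moreover from this have "exec ?W s 1 s" by (intro exec_WhileFalse) simp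
      ultimately show ?thesis by (intro exI[of _ 1] exI[of _ s]) simp
    next
      case True
      then have sf: "s f = B1 # w" using less.prems by simp
      let ?s0 = "s(f := w)"
      have 0: "exec (Pop f) s 1 ?s0" using exec_Pop[of f s] sf by simp
      obtain t1 s1 where 1: "exec (clocked k f p) ?s0 t1 s1" "s1 f = w" "length (s1 k) \<le> length (s k)"
        "t1 + b * length (s1 k) \<le> a + b * length (s k)" using p[rule_format, of ?s0] assms(4) by auto
      let ?s2 = "s1(k := tl (s1 k))"
      have 2: "exec (Pop k) s1 1 ?s2" by (rule exec_Pop)
      let ?s3 = "?s2(f := (if top_of (?s2 r) \<in> A \<and> ?s2 k \<noteq> [] then B1 else B0) # ?s2 f)"
      obtain t3 where 3: "t3 \<le> 3" "exec ?test ?s2 t3 ?s3" using exec_loop_test by blast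
      have body: "exec ?body s (1 + (t1 + (1 + t3))) ?s3"
        by (intro exec_Seq[OF 0] exec_Seq[OF 1(1)] exec_Seq[OF 2] 3(2))
      have k3: "?s3 k = tl (s1 k)" using assms(4) by simp
      have ks: "length (s k) > 0" using True by simp
      have lt: "length (?s3 k) < length (s k)" using 1(3) ks unfolding k3 length_tl by linarith
      have f3: "?s3 f = (if top_of (?s3 r) \<in> A \<and> ?s3 k \<noteq> [] then B1 else B0) # w"
        using r assms(4) 1(2) by simp
      obtain t4 s4 where 4: "exec ?W ?s3 t4 s4" "s4 f = B0 # w" "length (s4 k) \<le> length (?s3 k)"
        "t4 + B * length (s4 k) \<le> 1 + B * length (?s3 k)" using less.hyps[OF lt f3] by blast
      have e: "exec ?W s (Suc ((1 + (t1 + (1 + t3))) + t4)) s4"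
        by (rule exec_WhileTrue[OF _ body 4(1)]) (simp add: sf)
      \<comment> \<open>If the body has emptied the clock, the pop after it frees nothing; then the
        symbols present at the start of the iteration, at least one, pay.\<close>
      have "t1 + 6 + B * length (tl (s1 k)) \<le> B * length (s k)"
      proof (cases "s1 k")
        case Nil
        then have "t1 + 6 \<le> (a + 6) + b * length (s k)" using 1(4) by simp
        also have "\<dots> \<le> (a + 6) * length (s k) + b * length (s k)"
          by (rule add_right_mono) (use mult_le_mono2[OF Suc_leI[OF ks], of "a + 6"] in \<open>simp only:
              mult_Suc_right mult_0_right add_0_right\<close>)
        finally show ?thesis using Nil by (simp add: B_def algebra_simps)
      next
        case (Cons x xs)
        obtain d where d: "length (s k) = length (s1 k) + d" using 1(3) le_Suc_ex by blast
        have "t1 \<le> a + b * d" using 1(4) unfolding d by (simp add: algebra_simps)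
        moreover have "b * d \<le> B * d" by (simp add: B_def)
        moreover have "a + 6 \<le> B" by (simp add: B_def)
        ultimately have "t1 + 6 + B * length xs \<le> B + B * d + B * length xs" by linarith
        then show ?thesis unfolding d Cons by (simp add: algebra_simps)
      qed
      then have "Suc ((1 + (t1 + (1 + t3))) + t4) + B * length (s4 k) \<le> 1 + B * length (s k)"
        using 4(4) 3(1) unfolding k3 by linarith
      then show ?thesis using e 4(2,3) lt by (intro exI[of _ "Suc ((1 + (t1 + (1 + t3))) + t4)"] exI[of _
          s4]) simp
    qed
  qed
  have "?H (WhileTop r A p) 5 B s" for s
  proof -
    let ?s1 = "s(f := (if top_of (s r) \<in> A \<and> s k \<noteq> [] then B1 else B0) # s f)"
    obtain t1 where 1: "t1 \<le> 3" "exec ?test s t1 ?s1" using exec_loop_test by blast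
    have "?s1 f = (if top_of (?s1 r) \<in> A \<and> ?s1 k \<noteq> [] then B1 else B0) # s f" using r assms(4) by simp
    from loop[OF this] obtain t2 s2 where 2: "exec ?W ?s1 t2 s2" "s2 f = B0 # s f"
        "length (s2 k) \<le> length (?s1 k)"
      "t2 + B * length (s2 k) \<le> 1 + B * length (?s1 k)" by blast
    have 3: "exec (Pop f) s2 1 (s2(f := s f))" using exec_Pop[of f s2] 2(2) by simp
    have e: "exec (clocked k f (WhileTop r A p)) s (t1 + (t2 + 1)) (s2(f := s f))"
      unfolding clocked.simps by (intro exec_Seq[OF 1(2)] exec_Seq[OF 2(1)] 3)
    have "t1 + (t2 + 1) + B * length (s2 k) \<le> 5 + B * length (s k)" using 1(1) 2(4) assms(4) by simp
    with 2(3) assms(4) show ?thesis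
      by - (intro exI[of _ "t1 + (t2 + 1)"] exI[of _ "s2(f := s f)"] conjI, rule e, simp_all)
  qed
  then show ?case by blast
qed

text \<open>The clocked run consumes at most one clock symbol per time unit of the original run, so
  a clock as long as the original running time does not expire early.\<close>

lemma clocked_simulates:
  assumes "N \<le> k" "N \<le> f" "k \<noteq> f"
  shows "exec P s t s' \<Longrightarrow> below N P \<Longrightarrow> (\<And>i. i < N \<Longrightarrow> r i = s i) \<Longrightarrow> t \<le> length (r k) \<Longrightarrow>
    \<exists>t' r'. exec (clocked k f P) r t' r' \<and> (\<forall>i<N. r' i = s' i) \<and> length (r k) \<le> length (r' k) + t \<and> r' f = r f"
proof (induction arbitrary: r rule: exec.induct)
  case (exec_Skip s)
  then show ?case by (intro exI[of _ 1] exI[of _ r]) (use exec.exec_Skip in auto)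
next
  case (exec_Push q a s)
  then have q: "q < N" "q \<noteq> k" "q \<noteq> f" using assms by auto
  have e: "exec (clocked k f (Push q a)) r 1 (r(q := a # r q))"
    unfolding clocked.simps by (rule exec.exec_Push)
  show ?case
    by (intro exI[of _ 1] exI[of _ "r(q := a # r q)"] conjI, rule e) (use q exec_Push.prems(2) in simp_all)
next
  case (exec_Pop q s)
  then have q: "q < N" "q \<noteq> k" "q \<noteq> f" using assms by auto
  have e: "exec (clocked k f (Pop q)) r 1 (r(q := tl (r q)))"
    unfolding clocked.simps by (rule exec.exec_Pop)
  show ?case
    by (intro exI[of _ 1] exI[of _ "r(q := tl (r q))"] conjI, rule e) (use q exec_Pop.prems(2) in simp_all)
next
  case (exec_Seq p s m s' q n s'')
  have b: "below N p" "below N q" using exec_Seq.prems(1) by auto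
  obtain t1 r1 where 1: "exec (clocked k f p) r t1 r1" "\<forall>i<N. r1 i = s' i"
      "length (r k) \<le> length (r1 k) + m" "r1 f = r f"
    using exec_Seq.IH(1)[OF b(1) exec_Seq.prems(2)] exec_Seq.prems(3) by auto
  obtain t2 r2 where 2: "exec (clocked k f q) r1 t2 r2" "\<forall>i<N. r2 i = s'' i"
      "length (r1 k) \<le> length (r2 k) + n" "r2 f = r1 f"
    using exec_Seq.IH(2)[OF b(2), of r1] 1 exec_Seq.prems(3) by auto
  show ?case using exec.exec_Seq[OF 1(1) 2(1)] 1 2 by (intro exI[of _ "t1 + t2"] exI[of _ r2]) simp
next
  case (exec_IfTrue s q A p n s' p')
  have b: "below N p" "q < N" using exec_IfTrue.prems(1) by auto
  obtain t1 r1 where 1: "exec (clocked k f p) r t1 r1" "\<forall>i<N. r1 i = s' i"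
      "length (r k) \<le> length (r1 k) + n" "r1 f = r f"
    using exec_IfTrue.IH[OF b(1) exec_IfTrue.prems(2)] exec_IfTrue.prems(3) by auto
  have "top_of (r q) \<in> A" using exec_IfTrue.hyps exec_IfTrue.prems(2)[OF b(2)] by simp
  from exec.exec_IfTrue[OF this 1(1)] show ?case using 1 by (intro exI[of _ "Suc t1"] exI[of _ r1]) simp
next
  case (exec_IfFalse s q A p n s' p')
  have b: "below N p" "q < N" using exec_IfFalse.prems(1) by auto
  obtain t1 r1 where 1: "exec (clocked k f p) r t1 r1" "\<forall>i<N. r1 i = s' i"
      "length (r k) \<le> length (r1 k) + n" "r1 f = r f"
    using exec_IfFalse.IH[OF b(1) exec_IfFalse.prems(2)] exec_IfFalse.prems(3) by auto
  have "top_of (r q) \<notin> A" using exec_IfFalse.hyps exec_IfFalse.prems(2)[OF b(2)] by simp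
  from exec.exec_IfFalse[OF this 1(1)] show ?case using 1 by (intro exI[of _ "Suc t1"] exI[of _ r1]) simp
next
  case (exec_WhileFalse s q A p)
  have q: "q < N" using exec_WhileFalse.prems(1) by simp
  have top: "top_of (r q) \<notin> A" using exec_WhileFalse.hyps exec_WhileFalse.prems(2)[OF q] by simp
  let ?r1 = "r(f := B0 # r f)"
  obtain t1 where 1: "exec (loop_test k f q A) r t1 ?r1" using exec_loop_test[of k f q A r] top by auto
  let ?body = "Seq (Pop f) (Seq (clocked k f p) (Seq (Pop k) (loop_test k f q A)))"
  have 2: "exec (WhileTop f {Some B1} ?body) ?r1 1 ?r1" by (rule exec.exec_WhileFalse) simp
  have 3: "exec (Pop f) ?r1 1 r" using exec.exec_Pop[of f ?r1] by simp
  have "exec (clocked k f (WhileTop q A p)) r (t1 + (1 + 1)) r"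
    unfolding clocked.simps by (intro exec.exec_Seq[OF 1] exec.exec_Seq[OF 2] 3)
  then show ?case using exec_WhileFalse.prems(2) by (intro exI[of _ "t1 + (1 + 1)"] exI[of _ r]) simp
next
  case (exec_WhileTrue s q A p m s' n s'')
  have b: "below N p" "q < N" using exec_WhileTrue.prems(1) by auto
  have top: "top_of (r q) \<in> A" using exec_WhileTrue.hyps(1) exec_WhileTrue.prems(2)[OF b(2)] by simp
  have rk: "Suc (m + n) \<le> length (r k)" by (rule exec_WhileTrue.prems(3))
  then have ne: "r k \<noteq> []" by auto
  let ?test = "loop_test k f q A"
  let ?body = "Seq (Pop f) (Seq (clocked k f p) (Seq (Pop k) ?test))"
  let ?W = "WhileTop f {Some B1} ?body"
  let ?r0 = "r(f := B1 # r f)"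
  obtain t0 where 0: "exec ?test r t0 ?r0" using exec_loop_test[of k f q A r] top ne by auto
  have pf: "exec (Pop f) ?r0 1 r" using exec.exec_Pop[of f ?r0] by simp
  have "m \<le> length (r k)" using rk by simp
  from exec_WhileTrue.IH(1)[OF b(1) exec_WhileTrue.prems(2) this]
  obtain t1 r1 where 1: "exec (clocked k f p) r t1 r1" "\<forall>i<N. r1 i = s' i"
      "length (r k) \<le> length (r1 k) + m" "r1 f = r f"
    by blast
  let ?r2 = "r1(k := tl (r1 k))"
  have pk: "exec (Pop k) r1 1 ?r2" by (rule exec.exec_Pop)
  have "\<exists>t' r'. exec (clocked k f (WhileTop q A p)) ?r2 t' r' \<and> (\<forall>i<N. r' i = s'' i) \<and>
      length (?r2 k) \<le> length (r' k) + n \<and> r' f = ?r2 f"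
    by (rule exec_WhileTrue.IH(2)[OF exec_WhileTrue.prems(1)]) (use 1 rk assms in auto)
  then obtain t2 r3 where 2: "exec (clocked k f (WhileTop q A p)) ?r2 t2 r3" "\<forall>i<N. r3 i = s'' i"
      "length (?r2 k) \<le> length (r3 k) + n" "r3 f = ?r2 f" by blast
  from 2(1)[unfolded clocked.simps] obtain u1 u2 u3 ra rb where u: "exec ?test ?r2 u1 ra"
      "exec ?W ra u2 rb" "exec (Pop f) rb u3 r3"
    by (auto elim!: exec_SeqE)
  have body: "exec ?body ?r0 (1 + (t1 + (1 + u1))) ra"
    by (intro exec.exec_Seq[OF pf] exec.exec_Seq[OF 1(1)] exec.exec_Seq[OF pk] u(1))
  have W: "exec ?W ?r0 (Suc ((1 + (t1 + (1 + u1))) + u2)) rb"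
    by (rule exec.exec_WhileTrue[OF _ body u(2)]) simp
  have "exec (clocked k f (WhileTop q A p)) r (t0 + (Suc ((1 + (t1 + (1 + u1))) + u2) + u3)) r3"
    unfolding clocked.simps by (intro exec.exec_Seq[OF 0] exec.exec_Seq[OF W] u(3))
  moreover have "r3 f = r f" using 2(4) 1(4) assms by simp
  moreover have "length (r k) \<le> length (r3 k) + Suc (m + n)" using 1(3) 2(3) by simp
  ultimately show ?case using 2(2) by blast
qed

section \<open>Membership in NP and the reductions\<close>

text \<open>The length of the clock is multiplied by \<open>length w + 2\<close>, so
  \<open>c\<close> rounds produce \<open>(length w + 2) ^ c\<close>, the form of the time bounds in
  \<open>ptime\<close>. Stack \<open>k + 1\<close> stays free for the flags of the clocked
  program.\<close>

definition clock_mult :: "nat \<Rightarrow> prog" where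
  "clock_mult k = Seq (move k (k + 2)) (WhileTop (k + 2) (range Some)
     (Seq (Pop (k + 2)) (Seq (copy 0 k (k + 3)) (Seq (Push k B0) (Push k B0)))))"

definition with_clock :: "nat \<Rightarrow> word \<Rightarrow> word \<Rightarrow> store" where
  "with_clock k w u = (clean w)(k := u)"

lemma runs_clock_mult:
  assumes "k > 0"
  shows "\<exists>u'. length u' = length u * (length w + 2) \<and>
    runs (clock_mult k) (with_clock k w u) (with_clock k w u') ((6 * length u + 1) + (length u * (16 *
        length w + 6) + 1))"
proof -
  let ?body = "Seq (Pop (k + 2)) (Seq (copy 0 k (k + 3)) (Seq (Push k B0) (Push k B0)))"
  let ?W = "WhileTop (k + 2) (range Some) ?body"
  have loop: "\<exists>u'. length u' = length u + length v * (length w + 2) \<and>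
    runs ?W ((with_clock k w u)(k + 2 := v)) (with_clock k w u') (length v * (16 * length w + 6) + 1)" for u v
  proof (induction v arbitrary: u)
    case Nil
    have e: "(with_clock k w u)(k + 2 := []) = with_clock k w u" using assms
        by (auto simp: with_clock_def fun_eq_iff)
    have "runs ?W (with_clock k w u) (with_clock k w u) 1"
      by (rule runs_WhileFalse) (use assms in \<open>simp add: with_clock_def\<close>)
    then show ?case unfolding e by (intro exI[of _ u]) simp
  next
    case (Cons x v)
    let ?s = "\<lambda>u v. (with_clock k w u)(k + 2 := v)"
    let ?u = "B0 # B0 # rev w @ u"
    have 1: "runs (Pop (k + 2)) (?s u (x # v)) (?s u v) 1"
      by (rule runs_cong[OF runs_Pop]) auto
    have 2: "runs (copy 0 k (k + 3)) (?s u v) (?s (rev w @ u) v) (16 * length w + 2)"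
      by (rule runs_mono[OF runs_copy]) (use assms in \<open>auto simp: with_clock_def fun_eq_iff\<close>)
    have 3: "runs (Push k B0) (?s z v) (?s (B0 # z) v) 1" for z
      by (rule runs_cong[OF runs_Push]) (use assms in \<open>auto simp: with_clock_def fun_eq_iff\<close>)
    have body: "runs ?body (?s u (x # v)) (?s ?u v) (1 + ((16 * length w + 2) + (1 + 1)))"
      by (intro runs_Seq[OF 1] runs_Seq[OF 2] runs_Seq[OF 3] 3)
    obtain u' where u': "length u' = length ?u + length v * (length w + 2)"
      "runs ?W (?s ?u v) (with_clock k w u') (length v * (16 * length w + 6) + 1)" using Cons.IH by blast
    have R: "runs ?W (?s u (x # v)) (with_clock k w u') (length (x # v) * (16 * length w + 6) + 1)"
      by (rule runs_mono[OF runs_WhileTrue[OF _ body u'(2)]]) auto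
    show ?case by (intro exI[of _ u'] conjI R) (use u'(1) in simp)
  qed
  have 1: "runs (move k (k + 2)) (with_clock k w u) ((with_clock k w [])(k + 2 := rev u)) (6 * length u + 1)"
    by (rule runs_mono[OF runs_move]) (use assms in \<open>auto simp: with_clock_def fun_eq_iff\<close>)
  obtain u' where u': "length u' = length ([] :: word) + length (rev u) * (length w + 2)"
    "runs ?W ((with_clock k w [])(k + 2 := rev u)) (with_clock k w u') (length (rev u) * (16 * length w +
        6) + 1)"
    using loop by blast
  show ?thesis unfolding clock_mult_def
    by (intro exI[of _ u'] conjI) (use u'(1) runs_Seq[OF 1 u'(2)] in simp_all)
qed

lemma ex_clock_program:
  assumes "k > 0"
  shows "\<exists>P T. pbound UNIV T length \<and>
    (\<forall>w. \<exists>u. length u = (length w + 2) ^ c \<and> runs P (clean w) (with_clock k w u) (T w))"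
proof (induction c)
  case 0
  have "runs (Push k B0) (clean w) (with_clock k w [B0]) 1" for w
    by (rule runs_cong[OF runs_Push]) (use assms in \<open>auto simp: with_clock_def\<close>)
  then show ?case by (intro exI[of _ "Push k B0"] exI[of _ "\<lambda>_. 1"]) (auto simp: pbound_const intro!:
      exI[of _ "[B0]"])
next
  case (Suc c)
  then obtain P T where P: "pbound UNIV T length"
    "\<forall>w. \<exists>u. length u = (length w + 2) ^ c \<and> runs P (clean w) (with_clock k w u) (T w)" by blast
  let ?T = "\<lambda>w :: word. T w + ((6 * (length w + 2) ^ c + 1) + ((length w + 2) ^ c * (16 * length w + 6) + 1))"
  have "\<exists>u. length u = (length w + 2) ^ Suc c \<and> runs (Seq P (clock_mult k)) (clean w) (with_clock k w u)
      (?T w)" for w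
  proof -
    obtain u where u: "length u = (length w + 2) ^ c" "runs P (clean w) (with_clock k w u) (T w)"
        using P(2) by blast
    obtain u' where u': "length u' = length u * (length w + 2)"
      "runs (clock_mult k) (with_clock k w u) (with_clock k w u') ((6 * length u + 1) + (length u * (16 *
          length w + 6) + 1))"
      using runs_clock_mult[OF assms] by blast
    show ?thesis using runs_Seq[OF u(2) u'(2)] u'(1) u(1) by (intro exI[of _ u']) simp
  qed
  moreover have "pbound UNIV ?T length" by (intro pbound_intros pbound_power P(1))
  ultimately show ?case by blast
qed

text \<open>Any word is read as an assignment, so that certificates need not be validated.\<close>

definition certificate :: "word \<Rightarrow> bool list" where
  "certificate y = rev (map (\<lambda>x. x = B1) y)"

text \<open>Turns the two input stacks of a verifier into the encoding of a pair. Popping the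
  certificate reverses it, which accounts for the \<open>rev\<close> in
  \<open>certificate\<close>.\<close>

definition join_inputs :: prog where
  "join_inputs = Seq (Push 2 RP) (Seq (WhileTop 1 (range Some) (Seq (IfTop 1 {Some B1} (Push 2 B1) (Push 2
      B0)) (Pop 1)))
     (Seq (Push 2 LP) (Seq (move 0 1) (Seq (move 2 3) (Seq (move 3 0) (move 1 0))))))"

lemma encode_bool_list: "encode bs = LP # map (\<lambda>b. if b then B1 else B0) bs @ [RP]"
proof -
  have "concat (map encode bs) = map (\<lambda>b. if b then B1 else B0) bs"
    by (induction bs) (simp_all add: encode_bool_def enc_bool_def)
  then show ?thesis by (simp add: encode_list_def)
qed

lemma runs_join_inputs:
  "runs join_inputs (init_store [x, y]) (clean (x @ encode (certificate y))) (20 * (length x + length y) + 50)"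
proof -
  define st where "st a b c d = (\<lambda>i::nat. if i = 0 then a else if i = 1 then b else if i = 2 then c else
      if i = 3 then d else [])"
    for a b c d :: word
  let ?f = "\<lambda>x. if x = B1 then B1 else B0"
  have 0: "init_store [x, y] = st x y [] []" by (auto simp: init_store_def st_def fun_eq_iff nth_Cons')
  have 1: "runs (Push 2 RP) (st x y [] []) (st x y [RP] []) 1"
    by (rule runs_cong[OF runs_Push]) (auto simp: st_def fun_eq_iff)
  let ?W = "WhileTop 1 (range Some) (Seq (IfTop 1 {Some B1} (Push 2 B1) (Push 2 B0)) (Pop 1))"
  have 2: "runs ?W (st x y c []) (st x [] (rev (map ?f y) @ c) []) (4 * length y + 1)" for c
  proof (induction y arbitrary: c)
    case Nil
    show ?case by (rule runs_cong[OF runs_WhileFalse]) (auto simp: st_def)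
  next
    case (Cons a y)
    have "runs (IfTop 1 {Some B1} (Push 2 B1) (Push 2 B0)) (st x (a # y) c []) (st x (a # y) (?f a # c) [])
        (Suc 1)"
      by (rule runs_If; rule runs_cong[OF runs_Push]) (auto simp: st_def fun_eq_iff)
    moreover have "runs (Pop 1) (st x (a # y) (?f a # c) []) (st x y (?f a # c) []) 1"
      by (rule runs_cong[OF runs_Pop]) (auto simp: st_def fun_eq_iff)
    ultimately have b: "runs (Seq (IfTop 1 {Some B1} (Push 2 B1) (Push 2 B0)) (Pop 1)) (st x (a # y) c [])
        (st x y (?f a # c) []) (Suc 1 + 1)"
      by (rule runs_Seq)
    show ?case by (rule runs_cong[OF runs_WhileTrue[OF _ b Cons.IH]]) (auto simp: st_def)
  qed
  let ?c = "rev (map ?f y) @ [RP]"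
  have 3: "runs (Push 2 LP) (st x [] ?c []) (st x [] (LP # ?c) []) 1"
    by (rule runs_cong[OF runs_Push]) (auto simp: st_def fun_eq_iff)
  have 4: "runs (move 0 1) (st x [] (LP # ?c) []) (st [] (rev x) (LP # ?c) []) (6 * length x + 1)"
    by (rule runs_mono[OF runs_move]) (auto simp: st_def fun_eq_iff)
  have 5: "runs (move 2 3) (st [] (rev x) (LP # ?c) []) (st [] (rev x) [] (rev (LP # ?c))) (6 * length y + 20)"
    by (rule runs_mono[OF runs_move]) (auto simp: st_def fun_eq_iff)
  have 6: "runs (move 3 0) (st [] (rev x) [] (rev (LP # ?c))) (st (LP # ?c) (rev x) [] []) (6 * length y + 20)"
    by (rule runs_mono[OF runs_move]) (auto simp: st_def fun_eq_iff)
  have c: "encode (certificate y) = LP # ?c"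
    by (simp add: encode_bool_list certificate_def rev_map)
  have 7: "runs (move 1 0) (st (LP # ?c) (rev x) [] []) (clean (x @ encode (certificate y))) (6 * length x + 1)"
    unfolding c by (rule runs_mono[OF runs_move]) (auto simp: st_def clean_def fun_eq_iff)
  show ?thesis unfolding 0 join_inputs_def
    by (rule runs_mono[OF runs_Seq[OF 1 runs_Seq[OF 2 runs_Seq[OF 3 runs_Seq[OF 4 runs_Seq[OF 5 runs_Seq[OF
        6 7]]]]]]]) simp
qed

text \<open>The verifier relation is read off the clocked program on arbitrary words. On encodings
  the clock is long enough for it to agree with \<open>g\<close>; elsewhere it suffices that the
  program halts in time.\<close>

lemma in_NP_of_verifier:
  fixes g :: "'a::data \<Rightarrow> bool list \<Rightarrow> bool"
  assumes g: "FP (\<lambda>p. g (fst p) (snd p))"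
  shows "\<exists>L. in_NP L \<and> (\<forall>a. encode a \<in> L \<longleftrightarrow> (\<exists>y. length y \<le> size_of a \<and> g a (certificate y)))"
proof -
  obtain P c where P: "\<And>p. runs P (clean (encode p)) (clean (encode (g (fst p) (snd p)))) ((size_of p + 2) ^ c)"
    using g unfolding FP_def ptime_def by blast
  obtain N where N: "N > 0" "below N P" using ex_below by blast
  define k where "k = N"
  have k: "k > 0" "N \<le> k" "N \<le> Suc k" "k \<noteq> Suc k" using N by (auto simp: k_def)
  obtain Q T where Q: "pbound UNIV T (length :: word \<Rightarrow> nat)"
    "\<forall>w. \<exists>u. length u = (length w + 2) ^ c \<and> runs Q (clean w) (with_clock k w u) (T w)"
    using ex_clock_program[OF k(1), of c] by blast
  obtain a b where ab: "\<forall>s. \<exists>t s'. exec (clocked k (Suc k) P) s t s' \<and> s' (Suc k) = s (Suc k) \<and>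
      length (s' k) \<le> length (s k) \<and> t + b * length (s' k) \<le> a + b * length (s k)"
    using clocked_halts[OF N(2) k(2-4)] by blast
  let ?C = "clocked k (Suc k) P"
  let ?out = "IfTop 0 {Some B1} (Seq (clear 0) (Push 0 B1)) (Seq (clear 0) (Push 0 B0))"
  let ?V = "Seq join_inputs (Seq Q (Seq ?C ?out))"
  define w where "w x y = x @ encode (certificate y)" for x y
  define ver where "ver x y \<longleftrightarrow> (\<exists>u t s. length u = (length (w x y) + 2) ^ c \<and>
      runs Q (clean (w x y)) (with_clock k (w x y) u) (T (w x y)) \<and>
    exec ?C (with_clock k (w x y) u) t s \<and> top_of (s 0) = Some B1)" for x y
  define S where "S v = a + b * (length v + 2) ^ c" for v :: word
  have lenw: "length (w x y) = length x + length y + 2" for x y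
    by (simp add: w_def encode_bool_list certificate_def)
  define TT where "TT v = (20 * length v + 50) + (T v + (S v + Suc ((2 * (length v + S v) + 1) + 1)))"
      for v :: word
  have run: "outputs_within ?V [x, y] (TT (w x y)) [if ver x y then B1 else B0]" for x y
  proof -
    obtain u where u: "length u = (length (w x y) + 2) ^ c" "runs Q (clean (w x y)) (with_clock k (w x y)
        u) (T (w x y))"
      using Q(2) by blast
    obtain t s where s: "exec ?C (with_clock k (w x y) u) t s" "t + b * length (s k) \<le> a + b * length u"
      using ab[rule_format, of "with_clock k (w x y) u"] by (auto simp: with_clock_def)
    have t: "t \<le> S (w x y)" using s(2) u(1) by (simp add: S_def)
    have ver: "ver x y \<longleftrightarrow> top_of (s 0) = Some B1"
    proof
      assume "ver x y"
      then obtain u' t' s' where u': "runs Q (clean (w x y)) (with_clock k (w x y) u') (T (w x y))"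
        "exec ?C (with_clock k (w x y) u') t' s'" "top_of (s' 0) = Some B1" unfolding ver_def by blast
      have "with_clock k (w x y) u' = with_clock k (w x y) u"
        using u(2) u'(1) unfolding runs_def by (auto dest: exec_deterministic)
      then have "s' = s" using u'(2) s(1) exec_deterministic by metis
      then show "top_of (s 0) = Some B1" using u'(3) by simp
    qed (use u s(1) in \<open>unfold ver_def, blast\<close>)
    have l: "length (s 0) \<le> length (w x y) + S (w x y)"
      using exec_length[OF s(1), of 0] t k(1) by (simp add: with_clock_def)
    have fin: "runs (Seq (clear 0) (Push 0 z)) s (s(0 := [z])) ((2 * (length (w x y) + S (w x y)) + 1) +
        1)" for z
    proof (rule runs_Seq)
      show "runs (clear 0) s (s(0 := [])) (2 * (length (w x y) + S (w x y)) + 1)"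
        by (rule runs_mono[OF runs_clear]) (use l in auto)
      show "runs (Push 0 z) (s(0 := [])) (s(0 := [z])) 1"
        by (rule runs_cong[OF runs_Push]) auto
    qed
    have out: "runs ?out s (s(0 := [if ver x y then B1 else B0])) (Suc ((2 * (length (w x y) + S (w x y)) +
        1) + 1))"
      by (rule runs_If; rule runs_cong[OF fin]) (use ver in auto)
    have j: "runs join_inputs (init_store [x, y]) (clean (w x y)) (20 * length (w x y) + 50)"
      using runs_join_inputs[of x y] unfolding w_def[symmetric] by (rule runs_mono) (simp add: lenw)
    have C: "runs ?C (with_clock k (w x y) u) s (S (w x y))" using s(1) t unfolding runs_def by blast
    have "runs ?V (init_store [x, y]) (s(0 := [if ver x y then B1 else B0])) (TT (w x y))"
      unfolding TT_def by (intro runs_Seq[OF j] runs_Seq[OF u(2)] runs_Seq[OF C] out)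
    then show ?thesis unfolding outputs_within_def runs_def by fastforce
  qed
  have correct: "ver (encode a) y \<longleftrightarrow> g a (certificate y)" for a :: 'a and y
  proof -
    have w: "w (encode a) y = encode (a, certificate y)" by (simp add: w_def encode_pair)
    obtain t where t: "t \<le> (length (w (encode a) y) + 2) ^ c" "exec P (clean (w (encode a) y)) t (clean
        (encode (g a (certificate y))))"
      using P[of "(a, certificate y)"] unfolding w runs_def by auto
    have sim: "s 0 = encode (g a (certificate y))"
      if "length u = (length (w (encode a) y) + 2) ^ c" "exec ?C (with_clock k (w (encode a) y) u) t' s"
          for u t' s
    proof -
      have "\<exists>t' r'. exec ?C (with_clock k (w (encode a) y) u) t' r' \<and>
          (\<forall>i<N. r' i = clean (encode (g a (certificate y))) i) \<and>
          length (with_clock k (w (encode a) y) u k) \<le> length (r' k) + t \<and>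
              r' (Suc k) = with_clock k (w (encode a) y) u (Suc k)"
        by (rule clocked_simulates[OF k(2-4) t(2) N(2)]) (use t(1) that(1) k in \<open>auto simp: with_clock_def\<close>)
      then obtain t'' r' where r': "exec ?C (with_clock k (w (encode a) y) u) t'' r'"
          "\<forall>i<N. r' i = clean (encode (g a (certificate y))) i"
        by blast
      have "r' = s" using exec_deterministic[OF that(2) r'(1)] by blast
      then show ?thesis using r'(2) N(1) by auto
    qed
    obtain u where u: "length u = (length (w (encode a) y) + 2) ^ c"
        "runs Q (clean (w (encode a) y)) (with_clock k (w (encode a) y) u) (T (w (encode a) y))"
      using Q(2) by blast
    obtain t' s where s: "exec ?C (with_clock k (w (encode a) y) u) t' s" using ab by blast
    show ?thesis
    proof
      assume "ver (encode a) y"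
      then obtain u t s where u: "length u = (length (w (encode a) y) + 2) ^ c"
          "exec ?C (with_clock k (w (encode a) y) u) t s" "top_of (s 0) = Some B1"
        unfolding ver_def by blast
      show "g a (certificate y)"
        using sim[OF u(1,2)] u(3) by (simp add: encode_bool_def enc_bool_def split: if_splits)
    next
      assume "g a (certificate y)"
      then have "top_of (s 0) = Some B1" using sim[OF u(1) s] by (simp add: encode_bool_def enc_bool_def)
      then show "ver (encode a) y" unfolding ver_def using u s by blast
    qed
  qed
  have "pbound UNIV TT length" unfolding TT_def S_def Suc_eq_plus1_left
      by (intro pbound_intros pbound_power Q(1))
  then obtain d where d: "\<And>v. TT v \<le> (length v + 2) ^ d" by (auto simp: pbound_def)
  \<comment> \<open>The certificate is no longer than \<open>x\<close>, so the joined input has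
    length at most \<open>2 * length x + 2\<close>.\<close>
  let ?p = "[:4, 2:] ^ d :: nat poly"
  have "outputs_within ?V [x, y] (poly ?p (length x)) [if ver x y then B1 else B0]"
      if "length y \<le> poly [:0, 1:] (length x)" for x y
  proof -
    have "TT (w x y) \<le> (length (w x y) + 2) ^ d" by (rule d)
    also have "\<dots> \<le> (2 * length x + 4) ^ d" using that by (intro power_mono) (auto simp: lenw)
    finally have "TT (w x y) \<le> poly ?p (length x)" by (simp add: algebra_simps)
    then show ?thesis using run[of x y] unfolding outputs_within_def using le_trans by blast
  qed
  then have "in_NP {x. \<exists>y. length y \<le> poly [:0, 1:] (length x) \<and> ver x y}" unfolding in_NP_def by blast
  then show ?thesis
    by (intro exI[of _ "{x. \<exists>y. length y \<le> poly [:0, 1:] (length x) \<and> ver x y}"]) (simp add: correct)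
qed

lemma wmo_in_NP:
  assumes G: "constraint_language \<Gamma>"
  shows "\<exists>L. in_NP L \<and> (\<forall>I\<in>wmo_instances \<Gamma>. enc_wmo I \<in> L \<longleftrightarrow> wmo_yes I)"
proof -
  have "FP (\<lambda>p :: wmo_data \<times> bool list. wmo_check (sat_set \<Gamma>) (fst p) (snd p))"
    by (intro FP_wmo_check finite_sat_set[OF G] FP_intros)
  from in_NP_of_verifier[OF this] obtain L where L: "in_NP L"
    "\<forall>a. encode a \<in> L \<longleftrightarrow> (\<exists>y. length y \<le> size_of a \<and> wmo_check (sat_set \<Gamma>) a (certificate y))" by blast
  have "enc_wmo I \<in> L \<longleftrightarrow> wmo_yes I" if I: "I \<in> wmo_instances \<Gamma>" for I
  proof -
    have "enc_wmo I \<in> L \<longleftrightarrow> (\<exists>y. length y \<le> size_of (wmo_rep I) \<and> wmo_check (sat_set \<Gamma>) (wmo_rep I)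
        (certificate y))"
      using L(2) by (metis encode_wmo_rep)
    also have "\<dots> \<longleftrightarrow> wmo_yes I"
    proof
      assume "wmo_yes I"
      then obtain h where h: "length h = length (weights I)" "wmo_check (sat_set \<Gamma>) (wmo_rep I) h"
        using wmo_yes_iff_check[OF G I] by blast
      let ?y = "rev (map (\<lambda>b. if b then B1 else B0) h)"
      have "certificate ?y = h" by (simp add: certificate_def rev_map o_def if_distrib cong: if_cong)
      moreover have "length h \<le> size_of (wmo_rep I)"
        using length_le_size_of[of "map rat_rep (weights I)"] h(1) by (simp add: wmo_rep_def encode_pair)
      ultimately show "\<exists>y. length y \<le> size_of (wmo_rep I) \<and> wmo_check (sat_set \<Gamma>) (wmo_rep I) (certificate y)"
        using h(2) by (intro exI[of _ ?y]) simp
    qed (use wmo_check_correct[OF G I] in \<open>auto simp: wmo_yes_def\<close>)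
    finally show ?thesis .
  qed
  then show ?thesis using L(1) by blast
qed

definition trivial_instance :: "wmo_instance \<Rightarrow> bool \<Rightarrow> wmo_instance" where
  "trivial_instance I b = \<lparr>weights = map (\<lambda>_. 0) (weights I), constraints = [], threshold = (if b then 0
      else 1)\<rparr>"

lemma rat_rep_01: "rat_rep 0 = (False, 0, 1)" "rat_rep 1 = (False, 1, 1)"
  by (simp_all add: rat_rep_def)

text \<open>The reduction \<open>f\<close> given by NP-hardness may produce instances with many more
  variables. It is therefore used only to compute the bit \<open>wmo_yes I\<close>, which is paired
  with \<open>I\<close> itself to build an instance with as many variables.\<close>

lemma CV_reducible_tractable:
  assumes \<Delta>: "constraint_language \<Delta>" and hard: "NP_hard (W_Max_Ones \<Gamma>)" and dec: "decides \<Gamma> d" "FP d"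
  shows "W_Max_Ones \<Delta> \<le>\<^sub>C\<^sub>V W_Max_Ones \<Gamma>"
proof -
  obtain L where L: "in_NP L" "\<forall>I\<in>wmo_instances \<Delta>. enc_wmo I \<in> L \<longleftrightarrow> wmo_yes I" using wmo_in_NP[OF \<Delta>] by blast
  obtain f where f: "\<forall>x. f x \<in> wmo_instances \<Gamma>" "\<forall>x. x \<in> L \<longleftrightarrow> wmo_yes (f x)"
    "poly_time_computable (\<lambda>x. x) enc_wmo UNIV f"
    using hard L(1) unfolding NP_hard_def W_Max_Ones_def by auto
  let ?D = "wmo_instances \<Delta>"
  let ?r = "\<lambda>I. trivial_instance I (wmo_yes I)"
  have 1: "ptime ?D enc_wmo (\<lambda>I. encode (wmo_rep (f (enc_wmo I))))"
    using ptime_reindex[OF poly_time_computable_imp_ptime[OF f(3)], of enc_wmo ?D] by (simp add: encode_wmo_rep)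
  have 2: "ptime ?D (\<lambda>I. encode (wmo_rep (f (enc_wmo I)))) (\<lambda>I. encode (d (wmo_rep (f (enc_wmo I)))))"
    using ptime_reindex[OF dec(2)[unfolded FP_def], of "\<lambda>I. wmo_rep (f (enc_wmo I))" ?D] by simp
  have 3: "d (wmo_rep (f (enc_wmo I))) = wmo_yes I" if "I \<in> ?D" for I
    using dec(1) f L(2) that unfolding decides_def by blast
  have "ptime ?D enc_wmo (\<lambda>I. encode (d (wmo_rep (f (enc_wmo I)))) @ enc_wmo I)"
    by (rule ptime_append[OF ptime_comp[OF 1 2] ptime_id])
  then have 4: "ptime ?D enc_wmo (\<lambda>I. encode (wmo_yes I, wmo_rep I))"
    by (rule ptime_cong) (simp_all add: 3 encode_pair encode_wmo_rep)
  let ?g = "\<lambda>p :: bool \<times> wmo_data. (map (\<lambda>_. (False, 0, 1)) (fst (snd p)), [],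
      if fst p then (False, 0, 1) else (False, 1, 1)) :: wmo_data"
  have "FP ?g" by (intro FP_intros)
  then have "ptime ?D (\<lambda>I. encode (wmo_yes I, wmo_rep I)) (\<lambda>I. encode (?g (wmo_yes I, wmo_rep I)))"
    unfolding FP_def by (rule ptime_reindex) simp
  moreover have "?g (wmo_yes I, wmo_rep I) = wmo_rep (?r I)" for I
    by (simp add: wmo_rep_def trivial_instance_def rat_rep_01 o_def)
  ultimately have 5: "ptime ?D enc_wmo (\<lambda>I. enc_wmo (?r I))"
    using ptime_comp[OF 4] by (simp add: encode_wmo_rep)
  have inst: "?r I \<in> wmo_instances \<Gamma>" for I by (auto simp: trivial_instance_def wmo_instances_def)
  have "wmo_value (?r I) h = 0" for I h
    unfolding wmo_value_def wmo_var_def by (rule sum.neutral) (simp add: trivial_instance_def)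
  then have yes: "wmo_yes (?r I) \<longleftrightarrow> wmo_yes I" for I
    by (simp add: wmo_yes_def[of "?r I"] wmo_solution_def) (simp add: trivial_instance_def)
  have "CV_reduction (W_Max_Ones \<Delta>) (W_Max_Ones \<Gamma>) ?r"
    unfolding CV_reduction_def W_Max_Ones_def
    using inst yes ptime_imp_poly_time_computable[where eout = enc_wmo and f = ?r, OF 5]
    by (auto simp: wmo_var_def trivial_instance_def intro!: exI[of _ 0])
  then show ?thesis unfolding CV_reducible_def by blast
qed

lemma CV_reducible_gadget:
  assumes "gadget \<Gamma> G Ix K"
  shows "W_Max_Ones {R_II2} \<le>\<^sub>C\<^sub>V W_Max_Ones \<Gamma>"
proof -
  let ?D = "wmo_instances {R_II2}"
  let ?r = "hard_instance G Ix K"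
  have "ptime ?D (\<lambda>I. encode (wmo_rep I)) (\<lambda>I. encode (hard_data G Ix K (wmo_rep I)))"
    using FP_hard_data unfolding FP_def by (rule ptime_reindex) simp
  then have "ptime ?D enc_wmo (\<lambda>I. enc_wmo (?r I))"
    by (rule ptime_cong) (simp_all add: encode_wmo_rep flip: wmo_rep_hard_instance)
  then have "poly_time_computable enc_wmo enc_wmo ?D ?r" by (rule ptime_imp_poly_time_computable)
  then have "CV_reduction (W_Max_Ones {R_II2}) (W_Max_Ones \<Gamma>) ?r"
    unfolding CV_reduction_def W_Max_Ones_def
    using hard_instance_correct[OF assms] by (auto simp: wmo_var_def intro!: exI[of _ 0])
  then show ?thesis unfolding CV_reducible_def by blast
qed

lemma constraint_language_R_II2: "constraint_language {R_II2}"
  by (auto simp: constraint_language_def R_II2_def)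

theorem theorem4:
  fixes \<Gamma> :: "brel set"
  assumes "constraint_language \<Gamma>"
    and "NP_hard (W_Max_Ones \<Gamma>)"
  shows "W_Max_Ones {R_II2} \<le>\<^sub>C\<^sub>V W_Max_Ones \<Gamma>"
proof -
  \<comment> \<open>The first two easy classes share the propagation algorithm and form one case; if
    all three fail, each failure provides a witness relation.\<close>
  consider "(\<forall>R\<in>\<Gamma>. tuples R = {} \<or> one_valid R) \<or> (\<forall>R\<in>\<Gamma>. or_closed R)"
    | "\<forall>R\<in>\<Gamma>. closed3 (\<lambda>x y z. maj x y (\<not> z)) (tuples R)"
    | R0 R1 R2 where "R0 \<in> \<Gamma>" "tuples R0 \<noteq> {}" "\<not> one_valid R0" "R1 \<in> \<Gamma>" "\<not> or_closed R1"
      "R2 \<in> \<Gamma>" "\<not> closed3 (\<lambda>x y z. maj x y (\<not> z)) (tuples R2)" by blast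
  then show ?thesis
  proof cases
    case 1
    show ?thesis
      by (rule CV_reducible_tractable[OF constraint_language_R_II2 assms(2) decides_max_model[OF assms(1) 1]])
        (intro FP_wmo_check finite_sat_set FP_max_model FP_id assms(1))
  next
    case 2
    show ?thesis
      by (rule CV_reducible_tractable[OF constraint_language_R_II2 assms(2) decides_two_affine_model[OF
          assms(1) 2]])
        (intro FP_wmo_check finite_sat_set FP_two_affine_model FP_id assms(1))
  next
    case 3
    then show ?thesis using ex_gadget[OF assms(1)] CV_reducible_gadget by metis
  qed
qed

end
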